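(* Consider the descriptor system $$A_nx(n+2)+B_nx(n+1)+C_nx(n)+D_nu(n)=f(n)\quad\text{for all } n\ge n_0,$$ with $A_n,B_n,C_n\in\mathbb R^{m,d}$, $D_n\in\mathbb R^{m,p}$, $f(n)\in\mathbb R^m$. Assume that the Constant Size Assumption (see context) is fulfilled at every step of the regularization procedure (see context) where it is needed. Then for each fixed input sequence $\{u(n)\}_{n\ge n_0}$, the descriptor system has the same solution set (in $x$) as a so-called strangeness-free descriptor system $$\begin{bmatrix} \hat A_{n,1} & \hat B_{n,1} & \hat C_{n,1} \\ 0 & \hat B_{n,2} & \hat C_{n,2} \\ 0 & 0 & \hat C_{n,3} \\ 0 & \hat B_{n,5} & \hat C_{n,5} \\ 0 & 0 & \hat C_{n,6} \\ 0 & 0 & 0 \end{bmatrix} \begin{bmatrix} x(n+2) \\ x(n+1) \\ x(n) \end{bmatrix} + \begin{bmatrix} \hat D_{n,1} \\ 0 \\ 0 \\ \hat D_{n,4} \\ \hat D_{n,5} \\ 0 \end{bmatrix} u(n) = \begin{bmatrix} \hat f_1(n) \\ \hat f_2(n) \\ \hat f_3(n) \\ \hat f_4(n) \\ \hat f_5(n) \\ \hat f_6(n) \end{bmatrix} \quad\text{for all } n\ge n_0,$$ with block rows of sizes $\hat r_2,\hat r_1,\hat r_0,\hat\varphi_1,\hat\varphi_0,\hat v$ (the coefficients and the right-hand side not depending on the input), where the matrices $\begin{bmatrix}\hat A_{n,1}^T&\hat B_{n+1,2}^T&\hat C_{n+2,3}^T\end{bmatrix}^T$ and $\begin{bmatrix}\hat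 D_{n,4}^T&\hat D_{n,5}^T\end{bmatrix}^T$ have full row rank for all $n\ge n_0$.
   Context: **Hidden redundancy.** The pair $(P,Q)$ of matrices with $d$ columns has no hidden redundancy if $\operatorname{rank}\begin{bmatrix} P \\ Q \end{bmatrix}=\operatorname{rank}P+\operatorname{rank}Q$. **Condensed form.** For any descriptor system as in the claim there exist pointwise nonsingular $U_n\in\mathbb R^{m,m}$, $V_n\in\mathbb R^{p,p}$ such that scaling with $U_n$ and substituting $u(n)=V_nv(n)$ yields $$\begin{bmatrix} A_{n,1} & B_{n,1} & C_{n,1} \\ 0 & B_{n,2} & C_{n,2} \\ 0 & 0 & C_{n,3} \\ 0 & B_{n,4} & C_{n,4} \\ 0 & 0 & C_{n,5} \\ 0 & 0 & 0 \end{bmatrix} \begin{bmatrix} x(n+2) \\ x(n+1) \\ x(n) \end{bmatrix} + \begin{bmatrix} D_{n,1} & 0 & 0 \\ 0 & 0 & 0 \\ 0 & 0 & 0 \\ 0 & \Sigma_{n,1} & 0 \\ 0 & 0 & \Sigma_{n,0} \\ 0 & 0 & 0 \end{bmatrix} \begin{bmatrix} v_1(n) \\ v_2(n) \\ v_3(n) \end{bmatrix} = \tilde f(n)$$ with block row sizes $r_{2,n},r_{1,n},r_{0,n},\varphi_{1,n},\varphi_{0,n},v_n$, with $A_{n,1},B_{n,2},B_{n,4},C_{n,3}$ of full row rank and $\Sigma_{n,1},\Sigma_{n,0}$ nonsingular and diagonal. Write $\tilde f_1,\tilde f_2,\tilde f_3$ for the first three blocks of $\tilde f$. The first three block rows form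 the "upper part". **Constant Size Assumption.** The numbers $r_{2,n},r_{1,n},r_{0,n},\varphi_{1,n},\varphi_{0,n},v_n$ are constant for all $n\ge n_0$ (then written $r_2,r_1,r_0,\varphi_1,\varphi_0,v$). **Index reduction step.** Choose for each $n$ matrices $S^{(1)}_n,S^{(2)}_n,Z^{(1)}_n,\dots,Z^{(5)}_n$ of compatible sizes such that $\begin{bmatrix} S^{(i)}_n \\ Z^{(i)}_n \end{bmatrix}\in\mathbb R^{r_i,r_i}$ is orthogonal ($i=1,2$), $Z^{(1)}_nB_{n,2}+Z^{(3)}_nC_{n+1,3}=0$, $Z^{(2)}_nA_{n,1}+Z^{(4)}_nB_{n+1,2}+Z^{(5)}_nC_{n+2,3}=0$, $S^{(1)}_nB_{n,2}$ and $S^{(2)}_nA_{n,1}$ have full row rank, and the pairs $(S^{(1)}_nB_{n,2},C_{n+1,3})$ and $\left(S^{(2)}_nA_{n,1},\begin{bmatrix} B_{n+1,2} \\ C_{n+2,3} \end{bmatrix}\right)$ have no hidden redundancy (such matrices always exist). The step keeps the last three block rows and replaces the upper part by the equations - $S^{(2)}_n\big(A_{n,1}x(n+2)+B_{n,1}x(n+1)+C_{n,1}x(n)+D_{n,1}v_1(n)\big)=S^{(2)}_n\tilde f_1(n)$, - $(Z^{(2)}_nB_{n,1}+Z^{(4)}_nC_{n+1,2})x(n+1)+Z^{(2)}_nC_{n,1}x(n)+Z^{(2)}_nD_{n,1}v_1(n)=Z^{(2)}_n\tilde f_1(n)+Z^{(4)}_n\tilde f_2(n+1)+Z^{(5)}_n\tilde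 f_3(n+2)$, - $S^{(1)}_n\big(B_{n,2}x(n+1)+C_{n,2}x(n)\big)=S^{(1)}_n\tilde f_2(n)$, - $Z^{(1)}_nC_{n,2}x(n)=Z^{(1)}_n\tilde f_2(n)+Z^{(3)}_n\tilde f_3(n+1)$, - $C_{n,3}x(n)=\tilde f_3(n)$. **Regularization procedure.** Alternate between bringing the current system to condensed form and performing an index reduction step, until for all $n\ge n_0$ the pairs $\left(A_{n,1},\begin{bmatrix} B_{n+1,2} \\ C_{n+2,3} \end{bmatrix}\right)$ and $(B_{n,2},C_{n+1,3})$ of the current condensed form have no hidden redundancy; then transform the input back to $u$. The assumption is required for every condensed form that occurs. *)

theory Defs
  imports "Jordan_Normal_Form.DL_Rank"
begin

text \<open>Matrices and vectors are those of Jordan\_Normal\_Form, whose dimensions are values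
  and may be 0 (block rows of size 0 are allowed throughout). The library's rank function takes
  the number of rows as an explicit parameter.\<close>

definition mat_rank :: "real mat \<Rightarrow> nat" where
  "mat_rank M = vec_space.rank (dim_row M) M"

definition full_row_rank :: "real mat \<Rightarrow> bool" where
  "full_row_rank M \<longleftrightarrow> mat_rank M = dim_row M"

definition no_hidden_redundancy :: "real mat \<Rightarrow> real mat \<Rightarrow> bool" where
  "no_hidden_redundancy P Q \<longleftrightarrow> mat_rank (P @\<^sub>r Q) = mat_rank P + mat_rank Q"

text \<open>\<open>vstack nc Ms\<close> puts matrices with \<open>nc\<close> columns on top of each other;
  \<open>hstack nr Ms\<close> puts matrices with \<open>nr\<close> rows side by side.\<close>

definition vstack :: "nat \<Rightarrow> real mat list \<Rightarrow> real mat" where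
  "vstack nc Ms = foldr (@\<^sub>r) Ms (0\<^sub>m 0 nc)"

definition hstack :: "nat \<Rightarrow> real mat list \<Rightarrow> real mat" where
  "hstack nr Ms = transpose_mat (vstack nr (map transpose_mat Ms))"

text \<open>The library's \<open>orthogonal_mat\<close> only asks for pairwise orthogonal nonzero columns, which is
  weaker than the usual notion.\<close>

definition orthogonal_square :: "nat \<Rightarrow> real mat \<Rightarrow> bool" where
  "orthogonal_square r Q \<longleftrightarrow> Q \<in> carrier_mat r r \<and>
     Q * transpose_mat Q = 1\<^sub>m r \<and> transpose_mat Q * Q = 1\<^sub>m r"


section \<open>Descriptor systems\<close>

text \<open>The equation \<open>A x(n+2) + B x(n+1) + C x(n) + D u(n) = f\<close> at one time \<open>n\<close>. A descriptor system
  is a sequence of such equations; only its members with index \<open>n \<ge> n0\<close> matter.\<close>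

record descr_eq =
  cA :: "real mat"
  cB :: "real mat"
  cC :: "real mat"
  cD :: "real mat"
  rhs :: "real vec"

definition descriptor_system ::
  "nat \<Rightarrow> nat \<Rightarrow> nat \<Rightarrow> nat \<Rightarrow> (nat \<Rightarrow> descr_eq) \<Rightarrow> bool" where
  "descriptor_system n0 m d p E \<longleftrightarrow> (\<forall>n\<ge>n0.
     cA (E n) \<in> carrier_mat m d \<and> cB (E n) \<in> carrier_mat m d \<and> cC (E n) \<in> carrier_mat m d \<and>
     cD (E n) \<in> carrier_mat m p \<and> rhs (E n) \<in> carrier_vec m)"

text \<open>Sequences are total functions on \<open>nat\<close>; their values below \<open>n0\<close> are left unconstrained.\<close>

definition solutions ::
  "nat \<Rightarrow> nat \<Rightarrow> (nat \<Rightarrow> descr_eq) \<Rightarrow> (nat \<Rightarrow> real vec) \<Rightarrow> (nat \<Rightarrow> real vec) set" where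
  "solutions n0 d E u = {x. \<forall>n\<ge>n0. x n \<in> carrier_vec d \<and>
     cA (E n) *\<^sub>v x (n + 2) + cB (E n) *\<^sub>v x (n + 1) + cC (E n) *\<^sub>v x n + cD (E n) *\<^sub>v u n
       = rhs (E n)}"


section \<open>Condensed form\<close>

text \<open>Block sizes and blocks of the condensed form at one time \<open>n\<close>; \<open>cfS1\<close> and \<open>cfS0\<close> are
  $\Sigma_{n,1}$ and $\Sigma_{n,0}$, and \<open>cff1, \<dots>, cff6\<close> are the blocks of $\tilde f(n)$.\<close>

record condensed_eq =
  r2 :: nat
  r1 :: nat
  r0 :: nat
  phi1 :: nat
  phi0 :: nat
  vnum :: nat
  cfA1 :: "real mat"
  cfB1 :: "real mat"
  cfC1 :: "real mat"
  cfD1 :: "real mat"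
  cfB2 :: "real mat"
  cfC2 :: "real mat"
  cfC3 :: "real mat"
  cfB4 :: "real mat"
  cfC4 :: "real mat"
  cfC5 :: "real mat"
  cfS1 :: "real mat"
  cfS0 :: "real mat"
  cff1 :: "real vec"
  cff2 :: "real vec"
  cff3 :: "real vec"
  cff4 :: "real vec"
  cff5 :: "real vec"
  cff6 :: "real vec"

definition condensed_blocks :: "nat \<Rightarrow> nat \<Rightarrow> condensed_eq \<Rightarrow> bool" where
  "condensed_blocks d p c \<longleftrightarrow>
     phi1 c + phi0 c \<le> p \<and>
     cfA1 c \<in> carrier_mat (r2 c) d \<and> cfB1 c \<in> carrier_mat (r2 c) d \<and>
     cfC1 c \<in> carrier_mat (r2 c) d \<and> cfD1 c \<in> carrier_mat (r2 c) (p - phi1 c - phi0 c) \<and>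
     cfB2 c \<in> carrier_mat (r1 c) d \<and> cfC2 c \<in> carrier_mat (r1 c) d \<and>
     cfC3 c \<in> carrier_mat (r0 c) d \<and>
     cfB4 c \<in> carrier_mat (phi1 c) d \<and> cfC4 c \<in> carrier_mat (phi1 c) d \<and>
     cfC5 c \<in> carrier_mat (phi0 c) d \<and>
     cfS1 c \<in> carrier_mat (phi1 c) (phi1 c) \<and> cfS0 c \<in> carrier_mat (phi0 c) (phi0 c) \<and>
     cff1 c \<in> carrier_vec (r2 c) \<and> cff2 c \<in> carrier_vec (r1 c) \<and> cff3 c \<in> carrier_vec (r0 c) \<and>
     cff4 c \<in> carrier_vec (phi1 c) \<and> cff5 c \<in> carrier_vec (phi0 c) \<and>
     cff6 c \<in> carrier_vec (vnum c) \<and>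
     full_row_rank (cfA1 c) \<and> full_row_rank (cfB2 c) \<and>
     full_row_rank (cfB4 c) \<and> full_row_rank (cfC3 c) \<and>
     invertible_mat (cfS1 c) \<and> diagonal_mat (cfS1 c) \<and>
     invertible_mat (cfS0 c) \<and> diagonal_mat (cfS0 c)"

definition condensed_at ::
  "nat \<Rightarrow> nat \<Rightarrow> nat \<Rightarrow> descr_eq \<Rightarrow> condensed_eq \<Rightarrow> bool" where
  "condensed_at m d p e c \<longleftrightarrow>
     condensed_blocks d p c \<and>
     r2 c + r1 c + r0 c + phi1 c + phi0 c + vnum c = m \<and>
     (\<exists>U V. U \<in> carrier_mat m m \<and> invertible_mat U \<and> V \<in> carrier_mat p p \<and> invertible_mat V \<and>
        U * cA e = vstack d
          [cfA1 c, 0\<^sub>m (r1 c) d, 0\<^sub>m (r0 c) d, 0\<^sub>m (phi1 c) d, 0\<^sub>m (phi0 c) d, 0\<^sub>m (vnum c) d] \<and>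
        U * cB e = vstack d
          [cfB1 c, cfB2 c, 0\<^sub>m (r0 c) d, cfB4 c, 0\<^sub>m (phi0 c) d, 0\<^sub>m (vnum c) d] \<and>
        U * cC e = vstack d
          [cfC1 c, cfC2 c, cfC3 c, cfC4 c, cfC5 c, 0\<^sub>m (vnum c) d] \<and>
        U * cD e * V = vstack p
          [hstack (r2 c) [cfD1 c, 0\<^sub>m (r2 c) (phi1 c), 0\<^sub>m (r2 c) (phi0 c)],
           0\<^sub>m (r1 c) p,
           0\<^sub>m (r0 c) p,
           hstack (phi1 c) [0\<^sub>m (phi1 c) (p - phi1 c - phi0 c), cfS1 c, 0\<^sub>m (phi1 c) (phi0 c)],
           hstack (phi0 c) [0\<^sub>m (phi0 c) (p - phi1 c - phi0 c), 0\<^sub>m (phi0 c) (phi1 c), cfS0 c],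
           0\<^sub>m (vnum c) p] \<and>
        U *\<^sub>v rhs e =
          cff1 c @\<^sub>v cff2 c @\<^sub>v cff3 c @\<^sub>v cff4 c @\<^sub>v cff5 c @\<^sub>v cff6 c)"

definition condensed_form ::
  "nat \<Rightarrow> nat \<Rightarrow> nat \<Rightarrow> nat \<Rightarrow> (nat \<Rightarrow> descr_eq) \<Rightarrow> (nat \<Rightarrow> condensed_eq) \<Rightarrow> bool" where
  "condensed_form n0 m d p E c \<longleftrightarrow> (\<forall>n\<ge>n0. condensed_at m d p (E n) (c n))"

definition constant_size :: "nat \<Rightarrow> (nat \<Rightarrow> condensed_eq) \<Rightarrow> bool" where
  "constant_size n0 c \<longleftrightarrow> (\<forall>n\<ge>n0.
     r2 (c n) = r2 (c n0) \<and> r1 (c n) = r1 (c n0) \<and> r0 (c n) = r0 (c n0) \<and>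
     phi1 (c n) = phi1 (c n0) \<and> phi0 (c n) = phi0 (c n0) \<and> vnum (c n) = vnum (c n0))"


section \<open>Index reduction step\<close>

text \<open>Here \<open>c\<close>, \<open>c'\<close>, \<open>c''\<close> are the condensed equations at the times \<open>n\<close>, \<open>n+1\<close>, \<open>n+2\<close>. The numbers of
  rows of the S- and Z-matrices are free and may depend on \<open>n\<close>.\<close>

definition reduction_matrices ::
  "nat \<Rightarrow> condensed_eq \<Rightarrow> condensed_eq \<Rightarrow> condensed_eq \<Rightarrow> real mat \<Rightarrow> real mat \<Rightarrow>
   real mat \<Rightarrow> real mat \<Rightarrow> real mat \<Rightarrow> real mat \<Rightarrow> real mat \<Rightarrow> bool" where
  "reduction_matrices d c c' c'' S1 S2 Z1 Z2 Z3 Z4 Z5 \<longleftrightarrow>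
     dim_col S1 = r1 c \<and> dim_col Z1 = r1 c \<and> orthogonal_square (r1 c) (S1 @\<^sub>r Z1) \<and>
     dim_col S2 = r2 c \<and> dim_col Z2 = r2 c \<and> orthogonal_square (r2 c) (S2 @\<^sub>r Z2) \<and>
     Z3 \<in> carrier_mat (dim_row Z1) (r0 c') \<and>
     Z4 \<in> carrier_mat (dim_row Z2) (r1 c') \<and>
     Z5 \<in> carrier_mat (dim_row Z2) (r0 c'') \<and>
     Z1 * cfB2 c + Z3 * cfC3 c' = 0\<^sub>m (dim_row Z1) d \<and>
     Z2 * cfA1 c + Z4 * cfB2 c' + Z5 * cfC3 c'' = 0\<^sub>m (dim_row Z2) d \<and>
     full_row_rank (S1 * cfB2 c) \<and> full_row_rank (S2 * cfA1 c) \<and>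
     no_hidden_redundancy (S1 * cfB2 c) (cfC3 c') \<and>
     no_hidden_redundancy (S2 * cfA1 c) (cfB2 c' @\<^sub>r cfC3 c'')"

definition reduced_eq ::
  "nat \<Rightarrow> nat \<Rightarrow> condensed_eq \<Rightarrow> condensed_eq \<Rightarrow> condensed_eq \<Rightarrow> real mat \<Rightarrow> real mat \<Rightarrow>
   real mat \<Rightarrow> real mat \<Rightarrow> real mat \<Rightarrow> real mat \<Rightarrow> real mat \<Rightarrow> descr_eq" where
  "reduced_eq d p c c' c'' S1 S2 Z1 Z2 Z3 Z4 Z5 =
    (let s1 = dim_row S1; s2 = dim_row S2; z1 = dim_row Z1; z2 = dim_row Z2;
         q = p - phi1 c - phi0 c in
     \<lparr> cA = vstack d
         [S2 * cfA1 c,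
          0\<^sub>m z2 d,
          0\<^sub>m s1 d,
          0\<^sub>m z1 d,
          0\<^sub>m (r0 c) d,
          0\<^sub>m (phi1 c) d,
          0\<^sub>m (phi0 c) d,
          0\<^sub>m (vnum c) d],
       cB = vstack d
         [S2 * cfB1 c,
          Z2 * cfB1 c + Z4 * cfC2 c',
          S1 * cfB2 c,
          0\<^sub>m z1 d,
          0\<^sub>m (r0 c) d,
          cfB4 c,
          0\<^sub>m (phi0 c) d,
          0\<^sub>m (vnum c) d],
       cC = vstack d
         [S2 * cfC1 c,
          Z2 * cfC1 c,
          S1 * cfC2 c,
          Z1 * cfC2 c,
          cfC3 c,
          cfC4 c,
          cfC5 c,
          0\<^sub>m (vnum c) d],
       cD = vstack p
         [hstack s2 [S2 * cfD1 c, 0\<^sub>m s2 (phi1 c), 0\<^sub>m s2 (phi0 c)],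
          hstack z2 [Z2 * cfD1 c, 0\<^sub>m z2 (phi1 c), 0\<^sub>m z2 (phi0 c)],
          0\<^sub>m s1 p,
          0\<^sub>m z1 p,
          0\<^sub>m (r0 c) p,
          hstack (phi1 c) [0\<^sub>m (phi1 c) q, cfS1 c, 0\<^sub>m (phi1 c) (phi0 c)],
          hstack (phi0 c) [0\<^sub>m (phi0 c) q, 0\<^sub>m (phi0 c) (phi1 c), cfS0 c],
          0\<^sub>m (vnum c) p],
       rhs =
         (S2 *\<^sub>v cff1 c) @\<^sub>v
         (Z2 *\<^sub>v cff1 c + Z4 *\<^sub>v cff2 c' + Z5 *\<^sub>v cff3 c'') @\<^sub>v
         (S1 *\<^sub>v cff2 c) @\<^sub>v
         (Z1 *\<^sub>v cff2 c + Z3 *\<^sub>v cff3 c') @\<^sub>v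
         cff3 c @\<^sub>v cff4 c @\<^sub>v cff5 c @\<^sub>v cff6 c \<rparr>)"

text \<open>The resulting system has the input \<open>v\<close> of the condensed form; successive input
  transformations accumulate along the procedure.\<close>

definition index_reduction ::
  "nat \<Rightarrow> nat \<Rightarrow> nat \<Rightarrow> (nat \<Rightarrow> condensed_eq) \<Rightarrow> (nat \<Rightarrow> descr_eq) \<Rightarrow> bool" where
  "index_reduction n0 d p c F \<longleftrightarrow> (\<forall>n\<ge>n0. \<exists>S1 S2 Z1 Z2 Z3 Z4 Z5.
     reduction_matrices d (c n) (c (n + 1)) (c (n + 2)) S1 S2 Z1 Z2 Z3 Z4 Z5 \<and>
     F n = reduced_eq d p (c n) (c (n + 1)) (c (n + 2)) S1 S2 Z1 Z2 Z3 Z4 Z5)"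


section \<open>Regularization procedure\<close>

definition procedure_stops :: "nat \<Rightarrow> (nat \<Rightarrow> condensed_eq) \<Rightarrow> bool" where
  "procedure_stops n0 c \<longleftrightarrow> (\<forall>n\<ge>n0.
     no_hidden_redundancy (cfA1 (c n)) (cfB2 (c (n + 1)) @\<^sub>r cfC3 (c (n + 2))) \<and>
     no_hidden_redundancy (cfB2 (c n)) (cfC3 (c (n + 1))))"

text \<open>The condensed form with number \<open>k\<close> occurs iff the procedure has not stopped before.\<close>

definition occurs :: "nat \<Rightarrow> (nat \<Rightarrow> nat \<Rightarrow> condensed_eq) \<Rightarrow> nat \<Rightarrow> bool" where
  "occurs n0 cf k \<longleftrightarrow> (\<forall>j<k. \<not> procedure_stops n0 (cf j))"

text \<open>One execution of the procedure on \<open>E\<close>, with arbitrary choices: \<open>cf k\<close> is a condensed form of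
  the current system \<open>sys k\<close>, and \<open>sys (Suc k)\<close> arises from it by an index reduction step.
  Neither termination nor the existence of condensed forms and of the matrices for the reduction
  step is built in: an execution may be infinite, and a choice only has to be correct if a correct
  choice exists. What happens after the procedure has stopped is irrelevant.\<close>

definition regularization_run ::
  "nat \<Rightarrow> nat \<Rightarrow> nat \<Rightarrow> nat \<Rightarrow> (nat \<Rightarrow> descr_eq) \<Rightarrow>
   (nat \<Rightarrow> nat \<Rightarrow> descr_eq) \<Rightarrow> (nat \<Rightarrow> nat \<Rightarrow> condensed_eq) \<Rightarrow> bool" where
  "regularization_run n0 m d p E sys cf \<longleftrightarrow>
     sys 0 = E \<and>
     (\<forall>k. occurs n0 cf k \<longrightarrow>
        ((\<exists>c. condensed_form n0 m d p (sys k) c) \<longrightarrow> condensed_form n0 m d p (sys k) (cf k)) \<and>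
        (\<not> procedure_stops n0 (cf k) \<longrightarrow>
           (\<exists>F. index_reduction n0 d p (cf k) F) \<longrightarrow>
           index_reduction n0 d p (cf k) (sys (Suc k))))"


section \<open>Strangeness-free systems\<close>

definition strangeness_free ::
  "nat \<Rightarrow> nat \<Rightarrow> nat \<Rightarrow> (nat \<Rightarrow> descr_eq) \<Rightarrow> bool" where
  "strangeness_free n0 d p F \<longleftrightarrow>
    (\<exists>(r2h::nat) (r1h::nat) (r0h::nat) (phi1h::nat) (phi0h::nat) (vh::nat)
      A1 B1 C1 B2 C2 C3 B5 C5 C6 D1 D4 D5 f1 f2 f3 f4 f5 f6. \<forall>n\<ge>n0.
       A1 n \<in> carrier_mat r2h d \<and> B1 n \<in> carrier_mat r2h d \<and> C1 n \<in> carrier_mat r2h d \<and>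
       B2 n \<in> carrier_mat r1h d \<and> C2 n \<in> carrier_mat r1h d \<and>
       C3 n \<in> carrier_mat r0h d \<and>
       B5 n \<in> carrier_mat phi1h d \<and> C5 n \<in> carrier_mat phi1h d \<and>
       C6 n \<in> carrier_mat phi0h d \<and>
       D1 n \<in> carrier_mat r2h p \<and> D4 n \<in> carrier_mat phi1h p \<and> D5 n \<in> carrier_mat phi0h p \<and>
       f1 n \<in> carrier_vec r2h \<and> f2 n \<in> carrier_vec r1h \<and> f3 n \<in> carrier_vec r0h \<and>
       f4 n \<in> carrier_vec phi1h \<and> f5 n \<in> carrier_vec phi0h \<and> f6 n \<in> carrier_vec vh \<and>
       cA (F n) = vstack d
         [A1 n, 0\<^sub>m r1h d, 0\<^sub>m r0h d, 0\<^sub>m phi1h d, 0\<^sub>m phi0h d, 0\<^sub>m vh d] \<and>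
       cB (F n) = vstack d
         [B1 n, B2 n, 0\<^sub>m r0h d, B5 n, 0\<^sub>m phi0h d, 0\<^sub>m vh d] \<and>
       cC (F n) = vstack d
         [C1 n, C2 n, C3 n, C5 n, C6 n, 0\<^sub>m vh d] \<and>
       cD (F n) = vstack p
         [D1 n, 0\<^sub>m r1h p, 0\<^sub>m r0h p, D4 n, D5 n, 0\<^sub>m vh p] \<and>
       rhs (F n) = f1 n @\<^sub>v f2 n @\<^sub>v f3 n @\<^sub>v f4 n @\<^sub>v f5 n @\<^sub>v f6 n \<and>
       full_row_rank (vstack d [A1 n, B2 (n + 1), C3 (n + 2)]) \<and>
       full_row_rank (vstack p [D4 n, D5 n]))"

end

theory Submission
  imports Defs
begin

text \<open>A reduction step only combines the equations at the times \<open>n\<close>, \<open>n + 1\<close>, \<open>n + 2\<close>, and the original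
  equations can be recovered from the third block row upwards, so the solution set is preserved.
  If the matrices $Z^{(i)}_n$ have $z_i$ rows, the next condensed form satisfies $r_2' \le r_2 - z_2$
  and $r_1' \le r_1 - z_1 + z_2$; the second bound holds because $r_1'$ is the rank of \<open>B\<close> on the row
  combinations that annihilate \<open>A\<close> and \<open>D\<close>. Hence $2 r_2 + r_1$ drops whenever some $z_i$ is positive,
  which is the case at some time unless the procedure stops. Once it has stopped, ranks add up by the
  absence of hidden redundancy. Condensed forms and reduction matrices always exist, by repeated
  orthogonal row compression.\<close>

section \<open>Matrices and vectors\<close>

text \<open>The weight 2 on \<open>r2\<close> reflects where equations go: the z_2 rows that leave
  level 2 may all turn up at level 1, so the measure falls by at least z_1 + z_2. Redundancy need
  not show at time \<open>n0\<close>, only at some time \<open>n\<close>; the Constant Size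
  Assumption carries the drop at \<open>n\<close> over to \<open>n0\<close>. A run has to choose
  correctly only where a correct choice exists, so the existence of condensed forms and of reduction
  matrices is part of the argument, together with the invariant that every system keeps
  \<open>m\<close> rows. Rank is awkward in block computations. It is replaced by the triviality of
  a left kernel, \<open>injective_mat M\<^sup>T\<close>; the link is a factorization
  \<open>G * H\<close> with \<open>G\<close> injective and \<open>H\<close> of independent rows.
  Bounds on numbers of rows come down to one fact: a matrix with more columns than rows has a
  nonzero kernel vector.\<close>

text \<open>As conditional rewrite rules, \<open>carrier_vecD\<close> and \<open>carrier_matD\<close> loop on facts such as
  \<open>M \<in> carrier_mat (dim_row M) (dim_col M)\<close>; the equivalences do not.\<close>

lemma carrier_mat_iff: "M \<in> carrier_mat m n \<longleftrightarrow> dim_row M = m \<and> dim_col M = n"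
  by (simp only: carrier_mat_def mem_Collect_eq)

declare carrier_vecD [simp del] carrier_dim_vec [simp]
  carrier_matD [simp del, rule del] carrier_mat_iff [simp]

lemma mult_mat_vec_assoc:
  fixes A B :: "real mat"
  assumes "dim_col A = dim_row B" "dim_vec x = dim_col B"
  shows "(A * B) *\<^sub>v x = A *\<^sub>v (B *\<^sub>v x)"
  using assms by (intro assoc_mult_mat_vec[of _ "dim_row A" "dim_row B" _ "dim_col B"]) auto

lemma mult_mat_vec_add:
  fixes A :: "real mat"
  assumes "dim_vec x = dim_col A" "dim_vec y = dim_col A"
  shows "A *\<^sub>v (x + y) = A *\<^sub>v x + A *\<^sub>v y"
  using assms by (intro mult_add_distrib_mat_vec[of _ "dim_row A" "dim_col A"]) auto

lemma mult_mat_vec_diff: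
  fixes A :: "real mat"
  assumes "dim_vec x = dim_col A" "dim_vec y = dim_col A"
  shows "A *\<^sub>v (x - y) = A *\<^sub>v x - A *\<^sub>v y"
  using assms by (intro mult_minus_distrib_mat_vec[of _ "dim_row A" "dim_col A"]) auto

lemma add_mat_mult_vec:
  fixes A B :: "real mat"
  assumes "dim_row B = dim_row A" "dim_col B = dim_col A" "dim_vec x = dim_col A"
  shows "(A + B) *\<^sub>v x = A *\<^sub>v x + B *\<^sub>v x"
  using assms by (intro add_mult_distrib_mat_vec[of _ "dim_row A" "dim_col A"]) auto

lemma zero_mat_mult_vec [simp]: "dim_vec x = nc \<Longrightarrow> 0\<^sub>m nr nc *\<^sub>v x = (0\<^sub>v nr :: real vec)"
  by (intro eq_vecI) (auto simp: scalar_prod_def)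

lemma mult_mat_zero_vec [simp]: "dim_col A = n \<Longrightarrow> A *\<^sub>v 0\<^sub>v n = (0\<^sub>v (dim_row A) :: real vec)"
  by (intro eq_vecI) (auto simp: scalar_prod_def)

lemma transpose_mult_dim:
  fixes A B :: "real mat"
  shows "dim_col A = dim_row B \<Longrightarrow> (A * B)\<^sup>T = B\<^sup>T * A\<^sup>T"
  by (rule transpose_mult[of _ "dim_row A" "dim_row B" _ "dim_col B"]) auto

lemma mult_mat_assoc:
  fixes A B C :: "real mat"
  assumes "dim_col A = dim_row B" "dim_col B = dim_row C"
  shows "A * B * C = A * (B * C)"
  using assms
  by (intro assoc_mult_mat[of _ "dim_row A" "dim_row B" _ "dim_row C" _ "dim_col C"]) auto

text \<open>Block identities become vector identities this way, where stacking and multiplication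
  have simple rewrite rules and no matrix entries need to be computed.\<close>

lemma mat_eq_via_vec:
  fixes A B :: "real mat"
  assumes "A \<in> carrier_mat m n" "B \<in> carrier_mat m n"
    and "\<And>x. x \<in> carrier_vec n \<Longrightarrow> A *\<^sub>v x = B *\<^sub>v x"
  shows "A = B"
proof (rule mat_col_eqI)
  fix j assume j: "j < dim_col B"
  have "col A j = A *\<^sub>v unit_vec n j" "col B j = B *\<^sub>v unit_vec n j"
    using assms(1,2) j by (auto intro!: eq_vecI)
  thus "col A j = col B j" using assms(3)[of "unit_vec n j"] by simp
qed (use assms in auto)

lemma vec_split:
  fixes v :: "real vec"
  assumes "dim_vec v = n + k"
  obtains a b where "dim_vec a = n" "dim_vec b = k" "v = a @\<^sub>v b"
  using vec_first_last_append[of v n k] assms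
  by (metis carrier_dim_vec dim_vec_first dim_vec_last)

lemma append_vec_inject:
  fixes a b :: "real vec"
  shows "dim_vec a = dim_vec b \<Longrightarrow> a @\<^sub>v c = b @\<^sub>v d \<longleftrightarrow> a = b \<and> c = d"
  by (rule append_vec_eq[of _ "dim_vec b"]) auto

lemma append_vec_plus:
  fixes a b c d :: "real vec"
  assumes "dim_vec a = dim_vec b" "dim_vec c = dim_vec d"
  shows "(a @\<^sub>v c) + (b @\<^sub>v d) = (a + b) @\<^sub>v (c + d)"
  using assms by (intro eq_vecI) auto

lemma zero_append_zero [simp]: "0\<^sub>v m @\<^sub>v 0\<^sub>v n = (0\<^sub>v (m + n) :: real vec)"
  by (intro eq_vecI) auto

lemma append_vec_nil [simp]: "dim_vec b = 0 \<Longrightarrow> a @\<^sub>v b = (a :: real vec)"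
  by (intro eq_vecI) auto

lemma dim_append_rows [simp]:
  "dim_row (A @\<^sub>r B) = dim_row A + dim_row B" "dim_col (A @\<^sub>r B) = dim_col A"
  by (simp_all add: append_rows_def)

lemma append_rows_nil [simp]:
  "dim_row B = 0 \<Longrightarrow> dim_col B = dim_col A \<Longrightarrow> A @\<^sub>r B = (A :: real mat)"
  by (intro eq_matI) (auto simp: append_rows_def)

lemma append_rows_mult_vec:
  fixes A B :: "real mat"
  assumes "dim_col B = dim_col A" "dim_vec x = dim_col A"
  shows "(A @\<^sub>r B) *\<^sub>v x = (A *\<^sub>v x) @\<^sub>v (B *\<^sub>v x)"
  using assms by (intro mat_mult_append[of _ "dim_row A" "dim_col A" _ "dim_row B"]) auto

lemma append_rows_inject:
  fixes A B C D :: "real mat"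
  assumes eq: "A @\<^sub>r B = C @\<^sub>r D"
    and dims: "dim_row A = dim_row C" "dim_col B = dim_col A" "dim_col D = dim_col C"
  shows "A = C \<and> B = D"
proof -
  from arg_cong[OF eq, of dim_row] arg_cong[OF eq, of dim_col] dims
  have d: "dim_row B = dim_row D" "dim_col A = dim_col C" by auto
  have "A *\<^sub>v x = C *\<^sub>v x \<and> B *\<^sub>v x = D *\<^sub>v x" if "x \<in> carrier_vec (dim_col A)" for x
  proof -
    have "(A *\<^sub>v x) @\<^sub>v (B *\<^sub>v x) = (C *\<^sub>v x) @\<^sub>v (D *\<^sub>v x)"
      using arg_cong[OF eq, of "\<lambda>M. M *\<^sub>v x"] that dims d
      by (simp add: append_rows_mult_vec)
    thus ?thesis using dims d by (simp add: append_vec_inject)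
  qed
  note vec_eq = this
  have "A = C"
    using dims d vec_eq by (intro mat_eq_via_vec[of _ "dim_row C" "dim_col A"]) auto
  moreover have "B = D"
    using dims d vec_eq by (intro mat_eq_via_vec[of _ "dim_row D" "dim_col A"]) auto
  ultimately show ?thesis ..
qed

lemma append_rows_mult:
  fixes A B N :: "real mat"
  assumes "dim_col A = dim_row N" "dim_col B = dim_row N"
  shows "(A @\<^sub>r B) * N = (A * N) @\<^sub>r (B * N)"
  by (rule mat_eq_via_vec[of _ "dim_row A + dim_row B" "dim_col N"])
    (use assms in \<open>auto simp: mult_mat_vec_assoc append_rows_mult_vec\<close>)

text \<open>Testing the adjoint identity with unit vectors yields the entries of the transposed
  product, so a transposed stack can be handled through the stack itself.\<close>

lemma transpose_mult_vec_eqI: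
  fixes A :: "real mat"
  assumes A: "A \<in> carrier_mat m n" and y: "y \<in> carrier_vec m" and z: "z \<in> carrier_vec n"
    and eq: "\<And>x. x \<in> carrier_vec n \<Longrightarrow> y \<bullet> (A *\<^sub>v x) = z \<bullet> x"
  shows "A\<^sup>T *\<^sub>v y = z"
proof (rule eq_vecI)
  fix i assume i: "i < dim_vec z"
  hence u: "unit_vec n i \<in> carrier_vec n" and i': "i < n" using z by auto
  have w: "A\<^sup>T *\<^sub>v y \<in> carrier_vec n" using A y by auto
  have "(A\<^sup>T *\<^sub>v y) \<bullet> unit_vec n i = z \<bullet> unit_vec n i"
    using transpose_vec_mult_scalar[OF A u y] eq[OF u] by simp
  thus "(A\<^sup>T *\<^sub>v y) $ i = z $ i"
    using scalar_prod_right_unit[OF i', of "A\<^sup>T *\<^sub>v y"] scalar_prod_right_unit[OF i', of z] w z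
    by simp
qed (use assms in auto)

text \<open>A product \<open>M\<^sup>T *\<^sub>v y\<close> is the combination of the rows of
  \<open>M\<close> with coefficients \<open>y\<close>; splitting \<open>y\<close> along the stack
  splits the combination. The arguments about dependent rows of stacked matrices run through this
  rule.\<close>

lemma append_rows_transpose_mult_vec:
  fixes A B :: "real mat"
  assumes "dim_col B = dim_col A" "dim_vec a = dim_row A" "dim_vec b = dim_row B"
  shows "(A @\<^sub>r B)\<^sup>T *\<^sub>v (a @\<^sub>v b) = A\<^sup>T *\<^sub>v a + B\<^sup>T *\<^sub>v b"
proof -
  have a: "a \<in> carrier_vec (dim_row A)" and b: "b \<in> carrier_vec (dim_row B)"
    and A: "A \<in> carrier_mat (dim_row A) (dim_col A)"
    and B: "B \<in> carrier_mat (dim_row B) (dim_col A)"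
    using assms by auto
  have "(a @\<^sub>v b) \<bullet> ((A @\<^sub>r B) *\<^sub>v x) = (A\<^sup>T *\<^sub>v a + B\<^sup>T *\<^sub>v b) \<bullet> x"
    if x: "x \<in> carrier_vec (dim_col A)" for x
  proof -
    have "(A\<^sup>T *\<^sub>v a + B\<^sup>T *\<^sub>v b) \<bullet> x = (A\<^sup>T *\<^sub>v a) \<bullet> x + (B\<^sup>T *\<^sub>v b) \<bullet> x"
      using x A B a b by (intro add_scalar_prod_distrib[of _ "dim_col A"]) auto
    also have "\<dots> = a \<bullet> (A *\<^sub>v x) + b \<bullet> (B *\<^sub>v x)"
      by (simp only: transpose_vec_mult_scalar[OF A x a] transpose_vec_mult_scalar[OF B x b])
    also have "\<dots> = (a @\<^sub>v b) \<bullet> ((A *\<^sub>v x) @\<^sub>v (B *\<^sub>v x))"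
      using A B x by (intro scalar_prod_append[OF a b, symmetric]) auto
    also have "\<dots> = (a @\<^sub>v b) \<bullet> ((A @\<^sub>r B) *\<^sub>v x)"
      using x assms by (simp add: append_rows_mult_vec)
    finally show ?thesis by simp
  qed
  thus ?thesis using assms
    by (intro transpose_mult_vec_eqI[of _ "dim_row A + dim_row B" "dim_col A"]) auto
qed

lemma row_split:
  fixes M :: "real mat"
  assumes "dim_row M = n + k"
  obtains A B where "dim_row A = n" "dim_col A = dim_col M" "dim_row B = k" "dim_col B = dim_col M"
    "M = A @\<^sub>r B"
proof -
  define A where "A = mat n (dim_col M) (\<lambda>(i,j). M $$ (i,j))"
  define B where "B = mat k (dim_col M) (\<lambda>(i,j). M $$ (n + i,j))"
  have "M = A @\<^sub>r B" using assms
    by (intro eq_matI) (auto simp: A_def B_def append_rows_def)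
  thus thesis by (intro that[of A B]) (simp_all add: A_def B_def)
qed

lemma scalar_prod_self_eq_0: "v \<in> carrier_vec n \<Longrightarrow> v \<bullet> v = 0 \<longleftrightarrow> v = 0\<^sub>v n" for v :: "real vec"
  using conjugate_square_eq_0_vec[of v n] by (simp add: conjugate_vec_def)

section \<open>Matrices with trivial kernel\<close>

text \<open>Applied to a transpose, this says that the rows are linearly independent, and in this
  form it stands for full row rank. A matrix without columns satisfies it, so empty block rows need
  no special treatment.\<close>

definition injective_mat :: "real mat \<Rightarrow> bool" where
  "injective_mat M \<longleftrightarrow> (\<forall>x\<in>carrier_vec (dim_col M). M *\<^sub>v x = 0\<^sub>v (dim_row M) \<longrightarrow> x = 0\<^sub>v (dim_col M))"

lemma injective_matD:
  assumes "injective_mat M" "dim_vec x = dim_col M" "M *\<^sub>v x = 0\<^sub>v n"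
  shows "x = 0\<^sub>v (dim_col M)"
proof -
  have "n = dim_row M" using arg_cong[OF assms(3), of dim_vec] by simp
  thus ?thesis using assms unfolding injective_mat_def by (metis carrier_vec_dim_vec)
qed

lemma injective_mat_cancel:
  assumes "injective_mat M" "dim_vec x = dim_col M" "dim_vec y = dim_col M"
    and "M *\<^sub>v x = M *\<^sub>v y"
  shows "x = y"
proof -
  have "M *\<^sub>v (x - y) = 0\<^sub>v (dim_row M)"
    using assms by (simp add: mult_mat_vec_diff)
  hence "x - y = 0\<^sub>v (dim_col M)" using assms by (intro injective_matD) auto
  hence "x $ i - y $ i = 0" if "i < dim_vec y" for i
    using that assms by (metis index_minus_vec(1) index_zero_vec(1))
  thus ?thesis using assms by (intro eq_vecI) auto
qed

lemma injective_matI_left_inverse: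
  assumes "L * M = 1\<^sub>m (dim_col M)" "dim_col L = dim_row M"
  shows "injective_mat M"
  unfolding injective_mat_def
proof (intro ballI impI)
  fix x assume x: "x \<in> carrier_vec (dim_col M)" "M *\<^sub>v x = 0\<^sub>v (dim_row M)"
  have "x = (L * M) *\<^sub>v x" using x assms(1) by simp
  also have "\<dots> = 0\<^sub>v (dim_row L)" using x assms(2) by (subst mult_mat_vec_assoc) auto
  also have "dim_row L = dim_col M" using arg_cong[OF assms(1), of dim_row] by simp
  finally show "x = 0\<^sub>v (dim_col M)" .
qed

text \<open>Determinants enter only here: a trivial kernel makes the determinant nonzero, hence the
  matrix a unit of the matrix ring.\<close>

lemma square_injective_inverse:
  assumes M: "M \<in> carrier_mat n n" and inj: "injective_mat M"
  obtains N where "N \<in> carrier_mat n n" "M * N = 1\<^sub>m n" "N * M = 1\<^sub>m n"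
proof -
  have "det M \<noteq> 0"
    using M inj unfolding det_0_iff_vec_prod_zero_field[OF M] injective_mat_def by auto
  from det_non_zero_imp_unit[OF M this, of "()"] show ?thesis
    using that by (auto simp: Units_def ring_mat_def)
qed

text \<open>Zero rows pad \<open>M\<close> to a square matrix \<open>N\<close> with the same kernel.
  Were that kernel trivial, \<open>N\<close> would be invertible although it has a zero row. The
  later bounds on numbers of rows reduce to this one.\<close>

lemma wide_not_injective:
  assumes "dim_row M < dim_col M" shows "\<not> injective_mat M"
proof
  assume inj: "injective_mat M"
  define k where "k = dim_col M - dim_row M"
  define N where "N = M @\<^sub>r 0\<^sub>m k (dim_col M)"
  have N: "N \<in> carrier_mat (dim_col M) (dim_col M)" using assms by (auto simp: N_def k_def)
  have "injective_mat N" unfolding injective_mat_def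
  proof (intro ballI impI)
    fix x assume x: "x \<in> carrier_vec (dim_col N)" "N *\<^sub>v x = 0\<^sub>v (dim_row N)"
    hence "(M *\<^sub>v x) @\<^sub>v 0\<^sub>v k = 0\<^sub>v (dim_row M) @\<^sub>v 0\<^sub>v k"
      by (simp add: N_def append_rows_mult_vec)
    hence "M *\<^sub>v x = 0\<^sub>v (dim_row M)" by (subst (asm) append_vec_inject) auto
    thus "x = 0\<^sub>v (dim_col N)" using x inj by (auto simp: N_def injective_mat_def)
  qed
  then obtain L where L: "L \<in> carrier_mat (dim_col M) (dim_col M)" "N * L = 1\<^sub>m (dim_col M)"
    using square_injective_inverse[OF N] by metis
  \<comment> \<open>This selects the first padding row, which exists because \<open>k\<close> is
    positive; hence \<open>N\<^sup>T\<close> maps it to zero.\<close>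
  let ?e = "0\<^sub>v (dim_row M) @\<^sub>v unit_vec k 0 :: real vec"
  have e: "dim_vec ?e = dim_col M" using assms by (simp add: k_def)
  have "N\<^sup>T *\<^sub>v ?e = 0\<^sub>v (dim_col M)"
    using assms by (simp add: N_def append_rows_transpose_mult_vec)
  hence "L\<^sup>T *\<^sub>v (N\<^sup>T *\<^sub>v ?e) = 0\<^sub>v (dim_col M)" using L by auto
  moreover have "L\<^sup>T *\<^sub>v (N\<^sup>T *\<^sub>v ?e) = (N * L)\<^sup>T *\<^sub>v ?e"
    using L(1) N e by (simp add: transpose_mult_dim mult_mat_vec_assoc)
  moreover have "(N * L)\<^sup>T *\<^sub>v ?e = ?e" using e unfolding L(2) 
    by (metis carrier_vec_dim_vec one_mult_mat_vec transpose_one)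
  ultimately have "?e = 0\<^sub>v (dim_col M)" by metis
  hence "?e $ dim_row M = 0" using assms by simp
  thus False using assms by (simp add: k_def)
qed

text \<open>Neither the matrix nor its transpose can be wide, so the matrix is square. Numbers of
  rows are determined in this way from kernel conditions alone.\<close>

lemma injective_imp_inverse:
  assumes "injective_mat M" "injective_mat M\<^sup>T"
  obtains N where "dim_row M = dim_col M" "N \<in> carrier_mat (dim_col M) (dim_col M)"
    "M * N = 1\<^sub>m (dim_col M)" "N * M = 1\<^sub>m (dim_col M)"
proof -
  have eq: "dim_row M = dim_col M"
    using wide_not_injective[of M] wide_not_injective[of "M\<^sup>T"] assms by fastforce
  hence "M \<in> carrier_mat (dim_col M) (dim_col M)" by auto
  from square_injective_inverse[OF this assms(1)] eq that show ?thesis by metis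
qed

lemma injective_mat_mult:
  assumes "injective_mat A" "injective_mat B" "dim_col A = dim_row B"
  shows "injective_mat (A * B)"
  unfolding injective_mat_def
proof (intro ballI impI)
  fix x assume x: "x \<in> carrier_vec (dim_col (A * B))" "(A * B) *\<^sub>v x = 0\<^sub>v (dim_row (A * B))"
  hence "A *\<^sub>v (B *\<^sub>v x) = 0\<^sub>v (dim_row A)" using assms by (simp add: mult_mat_vec_assoc)
  hence "B *\<^sub>v x = 0\<^sub>v (dim_col A)" using assms by (intro injective_matD) auto
  thus "x = 0\<^sub>v (dim_col (A * B))" using assms x injective_matD[of B x] by auto
qed

text \<open>The Gram matrix \<open>M * M\<^sup>T\<close> is invertible: if it maps \<open>y\<close>
  to zero, then \<open>w = M\<^sup>T *\<^sub>v y\<close> is orthogonal to itself and therefore zero.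
  The right inverse is \<open>M\<^sup>T\<close> times the inverse of the Gram matrix.\<close>

lemma right_inverse_of_injective_transpose:
  assumes "injective_mat M\<^sup>T"
  obtains R where "R \<in> carrier_mat (dim_col M) (dim_row M)" "M * R = 1\<^sub>m (dim_row M)"
proof -
  have "injective_mat (M * M\<^sup>T)" unfolding injective_mat_def
  proof (intro ballI impI)
    fix y assume y: "y \<in> carrier_vec (dim_col (M * M\<^sup>T))" "(M * M\<^sup>T) *\<^sub>v y = 0\<^sub>v (dim_row (M * M\<^sup>T))"
    define w where "w = M\<^sup>T *\<^sub>v y"
    have "M *\<^sub>v w = 0\<^sub>v (dim_row M)" using y by (simp add: w_def mult_mat_vec_assoc)
    hence "w \<bullet> w = 0" 
      using y transpose_vec_mult_scalar[of M "dim_row M" "dim_col M" w y]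
      by (simp add: w_def carrier_vecI carrier_matI)
    hence "w = 0\<^sub>v (dim_col M)" using scalar_prod_self_eq_0[of w "dim_col M"] by (auto simp: w_def)
    thus "y = 0\<^sub>v (dim_col (M * M\<^sup>T))" using injective_matD[OF assms, of y] y by (auto simp: w_def)
  qed
  then obtain N where "N \<in> carrier_mat (dim_row M) (dim_row M)" "M * M\<^sup>T * N = 1\<^sub>m (dim_row M)"
    using square_injective_inverse[of "M * M\<^sup>T" "dim_row M"] by auto
  thus ?thesis by (intro that[of "M\<^sup>T * N"]) (auto simp: mult_mat_assoc)
qed

lemma injective_transposeI_right_inverse:
  assumes "M * R = 1\<^sub>m (dim_row M)" "dim_col M = dim_row R"
  shows "injective_mat M\<^sup>T"
  using arg_cong[OF assms(1), of transpose_mat] assms(2)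
  by (intro injective_matI_left_inverse[of "R\<^sup>T"]) (simp_all add: transpose_mult_dim)

lemma invertible_mat_iff_injective:
  assumes M: "M \<in> carrier_mat n n"
  shows "invertible_mat M \<longleftrightarrow> injective_mat M"
proof
  assume "invertible_mat M"
  then obtain L where "M * L = 1\<^sub>m (dim_row M)" "L * M = 1\<^sub>m (dim_row L)"
    by (auto simp: invertible_mat_def inverts_mat_def)
  moreover from this have "dim_row L = dim_col M" "dim_col L = dim_row M"
    by (metis index_mult_mat(2,3) index_one_mat(2,3))+
  ultimately show "injective_mat M" by (intro injective_matI_left_inverse[of L]) auto
next
  assume "injective_mat M"
  then obtain N where "N \<in> carrier_mat n n" "M * N = 1\<^sub>m n" "N * M = 1\<^sub>m n"
    using square_injective_inverse[OF M] by metis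
  thus "invertible_mat M" using M by (auto simp: invertible_mat_def inverts_mat_def)
qed

lemma invertible_mat_inverse:
  fixes M :: "real mat"
  assumes "M \<in> carrier_mat n n" "invertible_mat M"
  obtains N where "N \<in> carrier_mat n n" "M * N = 1\<^sub>m n" "N * M = 1\<^sub>m n"
  using assms square_injective_inverse invertible_mat_iff_injective by metis

lemma injective_append_transposeI:
  assumes dims: "dim_col B = dim_col A"
    and inj: "\<And>a b. \<lbrakk>a \<in> carrier_vec (dim_row A); b \<in> carrier_vec (dim_row B);
      A\<^sup>T *\<^sub>v a + B\<^sup>T *\<^sub>v b = 0\<^sub>v (dim_col A)\<rbrakk> \<Longrightarrow> a = 0\<^sub>v (dim_row A) \<and> b = 0\<^sub>v (dim_row B)"
  shows "injective_mat (A @\<^sub>r B)\<^sup>T"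
  unfolding injective_mat_def
proof (intro ballI impI)
  fix y :: "real vec"
  assume y: "y \<in> carrier_vec (dim_col (A @\<^sub>r B)\<^sup>T)" "(A @\<^sub>r B)\<^sup>T *\<^sub>v y = 0\<^sub>v (dim_row (A @\<^sub>r B)\<^sup>T)"
  obtain a b where ab: "a \<in> carrier_vec (dim_row A)" "b \<in> carrier_vec (dim_row B)" "y = a @\<^sub>v b"
    using vec_split[of y "dim_row A" "dim_row B"] y(1) by auto
  have "A\<^sup>T *\<^sub>v a + B\<^sup>T *\<^sub>v b = 0\<^sub>v (dim_col A)"
    using y(2) ab dims by (simp add: append_rows_transpose_mult_vec)
  from inj[OF ab(1,2) this] show "y = 0\<^sub>v (dim_col (A @\<^sub>r B)\<^sup>T)" using ab(3) by simp
qed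

lemma injective_append_transposeD:
  assumes "injective_mat (A @\<^sub>r B)\<^sup>T" and dims: "dim_col B = dim_col A"
    and ab: "dim_vec a = dim_row A" "dim_vec b = dim_row B" "A\<^sup>T *\<^sub>v a + B\<^sup>T *\<^sub>v b = 0\<^sub>v n"
  shows "a = 0\<^sub>v (dim_row A) \<and> b = 0\<^sub>v (dim_row B)"
proof -
  have "a @\<^sub>v b = 0\<^sub>v (dim_row A) @\<^sub>v 0\<^sub>v (dim_row B)"
    using injective_matD[OF assms(1), of "a @\<^sub>v b" n] ab dims
    by (simp add: append_rows_transpose_mult_vec)
  thus ?thesis using ab by (subst (asm) append_vec_inject) auto
qed

section \<open>Orthonormal bases and orthogonal splittings of rows\<close>

lemma mult_mat_vec_smult:
  fixes A :: "real mat"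
  assumes "dim_vec x = dim_col A"
  shows "A *\<^sub>v (k \<cdot>\<^sub>v x) = k \<cdot>\<^sub>v (A *\<^sub>v x)"
  by (rule mult_mat_vec[of _ "dim_row A" "dim_col A"]) (use assms in simp_all)

lemma add_zero_vec [simp]:
  fixes v :: "real vec"
  shows "dim_vec v = n \<Longrightarrow> v + 0\<^sub>v n = v" "dim_vec v = n \<Longrightarrow> 0\<^sub>v n + v = v"
  by (auto intro!: eq_vecI)

text \<open>An orthonormal system in \<open>W\<close> with the greatest number of rows already spans
  \<open>W\<close>, since otherwise a normalized residual could be added. The greatest number exists
  because independent rows of length \<open>r\<close> number at most \<open>r\<close>. Subspaces are
  plain sets of vectors with closure properties.\<close>

lemma orthonormal_basis:
  fixes W :: "real vec set"
  assumes W: "W \<subseteq> carrier_vec r" "0\<^sub>v r \<in> W"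
    and add: "\<And>v w. v \<in> W \<Longrightarrow> w \<in> W \<Longrightarrow> v + w \<in> W"
    and smult: "\<And>c v. v \<in> W \<Longrightarrow> c \<cdot>\<^sub>v v \<in> W"
  obtains Z where "dim_col Z = r" "Z * Z\<^sup>T = 1\<^sub>m (dim_row Z)"
    "\<And>y. dim_vec y = dim_row Z \<Longrightarrow> Z\<^sup>T *\<^sub>v y \<in> W" "\<And>v. v \<in> W \<Longrightarrow> Z\<^sup>T *\<^sub>v (Z *\<^sub>v v) = v"
proof -
  define P where "P k \<longleftrightarrow> (\<exists>Z :: real mat. dim_row Z = k \<and> dim_col Z = r \<and> Z * Z\<^sup>T = 1\<^sub>m k \<and>
    (\<forall>y. dim_vec y = k \<longrightarrow> Z\<^sup>T *\<^sub>v y \<in> W))" for k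
  have P0: "P 0" unfolding P_def
    by (rule exI[of _ "0\<^sub>m 0 r"]) (use W in \<open>auto intro!: eq_matI\<close>)
  have bound: "k \<le> r" if "P k" for k
  proof -
    from that obtain Z :: "real mat" where Z: "dim_row Z = k" "dim_col Z = r" "Z * Z\<^sup>T = 1\<^sub>m k"
      unfolding P_def by blast
    have "injective_mat Z\<^sup>T" by (rule injective_matI_left_inverse[of Z]) (use Z in simp_all)
    thus ?thesis using wide_not_injective[of "Z\<^sup>T"] Z by fastforce
  qed
  define k where "k = Greatest P"
  have "P k" unfolding k_def by (rule GreatestI_nat[of P 0 r]) (use P0 bound in auto)
  then obtain Z where Z: "dim_row Z = k" "dim_col Z = r" "Z * Z\<^sup>T = 1\<^sub>m k"
      "\<And>y. dim_vec y = k \<Longrightarrow> Z\<^sup>T *\<^sub>v y \<in> W"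
    unfolding P_def by blast
  have ZZ: "Z *\<^sub>v (Z\<^sup>T *\<^sub>v y) = y" if "dim_vec y = k" for y
    using mult_mat_vec_assoc[of Z "Z\<^sup>T" y] Z(1-3) that by simp
  have "Z\<^sup>T *\<^sub>v (Z *\<^sub>v v) = v" if v: "v \<in> W" for v
  proof -
    have dv: "dim_vec v = r" using v W by auto
    \<comment> \<open>The Gram-Schmidt residual of \<open>v\<close>. It is written with the factor
      -1 because closure of \<open>W\<close> is given for sums and multiples.\<close>
    define w where "w = v + (-1) \<cdot>\<^sub>v (Z\<^sup>T *\<^sub>v (Z *\<^sub>v v))"
    have dw: "dim_vec w = r" by (simp add: w_def Z dv)
    have wW: "w \<in> W" unfolding w_def by (intro add smult v Z(4)) (simp add: Z)
    have "Z *\<^sub>v w = Z *\<^sub>v v + (-1) \<cdot>\<^sub>v (Z *\<^sub>v v)"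
      unfolding w_def using Z dv by (simp add: mult_mat_vec_add mult_mat_vec_smult ZZ)
    also have "\<dots> = 0\<^sub>v k" using Z dv by (intro eq_vecI) auto
    finally have Zw: "Z *\<^sub>v w = 0\<^sub>v k" .
    have "w = 0\<^sub>v r"
    proof (rule ccontr)
      assume "w \<noteq> 0\<^sub>v r"
      hence "w \<bullet> w \<noteq> 0" using scalar_prod_self_eq_0[of w r] dw by simp
      moreover have "w \<bullet> w \<ge> 0" by (simp add: scalar_prod_def sum_nonneg)
      ultimately have pos: "w \<bullet> w > 0" by simp
      define e where "e = (1 / sqrt (w \<bullet> w)) \<cdot>\<^sub>v w"
      have de: "dim_vec e = r" by (simp add: e_def dw)
      have ee: "e \<bullet> e = 1"
        using pos dw by (simp add: e_def scalar_prod_smult_distrib[of _ r] field_simps)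
      have Ze: "Z *\<^sub>v e = 0\<^sub>v k"
        using dw Z Zw by (simp add: e_def mult_mat_vec_smult) (auto intro!: eq_vecI)
      \<comment> \<open>The new basis vector as a matrix with one row, so that the enlarged system
        is a stack.\<close>
      define F where "F = mat 1 r (\<lambda>(i,j). e $ j)"
      have dF: "dim_row F = 1" "dim_col F = r" by (simp_all add: F_def)
      have Fv: "F *\<^sub>v x = vec 1 (\<lambda>_. e \<bullet> x)" if "dim_vec x = r" for x
        using that de by (intro eq_vecI) (auto simp: F_def scalar_prod_def)
      have FT: "F\<^sup>T *\<^sub>v b = (b $ 0) \<cdot>\<^sub>v e" if "dim_vec b = 1" for b
        using that de by (intro eq_vecI) (auto simp: F_def scalar_prod_def)
      define Z' where "Z' = Z @\<^sub>r F"
      have dZ': "dim_row Z' = Suc k" "dim_col Z' = r" by (simp_all add: Z'_def Z dF)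
      have Z'T: "Z'\<^sup>T *\<^sub>v (a @\<^sub>v b) = Z\<^sup>T *\<^sub>v a + (b $ 0) \<cdot>\<^sub>v e" if "dim_vec a = k" "dim_vec b = 1" for a b
        unfolding Z'_def using that Z dF by (simp add: append_rows_transpose_mult_vec FT)
      have split: "\<exists>a b. y = a @\<^sub>v b \<and> dim_vec a = k \<and> dim_vec b = 1"
        if "dim_vec y = Suc k" for y :: "real vec"
        using vec_split[of y k 1] that by (metis Suc_eq_plus1)
      have "Z' * Z'\<^sup>T = 1\<^sub>m (Suc k)"
      proof (rule mat_eq_via_vec)
        fix x :: "real vec" assume "x \<in> carrier_vec (Suc k)"
        hence "dim_vec x = Suc k" by simp
        then obtain a b where x: "x = a @\<^sub>v b" and a: "dim_vec a = k" and b: "dim_vec b = 1"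
          using split by blast
        have "e \<bullet> (Z\<^sup>T *\<^sub>v a) = (Z\<^sup>T *\<^sub>v a) \<bullet> e"
          using Z a de by (intro comm_scalar_prod[of _ r]) auto
        also have "\<dots> = a \<bullet> (Z *\<^sub>v e)"
          using Z a de by (intro transpose_vec_mult_scalar[of _ k r]) auto
        also have "\<dots> = 0" using a by (simp add: Ze)
        finally have ea: "e \<bullet> (Z\<^sup>T *\<^sub>v a) = 0" .
        have "(Z' * Z'\<^sup>T) *\<^sub>v x = Z' *\<^sub>v (Z\<^sup>T *\<^sub>v a + (b $ 0) \<cdot>\<^sub>v e)"
          using x a b dZ' by (simp add: mult_mat_vec_assoc Z'T)
        also have "\<dots> = Z *\<^sub>v (Z\<^sup>T *\<^sub>v a + (b $ 0) \<cdot>\<^sub>v e) @\<^sub>v F *\<^sub>v (Z\<^sup>T *\<^sub>v a + (b $ 0) \<cdot>\<^sub>v e)"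
          unfolding Z'_def by (rule append_rows_mult_vec) (simp_all add: Z dF de)
        also have "Z *\<^sub>v (Z\<^sup>T *\<^sub>v a + (b $ 0) \<cdot>\<^sub>v e) = a"
          using Z a de Ze by (simp add: mult_mat_vec_add mult_mat_vec_smult ZZ) (auto intro!: eq_vecI)
        also have "F *\<^sub>v (Z\<^sup>T *\<^sub>v a + (b $ 0) \<cdot>\<^sub>v e) = b"
          using Z a b de ea ee
          by (subst Fv) (auto intro!: eq_vecI simp: scalar_prod_add_distrib[of _ r])
        finally show "(Z' * Z'\<^sup>T) *\<^sub>v x = 1\<^sub>m (Suc k) *\<^sub>v x" using x a b by simp
      qed (simp_all add: dZ')
      moreover have "Z'\<^sup>T *\<^sub>v y \<in> W" if "dim_vec y = Suc k" for y
      proof -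
        obtain a b where y: "y = a @\<^sub>v b" "dim_vec a = k" "dim_vec b = 1" using split \<open>dim_vec y = Suc k\<close> by blast
        have "e \<in> W" unfolding e_def by (intro smult wW)
        thus ?thesis using y by (simp add: Z'T add smult Z(4))
      qed
      ultimately have "P (Suc k)" unfolding P_def using dZ' by blast
      hence "Suc k \<le> k" unfolding k_def by (intro Greatest_le_nat[of P _ r]) (use bound in auto)
      thus False by simp
    qed
    hence w0: "(v + (-1) \<cdot>\<^sub>v (Z\<^sup>T *\<^sub>v (Z *\<^sub>v v))) $ i = 0" if "i < r" for i
      using that by (simp add: w_def)
    show ?thesis
    proof (rule eq_vecI)
      fix i assume i: "i < dim_vec v"
      thus "(Z\<^sup>T *\<^sub>v (Z *\<^sub>v v)) $ i = v $ i" using w0[of i] dv Z by (simp del: index_mult_mat_vec)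
    qed (simp add: dv Z)
  qed
  thus thesis using that[of Z] Z by auto
qed

text \<open>The two products with the transpose, read blockwise: the rows of \<open>S\<close> and
  \<open>Z\<close> are orthonormal and mutually orthogonal, and together they resolve the
  identity.\<close>

lemma orthogonal_square_append:
  fixes S Z :: "real mat"
  assumes orth: "orthogonal_square r (S @\<^sub>r Z)" and dims: "dim_col S = r" "dim_col Z = r"
  shows "dim_row S + dim_row Z = r"
    and "dim_vec a = dim_row S \<Longrightarrow> S *\<^sub>v (S\<^sup>T *\<^sub>v a) = a"
    and "dim_vec b = dim_row Z \<Longrightarrow> Z *\<^sub>v (Z\<^sup>T *\<^sub>v b) = b"
    and "dim_vec a = dim_row S \<Longrightarrow> Z *\<^sub>v (S\<^sup>T *\<^sub>v a) = 0\<^sub>v (dim_row Z)"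
    and "dim_vec b = dim_row Z \<Longrightarrow> S *\<^sub>v (Z\<^sup>T *\<^sub>v b) = 0\<^sub>v (dim_row S)"
    and "dim_vec v = r \<Longrightarrow> S\<^sup>T *\<^sub>v (S *\<^sub>v v) + Z\<^sup>T *\<^sub>v (Z *\<^sub>v v) = v"
proof -
  let ?Q = "S @\<^sub>r Z"
  have Q: "?Q * ?Q\<^sup>T = 1\<^sub>m r" "?Q\<^sup>T * ?Q = 1\<^sub>m r" and r: "dim_row S + dim_row Z = r"
    using orth by (auto simp: orthogonal_square_def)
  show "dim_row S + dim_row Z = r" by (rule r)
  have 1: "(S *\<^sub>v (S\<^sup>T *\<^sub>v a + Z\<^sup>T *\<^sub>v b)) @\<^sub>v (Z *\<^sub>v (S\<^sup>T *\<^sub>v a + Z\<^sup>T *\<^sub>v b)) = a @\<^sub>v b"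
    if "dim_vec a = dim_row S" "dim_vec b = dim_row Z" for a b
  proof -
    have "(?Q * ?Q\<^sup>T) *\<^sub>v (a @\<^sub>v b) = ?Q *\<^sub>v (S\<^sup>T *\<^sub>v a + Z\<^sup>T *\<^sub>v b)"
      using dims that by (subst mult_mat_vec_assoc) (simp_all add: append_rows_transpose_mult_vec)
    thus ?thesis using dims that r by (simp add: Q append_rows_mult_vec)
  qed
  have 2: "S *\<^sub>v (S\<^sup>T *\<^sub>v a + Z\<^sup>T *\<^sub>v b) = a \<and> Z *\<^sub>v (S\<^sup>T *\<^sub>v a + Z\<^sup>T *\<^sub>v b) = b"
    if "dim_vec a = dim_row S" "dim_vec b = dim_row Z" for a b
    using 1[OF that] that by (subst (asm) append_vec_inject) auto
  show "S *\<^sub>v (S\<^sup>T *\<^sub>v a) = a" "Z *\<^sub>v (S\<^sup>T *\<^sub>v a) = 0\<^sub>v (dim_row Z)" if "dim_vec a = dim_row S"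
    using 2[of a "0\<^sub>v (dim_row Z)"] dims that by auto
  show "Z *\<^sub>v (Z\<^sup>T *\<^sub>v b) = b" "S *\<^sub>v (Z\<^sup>T *\<^sub>v b) = 0\<^sub>v (dim_row S)" if "dim_vec b = dim_row Z"
    using 2[of "0\<^sub>v (dim_row S)" b] dims that by auto
  show "S\<^sup>T *\<^sub>v (S *\<^sub>v v) + Z\<^sup>T *\<^sub>v (Z *\<^sub>v v) = v" if v: "dim_vec v = r"
  proof -
    have "(?Q\<^sup>T * ?Q) *\<^sub>v v = ?Q\<^sup>T *\<^sub>v ((S *\<^sub>v v) @\<^sub>v (Z *\<^sub>v v))"
      using dims v by (subst mult_mat_vec_assoc) (simp_all add: append_rows_mult_vec)
    thus ?thesis using dims v by (simp add: Q append_rows_transpose_mult_vec)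
  qed
qed

text \<open>\<open>Z\<close> is an orthonormal basis of \<open>W\<close>, and \<open>S\<close> is
  one of the orthogonal complement, which is the kernel of \<open>Z\<close>. In the applications
  \<open>W\<close> holds the coefficients of dependent rows: \<open>Z\<close> singles them out and
  \<open>S\<close> keeps the rest.\<close>

lemma orthogonal_split:
  fixes W :: "real vec set"
  assumes W: "W \<subseteq> carrier_vec r" "0\<^sub>v r \<in> W"
    and add: "\<And>v w. v \<in> W \<Longrightarrow> w \<in> W \<Longrightarrow> v + w \<in> W"
    and smult: "\<And>c v. v \<in> W \<Longrightarrow> c \<cdot>\<^sub>v v \<in> W"
  obtains S Z where "dim_col S = r" "dim_col Z = r" "orthogonal_square r (S @\<^sub>r Z)"
    "\<And>y. dim_vec y = dim_row Z \<Longrightarrow> Z\<^sup>T *\<^sub>v y \<in> W"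
    "\<And>v. v \<in> W \<Longrightarrow> S *\<^sub>v v = 0\<^sub>v (dim_row S)"
proof -
  obtain Z where Z: "dim_col Z = r" "Z * Z\<^sup>T = 1\<^sub>m (dim_row Z)"
    "\<And>y. dim_vec y = dim_row Z \<Longrightarrow> Z\<^sup>T *\<^sub>v y \<in> W" "\<And>v. v \<in> W \<Longrightarrow> Z\<^sup>T *\<^sub>v (Z *\<^sub>v v) = v"
    using orthonormal_basis[OF assms] by blast
  define V where "V = {v \<in> carrier_vec r. Z *\<^sub>v v = 0\<^sub>v (dim_row Z)}"
  have V: "V \<subseteq> carrier_vec r" "0\<^sub>v r \<in> V" "\<And>v w. v \<in> V \<Longrightarrow> w \<in> V \<Longrightarrow> v + w \<in> V"
    "\<And>c v. v \<in> V \<Longrightarrow> c \<cdot>\<^sub>v v \<in> V"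
    by (auto simp: V_def Z(1) mult_mat_vec_add mult_mat_vec_smult)
  obtain S where S: "dim_col S = r" "S * S\<^sup>T = 1\<^sub>m (dim_row S)"
    "\<And>y. dim_vec y = dim_row S \<Longrightarrow> S\<^sup>T *\<^sub>v y \<in> V" "\<And>v. v \<in> V \<Longrightarrow> S\<^sup>T *\<^sub>v (S *\<^sub>v v) = v"
    using orthonormal_basis[OF V] by blast
  have ZS0: "Z * S\<^sup>T = 0\<^sub>m (dim_row Z) (dim_row S)"
    by (rule mat_eq_via_vec[of _ "dim_row Z" "dim_row S"]) (use S(3) in \<open>simp_all add: V_def Z S(1) mult_mat_vec_assoc\<close>)
  have SZ0: "S * Z\<^sup>T = 0\<^sub>m (dim_row S) (dim_row Z)"
    using arg_cong[OF ZS0, of transpose_mat] Z S by (simp add: transpose_mult_dim)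
  have v1: "S *\<^sub>v (S\<^sup>T *\<^sub>v a) = a" "Z *\<^sub>v (S\<^sup>T *\<^sub>v a) = 0\<^sub>v (dim_row Z)" if "dim_vec a = dim_row S" for a
    using that Z S mult_mat_vec_assoc[of S "S\<^sup>T" a] mult_mat_vec_assoc[of Z "S\<^sup>T" a] ZS0 by simp_all
  have v2: "Z *\<^sub>v (Z\<^sup>T *\<^sub>v b) = b" "S *\<^sub>v (Z\<^sup>T *\<^sub>v b) = 0\<^sub>v (dim_row S)" if "dim_vec b = dim_row Z" for b
    using that Z S mult_mat_vec_assoc[of S "Z\<^sup>T" b] mult_mat_vec_assoc[of Z "Z\<^sup>T" b] SZ0 by simp_all
  let ?Q = "S @\<^sub>r Z"
  have QQT: "?Q * ?Q\<^sup>T = 1\<^sub>m (dim_row S + dim_row Z)"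
  proof (rule mat_eq_via_vec)
    fix x :: "real vec" assume "x \<in> carrier_vec (dim_row S + dim_row Z)"
    hence "dim_vec x = dim_row S + dim_row Z" by simp
    then obtain a b where x: "x = a @\<^sub>v b" "dim_vec a = dim_row S" "dim_vec b = dim_row Z"
      by (elim vec_split) blast
    have "(?Q * ?Q\<^sup>T) *\<^sub>v x = ?Q *\<^sub>v (S\<^sup>T *\<^sub>v a + Z\<^sup>T *\<^sub>v b)"
      using x Z S by (subst mult_mat_vec_assoc) (simp_all add: append_rows_transpose_mult_vec)
    also have "\<dots> = x"
      using x Z(1) S(1) by (simp add: append_rows_mult_vec mult_mat_vec_add v1 v2 append_vec_plus)
    finally show "(?Q * ?Q\<^sup>T) *\<^sub>v x = 1\<^sub>m (dim_row S + dim_row Z) *\<^sub>v x" using x by simp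
  qed (simp_all add: Z S)
  have QTQ: "?Q\<^sup>T * ?Q = 1\<^sub>m r"
  proof (rule mat_eq_via_vec)
    fix v :: "real vec" assume v: "v \<in> carrier_vec r"
    define w where "w = v - Z\<^sup>T *\<^sub>v (Z *\<^sub>v v)"
    have "w \<in> V" using v Z by (auto simp: w_def V_def mult_mat_vec_diff v2)
    hence "S\<^sup>T *\<^sub>v (S *\<^sub>v w) = w" by (rule S(4))
    moreover have "S *\<^sub>v w = S *\<^sub>v v" using v Z S by (auto simp: w_def mult_mat_vec_diff v2)
    ultimately have "S\<^sup>T *\<^sub>v (S *\<^sub>v v) + Z\<^sup>T *\<^sub>v (Z *\<^sub>v v) = w + Z\<^sup>T *\<^sub>v (Z *\<^sub>v v)" by simp
    also have "\<dots> = v" unfolding w_def using v Z by (intro eq_vecI) auto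
    finally show "(?Q\<^sup>T * ?Q) *\<^sub>v v = 1\<^sub>m r *\<^sub>v v"
      using v Z S by (simp add: mult_mat_vec_assoc append_rows_mult_vec append_rows_transpose_mult_vec)
  qed (simp_all add: Z S)
  \<comment> \<open>That the two bases have \<open>r\<close> rows together is not counted but
    inferred: \<open>?Q\<close> and its transpose are both injective, so \<open>?Q\<close> is
    square.\<close>
  have "injective_mat ?Q" "injective_mat ?Q\<^sup>T"
    using injective_matI_left_inverse[of "?Q\<^sup>T" ?Q] injective_matI_left_inverse[of ?Q "?Q\<^sup>T"]
      QQT QTQ S Z by simp_all
  from injective_imp_inverse[OF this] have r: "dim_row S + dim_row Z = r" using S by auto
  have "S *\<^sub>v v = 0\<^sub>v (dim_row S)" if v: "v \<in> W" for v
    using v2(2)[of "Z *\<^sub>v v"] Z(4)[OF v] by simp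
  thus thesis using that[of S Z] S Z QQT QTQ r by (auto simp: orthogonal_square_def)
qed

text \<open>Here \<open>W\<close> is the left kernel of \<open>M\<close>. If a combination of the
  rows of \<open>S * M\<close> with coefficients \<open>y\<close> vanishes, then
  \<open>S\<^sup>T *\<^sub>v y\<close> lies in \<open>W\<close>, where \<open>S\<close> vanishes;
  since \<open>S * S\<^sup>T\<close> is the identity, \<open>y\<close> is zero.\<close>

lemma row_compression:
  fixes M :: "real mat"
  obtains S Z where "dim_col S = dim_row M" "dim_col Z = dim_row M"
    "orthogonal_square (dim_row M) (S @\<^sub>r Z)"
    "injective_mat (S * M)\<^sup>T" "Z * M = 0\<^sub>m (dim_row Z) (dim_col M)"
proof -
  define W where "W = {y \<in> carrier_vec (dim_row M). M\<^sup>T *\<^sub>v y = 0\<^sub>v (dim_col M)}"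
  have W: "W \<subseteq> carrier_vec (dim_row M)" "0\<^sub>v (dim_row M) \<in> W"
    "\<And>v w. v \<in> W \<Longrightarrow> w \<in> W \<Longrightarrow> v + w \<in> W" "\<And>c v. v \<in> W \<Longrightarrow> c \<cdot>\<^sub>v v \<in> W"
    by (auto simp: W_def mult_mat_vec_add mult_mat_vec_smult)
  obtain S Z where SZ: "dim_col S = dim_row M" "dim_col Z = dim_row M"
    "orthogonal_square (dim_row M) (S @\<^sub>r Z)"
    and ZW: "\<And>y. dim_vec y = dim_row Z \<Longrightarrow> Z\<^sup>T *\<^sub>v y \<in> W"
    and SW: "\<And>v. v \<in> W \<Longrightarrow> S *\<^sub>v v = 0\<^sub>v (dim_row S)"
    using orthogonal_split[OF W] by blast
  note orth = orthogonal_square_append[OF SZ(3,1,2)]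
  have "injective_mat (S * M)\<^sup>T" unfolding injective_mat_def
  proof (intro ballI impI)
    fix y assume y: "y \<in> carrier_vec (dim_col (S * M)\<^sup>T)" "(S * M)\<^sup>T *\<^sub>v y = 0\<^sub>v (dim_row (S * M)\<^sup>T)"
    hence "S\<^sup>T *\<^sub>v y \<in> W"
      using SZ by (simp add: W_def transpose_mult_dim mult_mat_vec_assoc)
    from SW[OF this] show "y = 0\<^sub>v (dim_col (S * M)\<^sup>T)" using orth(2)[of y] y by simp
  qed
  moreover have "(Z * M)\<^sup>T = 0\<^sub>m (dim_col M) (dim_row Z)"
  proof (rule mat_eq_via_vec[of _ "dim_col M" "dim_row Z"])
    fix x :: "real vec" assume "x \<in> carrier_vec (dim_row Z)"
    thus "(Z * M)\<^sup>T *\<^sub>v x = 0\<^sub>m (dim_col M) (dim_row Z) *\<^sub>v x"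
      using ZW[of x] SZ by (simp add: W_def transpose_mult_dim mult_mat_vec_assoc)
  qed simp_all
  hence "Z * M = 0\<^sub>m (dim_row Z) (dim_col M)"
    by (metis transpose_transpose zero_transpose_mat)
  ultimately show thesis using that SZ by blast
qed

section \<open>Rank and row relations\<close>

text \<open>The bridge to the rank function of the library: as \<open>H\<close> is onto,
  \<open>G * H\<close> has the column space of \<open>G\<close>, whose columns are
  independent.\<close>

lemma mat_rank_mult_right_inverse:
  fixes G H :: "real mat"
  assumes G: "injective_mat G" and H: "H * R = 1\<^sub>m (dim_row H)" "dim_col H = dim_row R"
    and dims: "dim_col G = dim_row H"
  shows "mat_rank (G * H) = dim_col G"
proof -
  interpret vec_space "TYPE(real)" "dim_row G" .
  have GH: "(G * H) *\<^sub>v x = G *\<^sub>v (H *\<^sub>v x)" if "dim_vec x = dim_col H" for x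
    using that dims by (simp add: mult_mat_vec_assoc)
  have R: "dim_col R = dim_row H" using arg_cong[OF H(1), of dim_col] by simp
  have HR: "H *\<^sub>v (R *\<^sub>v y) = y" if "dim_vec y = dim_row H" for y
    using mult_mat_vec_assoc[of H R y] that H R by simp
  have "col_space (G * H) = (\<lambda>x. (G * H) *\<^sub>v x) ` carrier_vec (dim_col H)"
    by (subst col_space_eq[of _ "dim_col H"]) auto
  also have "\<dots> = (\<lambda>y. G *\<^sub>v y) ` (\<lambda>x. H *\<^sub>v x) ` carrier_vec (dim_col H)"
    unfolding image_image by (rule image_cong[OF refl]) (rule GH, simp only: carrier_dim_vec)
  also have "(\<lambda>x. H *\<^sub>v x) ` carrier_vec (dim_col H) = carrier_vec (dim_row H)"
  proof
    show "carrier_vec (dim_row H) \<subseteq> (\<lambda>x. H *\<^sub>v x) ` carrier_vec (dim_col H)"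
    proof
      fix y :: "real vec" assume "y \<in> carrier_vec (dim_row H)"
      hence "dim_vec y = dim_row H" by (simp only: carrier_dim_vec)
      from HR[OF this] show "y \<in> (\<lambda>x. H *\<^sub>v x) ` carrier_vec (dim_col H)"
        by (intro image_eqI[of _ _ "R *\<^sub>v y"]) (simp_all add: H(2))
    qed
  next
    show "(\<lambda>x. H *\<^sub>v x) ` carrier_vec (dim_col H) \<subseteq> carrier_vec (dim_row H)"
      by (rule image_subsetI) (simp only: carrier_dim_vec dim_mult_mat_vec)
  qed
  also have "(\<lambda>y. G *\<^sub>v y) ` carrier_vec (dim_row H) = col_space G"
    using dims by (subst col_space_eq[of _ "dim_col G"]) auto
  finally have "col_space (G * H) = col_space G" .
  hence "rank (G * H) = rank G" unfolding rank_def col_space_def by simp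
  also have "rank G = dim_col G"
  proof (rule lin_indpt_full_rank)
    \<comment> \<open>Linear independence is stated for the set of columns, so repeated columns have
      to be excluded separately.\<close>
    show d: "distinct (cols G)"
    proof (rule ccontr)
      assume "\<not> distinct (cols G)"
      then obtain i j where ij: "i < dim_col G" "j < dim_col G" "i \<noteq> j" "col G i = col G j"
        by (auto simp: distinct_conv_nth)
      have "G *\<^sub>v unit_vec (dim_col G) k = col G k" if "k < dim_col G" for k
        using that by (intro eq_vecI) simp_all
      hence "G *\<^sub>v unit_vec (dim_col G) i = G *\<^sub>v unit_vec (dim_col G) j" using ij by simp
      from injective_mat_cancel[OF G _ _ this]
      have "unit_vec (dim_col G) i = (unit_vec (dim_col G) j :: real vec)" by simp
      from arg_cong[OF this, of "\<lambda>v. v $ i"] show False using ij(1-3) by (simp add: unit_vec_def)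
    qed
    show "lin_indpt (set (cols G))"
    proof
      assume "lin_dep (set (cols G))"
      then obtain v where "v \<in> carrier_vec (dim_col G)" "v \<noteq> 0\<^sub>v (dim_col G)" "G *\<^sub>v v = 0\<^sub>v (dim_row G)"
        using lin_depE[of G "dim_col G", OF _ _ d] by auto
      thus False using injective_matD[OF G] by auto
    qed
  qed simp
  finally show ?thesis by (simp add: mat_rank_def)
qed

text \<open>Row compression gives \<open>M = S\<^sup>T * (S * M)\<close>, since the part seen by
  \<open>Z\<close> vanishes. The number of rows of \<open>H\<close> is the rank, which turns rank
  statements into kernel statements.\<close>

lemma rank_factorization:
  fixes M :: "real mat"
  obtains G H where "M = G * H" "dim_col G = dim_row H" "injective_mat G" "injective_mat H\<^sup>T"
proof -
  obtain S Z where SZ: "dim_col S = dim_row M" "dim_col Z = dim_row M"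
    "orthogonal_square (dim_row M) (S @\<^sub>r Z)"
    and inj: "injective_mat (S * M)\<^sup>T" and ZM: "Z * M = 0\<^sub>m (dim_row Z) (dim_col M)"
    using row_compression[of M] by blast
  note orth = orthogonal_square_append[OF SZ(3,1,2)]
  have "M = S\<^sup>T * (S * M)"
  proof (rule mat_eq_via_vec[of _ "dim_row M" "dim_col M"])
    fix x :: "real vec" assume x: "x \<in> carrier_vec (dim_col M)"
    have "Z *\<^sub>v (M *\<^sub>v x) = 0\<^sub>v (dim_row Z)"
      using mult_mat_vec_assoc[of Z M x] x SZ ZM by simp
    hence "S\<^sup>T *\<^sub>v (S *\<^sub>v (M *\<^sub>v x)) = M *\<^sub>v x" using orth(6)[of "M *\<^sub>v x"] SZ by simp
    thus "M *\<^sub>v x = S\<^sup>T * (S * M) *\<^sub>v x" using SZ x by (simp add: mult_mat_vec_assoc)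
  qed (simp_all add: SZ)
  moreover have "injective_mat S\<^sup>T" unfolding injective_mat_def
    using orth(2) SZ by (metis carrier_dim_vec index_transpose_mat(2,3) mult_mat_zero_vec)
  ultimately show thesis using that[of "S\<^sup>T" "S * M"] inj by simp
qed

lemma mat_rank_mult_full:
  fixes G H :: "real mat"
  assumes "injective_mat G" "injective_mat H\<^sup>T" "dim_col G = dim_row H"
  shows "mat_rank (G * H) = dim_col G"
proof -
  obtain R where "R \<in> carrier_mat (dim_col H) (dim_row H)" "H * R = 1\<^sub>m (dim_row H)"
    using right_inverse_of_injective_transpose[OF assms(2)] by blast
  thus ?thesis using assms by (intro mat_rank_mult_right_inverse) auto
qed

lemma injective_one_mat: "injective_mat (1\<^sub>m n)"
  by (rule injective_matI_left_inverse[of "1\<^sub>m n"]) simp_all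

text \<open>From rank to kernel: in a rank factorization the left factor has as many columns as
  rows; being injective it is invertible, and the independence of the rows of \<open>H\<close>
  passes to \<open>M\<close>.\<close>

lemma full_row_rank_iff_injective_transpose: "full_row_rank M \<longleftrightarrow> injective_mat M\<^sup>T"
proof
  assume "injective_mat M\<^sup>T"
  thus "full_row_rank M"
    using mat_rank_mult_full[OF injective_one_mat, of M "dim_row M"] by (simp add: full_row_rank_def)
next
  assume full: "full_row_rank M"
  obtain G H where GH: "M = G * H" "dim_col G = dim_row H" "injective_mat G" "injective_mat H\<^sup>T"
    using rank_factorization .
  hence "dim_col G = dim_row G"
    using full mat_rank_mult_full[of G H] by (simp add: full_row_rank_def)
  then obtain N where "N \<in> carrier_mat (dim_col G) (dim_col G)" "G * N = 1\<^sub>m (dim_col G)"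
    using square_injective_inverse[of G "dim_col G"] GH by auto
  hence "injective_mat G\<^sup>T" using \<open>dim_col G = dim_row G\<close>
    by (intro injective_transposeI_right_inverse[of _ N]) auto
  thus "injective_mat M\<^sup>T" using GH by (simp add: transpose_mult_dim injective_mat_mult)
qed

lemma mat_rank_mult_injective:
  fixes M U :: "real mat"
  assumes "injective_mat U" "dim_col U = dim_row M"
  shows "mat_rank (U * M) = mat_rank M"
proof -
  obtain G H where GH: "M = G * H" "dim_col G = dim_row H" "injective_mat G" "injective_mat H\<^sup>T"
    using rank_factorization .
  have "U * M = (U * G) * H" using GH assms by (simp add: mult_mat_assoc)
  hence "mat_rank (U * M) = dim_col G"
    using GH assms mat_rank_mult_full[of "U * G" H] by (simp add: injective_mat_mult)
  thus ?thesis using GH mat_rank_mult_full[of G H] by simp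
qed

text \<open>\<open>F\<close> is the block diagonal matrix of \<open>A\<close> and \<open>B\<close>.
  It scales the two parts of a stack separately and, being injective, preserves the rank of the
  stack.\<close>

lemma block_diagonal_injective:
  fixes A B :: "real mat"
  assumes "injective_mat A" "injective_mat B"
  obtains F where "injective_mat F" "dim_row F = dim_row A + dim_row B"
    "dim_col F = dim_col A + dim_col B"
    "\<And>P Q. \<lbrakk>dim_row P = dim_col A; dim_row Q = dim_col B; dim_col Q = dim_col P\<rbrakk> \<Longrightarrow>
      F * (P @\<^sub>r Q) = (A * P) @\<^sub>r (B * Q)"
proof -
  define F where "F = four_block_mat A (0\<^sub>m (dim_row A) (dim_col B)) (0\<^sub>m (dim_row B) (dim_col A)) B"
  have dF: "dim_row F = dim_row A + dim_row B" "dim_col F = dim_col A + dim_col B"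
    by (simp_all add: F_def)
  have F: "F *\<^sub>v (a @\<^sub>v b) = (A *\<^sub>v a) @\<^sub>v (B *\<^sub>v b)"
    if "dim_vec a = dim_col A" "dim_vec b = dim_col B" for a b
    unfolding F_def using that
    by (subst four_block_mat_mult_vec[of _ "dim_row A" "dim_col A" _ "dim_col B" _ "dim_row B"]) simp_all
  have "injective_mat F" unfolding injective_mat_def
  proof (intro ballI impI)
    fix x assume x: "x \<in> carrier_vec (dim_col F)" "F *\<^sub>v x = 0\<^sub>v (dim_row F)"
    then obtain a b where ab: "dim_vec a = dim_col A" "dim_vec b = dim_col B" "x = a @\<^sub>v b"
      using vec_split[of x "dim_col A" "dim_col B"] dF by auto
    hence "(A *\<^sub>v a) @\<^sub>v (B *\<^sub>v b) = 0\<^sub>v (dim_row A) @\<^sub>v 0\<^sub>v (dim_row B)" using x dF by (simp add: F)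
    hence "A *\<^sub>v a = 0\<^sub>v (dim_row A)" "B *\<^sub>v b = 0\<^sub>v (dim_row B)"
      by (subst (asm) append_vec_inject, simp, simp)+
    hence "a = 0\<^sub>v (dim_col A)" "b = 0\<^sub>v (dim_col B)"
      using assms ab injective_matD by blast+
    thus "x = 0\<^sub>v (dim_col F)" using ab dF by simp
  qed
  moreover have "F * (P @\<^sub>r Q) = (A * P) @\<^sub>r (B * Q)"
    if "dim_row P = dim_col A" "dim_row Q = dim_col B" "dim_col Q = dim_col P" for P Q
    by (rule mat_eq_via_vec[of _ "dim_row F" "dim_col P"])
      (use that dF in \<open>simp_all add: mult_mat_vec_assoc append_rows_mult_vec F\<close>)
  ultimately show thesis using that dF by blast
qed

text \<open>\<open>Q\<close> may have dependent rows, so it is replaced by the factor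
  \<open>H\<close> of a rank factorization, which has the same row space. The rows of
  \<open>P\<close> and \<open>H\<close> together are independent, and an injective block diagonal
  matrix turns this stack into that of \<open>P\<close> and \<open>Q\<close>.\<close>

lemma no_hidden_redundancyI:
  fixes P Q :: "real mat"
  assumes P: "injective_mat P\<^sup>T" and dims: "dim_col Q = dim_col P"
    and indep: "\<And>a b. \<lbrakk>dim_vec a = dim_row P; dim_vec b = dim_row Q;
      P\<^sup>T *\<^sub>v a + Q\<^sup>T *\<^sub>v b = 0\<^sub>v (dim_col P)\<rbrakk> \<Longrightarrow> a = 0\<^sub>v (dim_row P)"
  shows "no_hidden_redundancy P Q"
proof -
  obtain G H where GH: "Q = G * H" "dim_col G = dim_row H" "injective_mat G" "injective_mat H\<^sup>T"
    using rank_factorization .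
  obtain R where R: "dim_row R = dim_row G" "dim_col R = dim_col G" "G\<^sup>T * R = 1\<^sub>m (dim_col G)"
    using right_inverse_of_injective_transpose[of "G\<^sup>T"] GH(3) by auto
  have "injective_mat (P @\<^sub>r H)\<^sup>T"
  proof (rule injective_append_transposeI)
    show "dim_col H = dim_col P" using GH(1) dims by simp
    fix a b assume a: "a \<in> carrier_vec (dim_row P)" and b: "b \<in> carrier_vec (dim_row H)"
      and eq: "P\<^sup>T *\<^sub>v a + H\<^sup>T *\<^sub>v b = 0\<^sub>v (dim_col P)"
    \<comment> \<open>A combination of the rows of \<open>H\<close> is lifted to one of the rows of
      \<open>Q\<close>: as \<open>R\<close> is a right inverse of \<open>G\<^sup>T\<close>, the
      coefficients \<open>R *\<^sub>v b\<close> produce the same vector from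
      \<open>Q\<close>.\<close>
    have b': "b = G\<^sup>T *\<^sub>v (R *\<^sub>v b)" using mult_mat_vec_assoc[of "G\<^sup>T" R b] R b GH(2) by simp
    have "Q\<^sup>T *\<^sub>v (R *\<^sub>v b) = H\<^sup>T *\<^sub>v b"
      using b' R GH(1,2) by (simp add: transpose_mult_dim mult_mat_vec_assoc)
    hence a0: "a = 0\<^sub>v (dim_row P)" using indep[of a "R *\<^sub>v b"] a eq R GH(1) by simp
    hence "H\<^sup>T *\<^sub>v b = 0\<^sub>v (dim_col P)" using eq GH(1) dims by simp
    hence "b = 0\<^sub>v (dim_row H)" using injective_matD[OF GH(4), of b] b by simp
    with a0 show "a = 0\<^sub>v (dim_row P) \<and> b = 0\<^sub>v (dim_row H)" by simp
  qed
  moreover obtain F where F: "injective_mat F" "dim_col F = dim_row P + dim_col G"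
    "F * (P @\<^sub>r H) = (1\<^sub>m (dim_row P) * P) @\<^sub>r (G * H)"
    using block_diagonal_injective[OF injective_one_mat GH(3), of "dim_row P"] GH dims
    by (metis index_mult_mat(3) index_one_mat(2,3))
  ultimately have "mat_rank (P @\<^sub>r Q) = dim_row P + dim_col G"
    using mat_rank_mult_full[of F "P @\<^sub>r H"] GH by simp
  moreover have "mat_rank P = dim_row P"
    using P by (simp add: full_row_rank_iff_injective_transpose[symmetric] full_row_rank_def)
  moreover have "mat_rank Q = dim_col G" using GH by (simp add: mat_rank_mult_full)
  ultimately show ?thesis by (simp add: no_hidden_redundancy_def)
qed

text \<open>Both the rank of \<open>P\<close> and that of the stack are unaffected by
  \<open>U\<close>. It serves the case in which a step removes no rows: what was arranged for the
  product with an orthogonal matrix then holds for the block itself.\<close>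

lemma no_hidden_redundancy_mult_injective:
  fixes P Q U :: "real mat"
  assumes U: "injective_mat U" "dim_col U = dim_row P" and dims: "dim_col Q = dim_col P"
    and "no_hidden_redundancy (U * P) Q"
  shows "no_hidden_redundancy P Q"
proof -
  obtain F where F: "injective_mat F" "dim_col F = dim_row P + dim_row Q"
    "F * (P @\<^sub>r Q) = (U * P) @\<^sub>r (1\<^sub>m (dim_row Q) * Q)"
    using block_diagonal_injective[OF U(1) injective_one_mat, of "dim_row Q"] U(2) dims
    by (metis index_one_mat(2,3))
  hence "mat_rank (P @\<^sub>r Q) = mat_rank ((U * P) @\<^sub>r Q)"
    using mat_rank_mult_injective[of F "P @\<^sub>r Q"] by simp
  thus ?thesis
    using assms(4) mat_rank_mult_injective[OF U] by (simp add: no_hidden_redundancy_def)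
qed

lemma no_hidden_redundancy_full_row_rank:
  assumes "no_hidden_redundancy P Q" "full_row_rank P" "full_row_rank Q"
  shows "full_row_rank (P @\<^sub>r Q)"
  using assms by (simp add: no_hidden_redundancy_def full_row_rank_def)

lemma vec_add_right_cancel:
  fixes a b c :: "real vec"
  assumes "dim_vec a = dim_vec c" "dim_vec b = dim_vec c"
  shows "a + c = b + c \<longleftrightarrow> a = b"
proof
  assume eq: "a + c = b + c"
  show "a = b"
  proof (rule eq_vecI)
    fix i assume "i < dim_vec b"
    thus "a $ i = b $ i" using arg_cong[OF eq, of "\<lambda>v. v $ i"] assms by simp
  qed (simp add: assms)
qed simp

text \<open>Replacing a block row by its \<open>S\<close> part and its \<open>Z\<close> part is
  reversible; the recovery of the original equations rests on this.\<close>

lemma orthogonal_square_cancel: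
  assumes orth: "orthogonal_square r (S @\<^sub>r Z)" and dims: "dim_col S = r" "dim_col Z = r"
    and "dim_vec e = r" "dim_vec f = r"
  shows "S *\<^sub>v e = S *\<^sub>v f \<and> Z *\<^sub>v e = Z *\<^sub>v f \<longleftrightarrow> e = f"
  using orthogonal_square_append(6)[OF orth dims, of e] orthogonal_square_append(6)[OF orth dims, of f]
    assms(4,5) by metis

section \<open>Stacked matrices\<close>

lemma vstack_Nil [simp]: "vstack nc [] = 0\<^sub>m 0 nc"
  and vstack_Cons [simp]: "vstack nc (M # Ms) = M @\<^sub>r vstack nc Ms"
  by (simp_all add: vstack_def)

lemma dim_vstack:
  assumes "\<forall>M\<in>set Ms. dim_col M = nc"
  shows "dim_row (vstack nc Ms) = sum_list (map dim_row Ms)" "dim_col (vstack nc Ms) = nc"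
  using assms by (induction Ms) simp_all

lemma vstack_mult:
  assumes "\<forall>M\<in>set Ms. dim_col M = nc" "nc = dim_row N"
  shows "vstack nc Ms * N = vstack (dim_col N) (map (\<lambda>M. M * N) Ms)"
  using assms(1)
proof (induction Ms)
  case Nil
  show ?case by (intro eq_matI) simp_all
next
  case (Cons M Ms)
  thus ?case using assms(2) dim_vstack(2)[of Ms nc] by (simp add: append_rows_mult)
qed

lemma dim_hstack:
  assumes "\<forall>M\<in>set Ms. dim_row M = nr"
  shows "dim_row (hstack nr Ms) = nr" "dim_col (hstack nr Ms) = sum_list (map dim_col Ms)"
  using assms dim_vstack[of "map transpose_mat Ms" nr] by (simp_all add: hstack_def o_def)

lemma mult_hstack:
  assumes "\<forall>M\<in>set Ms. dim_row M = nr" "dim_col A = nr"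
  shows "A * hstack nr Ms = hstack (dim_row A) (map (\<lambda>M. A * M) Ms)"
proof -
  have d: "\<forall>M\<in>set (map transpose_mat Ms). dim_col M = nr" using assms by simp
  have "A * hstack nr Ms = (vstack nr (map transpose_mat Ms) * A\<^sup>T)\<^sup>T"
    using assms dim_vstack(2)[OF d] by (simp add: transpose_mult_dim hstack_def)
  also have "vstack nr (map transpose_mat Ms) * A\<^sup>T
      = vstack (dim_row A) (map (\<lambda>M. M * A\<^sup>T) (map transpose_mat Ms))"
    using vstack_mult[OF d, of "A\<^sup>T"] assms by simp
  also have "map (\<lambda>M. M * A\<^sup>T) (map transpose_mat Ms) = map transpose_mat (map (\<lambda>M. A * M) Ms)"
    using assms by (simp add: transpose_mult_dim)
  finally show ?thesis by (simp add: hstack_def)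
qed

section \<open>Equations at one time\<close>

definition eq_holds :: "descr_eq \<Rightarrow> real vec \<Rightarrow> real vec \<Rightarrow> real vec \<Rightarrow> real vec \<Rightarrow> bool" where
  "eq_holds e x2 x1 x0 u \<longleftrightarrow> cA e *\<^sub>v x2 + cB e *\<^sub>v x1 + cC e *\<^sub>v x0 + cD e *\<^sub>v u = rhs e"

definition sized_eq :: "nat \<Rightarrow> nat \<Rightarrow> nat \<Rightarrow> descr_eq \<Rightarrow> bool" where
  "sized_eq m d p e \<longleftrightarrow> cA e \<in> carrier_mat m d \<and> cB e \<in> carrier_mat m d \<and>
     cC e \<in> carrier_mat m d \<and> cD e \<in> carrier_mat m p \<and> rhs e \<in> carrier_vec m"

lemma descriptor_system_iff: "descriptor_system n0 m d p E \<longleftrightarrow> (\<forall>n\<ge>n0. sized_eq m d p (E n))"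
  by (simp add: descriptor_system_def sized_eq_def)

lemma solutions_iff:
  "x \<in> solutions n0 d E u \<longleftrightarrow>
    (\<forall>n\<ge>n0. dim_vec (x n) = d \<and> eq_holds (E n) (x (n + 2)) (x (n + 1)) (x n) (u n))"
  by (simp add: solutions_def eq_holds_def)

lemma block_sum_append_iff:
  fixes A A' B B' C C' D D' :: "real mat"
  assumes "dim_col A = dim_vec x2" "dim_col A' = dim_vec x2"
    "dim_col B = dim_vec x1" "dim_col B' = dim_vec x1"
    "dim_col C = dim_vec x0" "dim_col C' = dim_vec x0"
    "dim_col D = dim_vec u" "dim_col D' = dim_vec u"
    and "dim_row B = dim_row A" "dim_row C = dim_row A" "dim_row D = dim_row A" "dim_vec f = dim_row A"
    and "dim_row B' = dim_row A'" "dim_row C' = dim_row A'" "dim_row D' = dim_row A'"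
  shows "(A @\<^sub>r A') *\<^sub>v x2 + (B @\<^sub>r B') *\<^sub>v x1 + (C @\<^sub>r C') *\<^sub>v x0 + (D @\<^sub>r D') *\<^sub>v u = f @\<^sub>v f' \<longleftrightarrow>
    A *\<^sub>v x2 + B *\<^sub>v x1 + C *\<^sub>v x0 + D *\<^sub>v u = f \<and>
    A' *\<^sub>v x2 + B' *\<^sub>v x1 + C' *\<^sub>v x0 + D' *\<^sub>v u = f'"
  using assms by (simp add: append_rows_mult_vec append_vec_plus append_vec_inject)

lemma scaled_eq_holds_iff:
  assumes e: "sized_eq m d p e" and U: "dim_row U = m" "dim_col U = m" "injective_mat U"
    and V: "dim_row V = p" "dim_col V = p"
    and e': "cA e' = U * cA e" "cB e' = U * cB e" "cC e' = U * cC e" "cD e' = U * cD e * V"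
      "rhs e' = U *\<^sub>v rhs e"
    and x: "dim_vec x2 = d" "dim_vec x1 = d" "dim_vec x0 = d" "dim_vec v = p"
  shows "eq_holds e' x2 x1 x0 v \<longleftrightarrow> eq_holds e x2 x1 x0 (V *\<^sub>v v)"
proof -
  have "eq_holds e' x2 x1 x0 v \<longleftrightarrow>
    U *\<^sub>v (cA e *\<^sub>v x2 + cB e *\<^sub>v x1 + cC e *\<^sub>v x0 + cD e *\<^sub>v (V *\<^sub>v v)) = U *\<^sub>v rhs e"
    using assms
    by (simp add: eq_holds_def sized_eq_def mult_mat_vec_assoc mult_mat_vec_add mult_mat_assoc)
  also have "\<dots> \<longleftrightarrow> eq_holds e x2 x1 x0 (V *\<^sub>v v)"
    using injective_mat_cancel[OF U(3)] e U by (auto simp: eq_holds_def sized_eq_def)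
  finally show ?thesis .
qed

section \<open>The condensed form as a system\<close>

text \<open>The nonzero input block rows are kept as matrices acting on the whole transformed input,
  so that solution sets can be compared without splitting that input.\<close>

definition input1 :: "condensed_eq \<Rightarrow> real mat" where
  "input1 c = hstack (r2 c) [cfD1 c, 0\<^sub>m (r2 c) (phi1 c), 0\<^sub>m (r2 c) (phi0 c)]"

definition input4 :: "nat \<Rightarrow> condensed_eq \<Rightarrow> real mat" where
  "input4 p c = hstack (phi1 c) [0\<^sub>m (phi1 c) (p - phi1 c - phi0 c), cfS1 c, 0\<^sub>m (phi1 c) (phi0 c)]"

definition input5 :: "nat \<Rightarrow> condensed_eq \<Rightarrow> real mat" where
  "input5 p c = hstack (phi0 c) [0\<^sub>m (phi0 c) (p - phi1 c - phi0 c), 0\<^sub>m (phi0 c) (phi1 c), cfS0 c]"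

text \<open>Reading the blocks as an equation of the original kind, with the transformed input,
  places condensed forms in one chain with the systems of the run.\<close>

definition condensed_descr :: "nat \<Rightarrow> nat \<Rightarrow> condensed_eq \<Rightarrow> descr_eq" where
  "condensed_descr d p c = \<lparr>
     cA = vstack d
       [cfA1 c, 0\<^sub>m (r1 c) d, 0\<^sub>m (r0 c) d, 0\<^sub>m (phi1 c) d, 0\<^sub>m (phi0 c) d, 0\<^sub>m (vnum c) d],
     cB = vstack d
       [cfB1 c, cfB2 c, 0\<^sub>m (r0 c) d, cfB4 c, 0\<^sub>m (phi0 c) d, 0\<^sub>m (vnum c) d],
     cC = vstack d
       [cfC1 c, cfC2 c, cfC3 c, cfC4 c, cfC5 c, 0\<^sub>m (vnum c) d],
     cD = vstack p
       [input1 c, 0\<^sub>m (r1 c) p, 0\<^sub>m (r0 c) p, input4 p c, input5 p c, 0\<^sub>m (vnum c) p],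
     rhs = cff1 c @\<^sub>v cff2 c @\<^sub>v cff3 c @\<^sub>v cff4 c @\<^sub>v cff5 c @\<^sub>v cff6 c \<rparr>"

lemma condensed_at_iff:
  "condensed_at m d p e c \<longleftrightarrow> condensed_blocks d p c \<and>
     r2 c + r1 c + r0 c + phi1 c + phi0 c + vnum c = m \<and>
     (\<exists>U V. U \<in> carrier_mat m m \<and> invertible_mat U \<and> V \<in> carrier_mat p p \<and> invertible_mat V \<and>
        U * cA e = cA (condensed_descr d p c) \<and> U * cB e = cB (condensed_descr d p c) \<and>
        U * cC e = cC (condensed_descr d p c) \<and> U * cD e * V = cD (condensed_descr d p c) \<and>
        U *\<^sub>v rhs e = rhs (condensed_descr d p c))"
  by (simp only: condensed_at_def condensed_descr_def input1_def input4_def input5_def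
      descr_eq.select_convs)

lemma condensed_blocks_dims:
  assumes "condensed_blocks d p c"
  shows "phi1 c + (phi0 c + (p - (phi1 c + phi0 c))) = p"
    "dim_row (cfA1 c) = r2 c" "dim_col (cfA1 c) = d"
    "dim_row (cfB1 c) = r2 c" "dim_col (cfB1 c) = d"
    "dim_row (cfC1 c) = r2 c" "dim_col (cfC1 c) = d"
    "dim_row (cfD1 c) = r2 c" "dim_col (cfD1 c) = p - (phi1 c + phi0 c)"
    "dim_row (cfB2 c) = r1 c" "dim_col (cfB2 c) = d"
    "dim_row (cfC2 c) = r1 c" "dim_col (cfC2 c) = d"
    "dim_row (cfC3 c) = r0 c" "dim_col (cfC3 c) = d"
    "dim_row (cfB4 c) = phi1 c" "dim_col (cfB4 c) = d"
    "dim_row (cfC4 c) = phi1 c" "dim_col (cfC4 c) = d"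
    "dim_row (cfC5 c) = phi0 c" "dim_col (cfC5 c) = d"
    "dim_row (cfS1 c) = phi1 c" "dim_col (cfS1 c) = phi1 c"
    "dim_row (cfS0 c) = phi0 c" "dim_col (cfS0 c) = phi0 c"
    "dim_vec (cff1 c) = r2 c" "dim_vec (cff2 c) = r1 c" "dim_vec (cff3 c) = r0 c"
    "dim_vec (cff4 c) = phi1 c" "dim_vec (cff5 c) = phi0 c" "dim_vec (cff6 c) = vnum c"
  using assms by (simp_all add: condensed_blocks_def)

lemma reduction_matrices_dims:
  assumes "reduction_matrices d c c' c'' S1 S2 Z1 Z2 Z3 Z4 Z5"
  shows "dim_col S1 = r1 c" "dim_col Z1 = r1 c" "dim_col S2 = r2 c" "dim_col Z2 = r2 c"
    "dim_row Z3 = dim_row Z1" "dim_col Z3 = r0 c'" "dim_row Z4 = dim_row Z2" "dim_col Z4 = r1 c'"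
    "dim_row Z5 = dim_row Z2" "dim_col Z5 = r0 c''"
  using assms by (simp_all add: reduction_matrices_def)

lemma reduction_matrices_rels:
  assumes "reduction_matrices d c c' c'' S1 S2 Z1 Z2 Z3 Z4 Z5"
  shows "orthogonal_square (r1 c) (S1 @\<^sub>r Z1)" "orthogonal_square (r2 c) (S2 @\<^sub>r Z2)"
    "Z1 * cfB2 c + Z3 * cfC3 c' = 0\<^sub>m (dim_row Z1) d"
    "Z2 * cfA1 c + Z4 * cfB2 c' + Z5 * cfC3 c'' = 0\<^sub>m (dim_row Z2) d"
  using assms by (simp_all add: reduction_matrices_def)

lemma dim_inputs:
  assumes "condensed_blocks d p c"
  shows "dim_row (input1 c) = r2 c" "dim_col (input1 c) = p"
    "dim_row (input4 p c) = phi1 c" "dim_col (input4 p c) = p"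
    "dim_row (input5 p c) = phi0 c" "dim_col (input5 p c) = p"
  using condensed_blocks_dims[OF assms] by (simp_all add: input1_def input4_def input5_def dim_hstack)

lemma condensed_eq_holds_iff:
  assumes c: "condensed_blocks d p c"
    and x: "dim_vec x2 = d" "dim_vec x1 = d" "dim_vec x0 = d" "dim_vec v = p"
  shows "eq_holds (condensed_descr d p c) x2 x1 x0 v \<longleftrightarrow>
    cfA1 c *\<^sub>v x2 + cfB1 c *\<^sub>v x1 + cfC1 c *\<^sub>v x0 + input1 c *\<^sub>v v = cff1 c \<and>
    cfB2 c *\<^sub>v x1 + cfC2 c *\<^sub>v x0 = cff2 c \<and>
    cfC3 c *\<^sub>v x0 = cff3 c \<and>
    cfB4 c *\<^sub>v x1 + cfC4 c *\<^sub>v x0 + input4 p c *\<^sub>v v = cff4 c \<and>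
    cfC5 c *\<^sub>v x0 + input5 p c *\<^sub>v v = cff5 c \<and>
    0\<^sub>v (vnum c) = cff6 c"
proof -
  note dims = condensed_blocks_dims[OF c] dim_inputs[OF c]
  show ?thesis
    unfolding eq_holds_def condensed_descr_def descr_eq.select_convs
    by (simp add: dims x block_sum_append_iff del: assoc_add_vec)
qed

section \<open>Equivalence of the reduced and the condensed equations\<close>

lemma mult_input1:
  assumes "condensed_blocks d p c" "dim_col S = r2 c"
  shows "hstack (dim_row S) [S * cfD1 c, 0\<^sub>m (dim_row S) (phi1 c), 0\<^sub>m (dim_row S) (phi0 c)] = S * input1 c"
  using assms(2) by (simp add: input1_def condensed_blocks_dims[OF assms(1)] mult_hstack)

lemma reduced_eq_unfold:
  assumes "condensed_blocks d p c" "reduction_matrices d c c' c'' S1 S2 Z1 Z2 Z3 Z4 Z5"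
  shows "reduced_eq d p c c' c'' S1 S2 Z1 Z2 Z3 Z4 Z5 = \<lparr>
     cA = vstack d [S2 * cfA1 c, 0\<^sub>m (dim_row Z2) d, 0\<^sub>m (dim_row S1) d, 0\<^sub>m (dim_row Z1) d,
       0\<^sub>m (r0 c) d, 0\<^sub>m (phi1 c) d, 0\<^sub>m (phi0 c) d, 0\<^sub>m (vnum c) d],
     cB = vstack d [S2 * cfB1 c, Z2 * cfB1 c + Z4 * cfC2 c', S1 * cfB2 c, 0\<^sub>m (dim_row Z1) d,
       0\<^sub>m (r0 c) d, cfB4 c, 0\<^sub>m (phi0 c) d, 0\<^sub>m (vnum c) d],
     cC = vstack d [S2 * cfC1 c, Z2 * cfC1 c, S1 * cfC2 c, Z1 * cfC2 c, cfC3 c, cfC4 c, cfC5 c,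
       0\<^sub>m (vnum c) d],
     cD = vstack p [S2 * input1 c, Z2 * input1 c, 0\<^sub>m (dim_row S1) p, 0\<^sub>m (dim_row Z1) p,
       0\<^sub>m (r0 c) p, input4 p c, input5 p c, 0\<^sub>m (vnum c) p],
     rhs = (S2 *\<^sub>v cff1 c) @\<^sub>v (Z2 *\<^sub>v cff1 c + Z4 *\<^sub>v cff2 c' + Z5 *\<^sub>v cff3 c'') @\<^sub>v
       (S1 *\<^sub>v cff2 c) @\<^sub>v (Z1 *\<^sub>v cff2 c + Z3 *\<^sub>v cff3 c') @\<^sub>v
       cff3 c @\<^sub>v cff4 c @\<^sub>v cff5 c @\<^sub>v cff6 c \<rparr>"
  by (simp add: reduced_eq_def Let_def input4_def input5_def mult_input1[OF assms(1)]
      reduction_matrices_dims[OF assms(2)] del: vstack_Cons)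

lemma reduced_eq_blocks:
  assumes c: "condensed_blocks d p c" and c': "condensed_blocks d p c'" and c'': "condensed_blocks d p c''"
    and R: "reduction_matrices d c c' c'' S1 S2 Z1 Z2 Z3 Z4 Z5"
    and x: "dim_vec x2 = d" "dim_vec x1 = d" "dim_vec x0 = d" "dim_vec v = p"
  shows "eq_holds (reduced_eq d p c c' c'' S1 S2 Z1 Z2 Z3 Z4 Z5) x2 x1 x0 v \<longleftrightarrow>
    S2 * cfA1 c *\<^sub>v x2 + S2 * cfB1 c *\<^sub>v x1 + S2 * cfC1 c *\<^sub>v x0 + S2 * input1 c *\<^sub>v v = S2 *\<^sub>v cff1 c \<and>
    (Z2 * cfB1 c + Z4 * cfC2 c') *\<^sub>v x1 + Z2 * cfC1 c *\<^sub>v x0 + Z2 * input1 c *\<^sub>v v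
      = Z2 *\<^sub>v cff1 c + Z4 *\<^sub>v cff2 c' + Z5 *\<^sub>v cff3 c'' \<and>
    S1 * cfB2 c *\<^sub>v x1 + S1 * cfC2 c *\<^sub>v x0 = S1 *\<^sub>v cff2 c \<and>
    Z1 * cfC2 c *\<^sub>v x0 = Z1 *\<^sub>v cff2 c + Z3 *\<^sub>v cff3 c' \<and>
    cfC3 c *\<^sub>v x0 = cff3 c \<and>
    cfB4 c *\<^sub>v x1 + cfC4 c *\<^sub>v x0 + input4 p c *\<^sub>v v = cff4 c \<and>
    cfC5 c *\<^sub>v x0 + input5 p c *\<^sub>v v = cff5 c \<and>
    0\<^sub>v (vnum c) = cff6 c"
proof -
  note dims = condensed_blocks_dims[OF c] condensed_blocks_dims[OF c'] condensed_blocks_dims[OF c'']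
    dim_inputs[OF c] reduction_matrices_dims[OF R]
  show ?thesis
    unfolding eq_holds_def reduced_eq_unfold[OF c R] descr_eq.select_convs
    by (simp add: dims x block_sum_append_iff del: assoc_add_vec)
qed

text \<open>The identity for \<open>Z1\<close> and \<open>Z3\<close>, applied to \<open>x1\<close>,
  eliminates \<open>x1\<close>: given the third block row at the next time, the \<open>Z1\<close>
  part of the second block row becomes the new equation for \<open>x0\<close> when
  \<open>Z3 *\<^sub>v cff3 c'\<close> is added on both sides.\<close>

lemma level1_reduction_iff:
  assumes c: "condensed_blocks d p c" and c': "condensed_blocks d p c'"
    and R: "reduction_matrices d c c' c'' S1 S2 Z1 Z2 Z3 Z4 Z5"
    and x: "dim_vec x1 = d" "dim_vec x0 = d"
    and next_eq: "cfC3 c' *\<^sub>v x1 = cff3 c'"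
  shows "S1 * cfB2 c *\<^sub>v x1 + S1 * cfC2 c *\<^sub>v x0 = S1 *\<^sub>v cff2 c \<and>
      Z1 * cfC2 c *\<^sub>v x0 = Z1 *\<^sub>v cff2 c + Z3 *\<^sub>v cff3 c'
    \<longleftrightarrow> cfB2 c *\<^sub>v x1 + cfC2 c *\<^sub>v x0 = cff2 c"
proof -
  note d = condensed_blocks_dims[OF c] condensed_blocks_dims[OF c'] reduction_matrices_dims[OF R]
  define e where "e = cfB2 c *\<^sub>v x1 + cfC2 c *\<^sub>v x0"
  have "Z1 *\<^sub>v (cfB2 c *\<^sub>v x1) + Z3 *\<^sub>v (cfC3 c' *\<^sub>v x1) = (Z1 * cfB2 c + Z3 * cfC3 c') *\<^sub>v x1"
    by (simp add: d x add_mat_mult_vec mult_mat_vec_assoc)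
  also have "\<dots> = 0\<^sub>v (dim_row Z1)" by (simp add: reduction_matrices_rels(3)[OF R] d x)
  finally have 0: "Z1 *\<^sub>v (cfB2 c *\<^sub>v x1) + Z3 *\<^sub>v cff3 c' = 0\<^sub>v (dim_row Z1)" by (simp add: next_eq)
  have "Z1 *\<^sub>v e + Z3 *\<^sub>v cff3 c'
      = (Z1 *\<^sub>v (cfB2 c *\<^sub>v x1) + Z3 *\<^sub>v cff3 c') + Z1 *\<^sub>v (cfC2 c *\<^sub>v x0)"
    unfolding e_def 
    by (simp add: d x mult_mat_vec_add) (intro eq_vecI; simp add: d x del: index_mult_mat_vec)
  also have "\<dots> = Z1 * cfC2 c *\<^sub>v x0" by (simp add: d x 0 mult_mat_vec_assoc)
  finally have Z: "Z1 * cfC2 c *\<^sub>v x0 = Z1 *\<^sub>v e + Z3 *\<^sub>v cff3 c'" by simp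
  have "Z1 * cfC2 c *\<^sub>v x0 = Z1 *\<^sub>v cff2 c + Z3 *\<^sub>v cff3 c' \<longleftrightarrow> Z1 *\<^sub>v e = Z1 *\<^sub>v cff2 c"
    unfolding Z by (intro vec_add_right_cancel) (simp_all add: d)
  moreover have "S1 * cfB2 c *\<^sub>v x1 + S1 * cfC2 c *\<^sub>v x0 = S1 *\<^sub>v e"
    unfolding e_def by (simp add: d x mult_mat_vec_add mult_mat_vec_assoc)
  moreover have "S1 *\<^sub>v e = S1 *\<^sub>v cff2 c \<and> Z1 *\<^sub>v e = Z1 *\<^sub>v cff2 c \<longleftrightarrow> e = cff2 c"
    by (intro orthogonal_square_cancel[OF reduction_matrices_rels(1)[OF R]]) (simp_all add: e_def d x)
  ultimately show ?thesis by (simp add: e_def)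
qed

text \<open>The same mechanism one level higher: \<open>x2\<close> is eliminated by the second block
  row at the next time and the third one two times ahead. The former contains
  \<open>cfC2 c' *\<^sub>v x1\<close>, which is the origin of the term \<open>Z4 * cfC2 c'\<close>
  in the coefficient of \<open>x1\<close>.\<close>

lemma level2_reduction_iff:
  assumes c: "condensed_blocks d p c" and c': "condensed_blocks d p c'" and c'': "condensed_blocks d p c''"
    and R: "reduction_matrices d c c' c'' S1 S2 Z1 Z2 Z3 Z4 Z5"
    and x: "dim_vec x2 = d" "dim_vec x1 = d" "dim_vec x0 = d" "dim_vec v = p"
    and next_eqs: "cfB2 c' *\<^sub>v x2 + cfC2 c' *\<^sub>v x1 = cff2 c'" "cfC3 c'' *\<^sub>v x2 = cff3 c''"
  shows "S2 * cfA1 c *\<^sub>v x2 + S2 * cfB1 c *\<^sub>v x1 + S2 * cfC1 c *\<^sub>v x0 + S2 * input1 c *\<^sub>v v = S2 *\<^sub>v cff1 c \<and>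
    (Z2 * cfB1 c + Z4 * cfC2 c') *\<^sub>v x1 + Z2 * cfC1 c *\<^sub>v x0 + Z2 * input1 c *\<^sub>v v
      = Z2 *\<^sub>v cff1 c + Z4 *\<^sub>v cff2 c' + Z5 *\<^sub>v cff3 c'' \<longleftrightarrow>
    cfA1 c *\<^sub>v x2 + cfB1 c *\<^sub>v x1 + cfC1 c *\<^sub>v x0 + input1 c *\<^sub>v v = cff1 c"
proof -
  note d = condensed_blocks_dims[OF c] condensed_blocks_dims[OF c'] condensed_blocks_dims[OF c'']
    reduction_matrices_dims[OF R] dim_inputs[OF c]
  define e where "e = cfA1 c *\<^sub>v x2 + cfB1 c *\<^sub>v x1 + cfC1 c *\<^sub>v x0 + input1 c *\<^sub>v v"
  \<comment> \<open>The correction that is added on both sides of the \<open>Z2\<close>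
    part.\<close>
  define g where "g = Z4 *\<^sub>v cff2 c' + Z5 *\<^sub>v cff3 c''"
  have dg: "dim_vec g = dim_row Z2" by (simp add: g_def d)
  have "Z2 *\<^sub>v (cfA1 c *\<^sub>v x2) + Z4 *\<^sub>v (cfB2 c' *\<^sub>v x2) + Z5 *\<^sub>v (cfC3 c'' *\<^sub>v x2)
      = (Z2 * cfA1 c + Z4 * cfB2 c' + Z5 * cfC3 c'') *\<^sub>v x2"
    by (simp add: d x add_mat_mult_vec mult_mat_vec_assoc)
  also have "\<dots> = 0\<^sub>v (dim_row Z2)" by (simp add: reduction_matrices_rels(4)[OF R] d x)
  finally have 0: "Z2 *\<^sub>v (cfA1 c *\<^sub>v x2) + Z4 *\<^sub>v (cfB2 c' *\<^sub>v x2) + Z5 *\<^sub>v cff3 c'' = 0\<^sub>v (dim_row Z2)"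
    by (simp add: next_eqs)
  have "Z4 *\<^sub>v cff2 c' = Z4 *\<^sub>v (cfB2 c' *\<^sub>v x2) + Z4 *\<^sub>v (cfC2 c' *\<^sub>v x1)"
    unfolding next_eqs(1)[symmetric] by (simp add: d x mult_mat_vec_add)
  hence "Z2 *\<^sub>v e + g = (Z2 *\<^sub>v (cfA1 c *\<^sub>v x2) + Z4 *\<^sub>v (cfB2 c' *\<^sub>v x2) + Z5 *\<^sub>v cff3 c'')
      + (Z2 *\<^sub>v (cfB1 c *\<^sub>v x1) + Z4 *\<^sub>v (cfC2 c' *\<^sub>v x1) + Z2 *\<^sub>v (cfC1 c *\<^sub>v x0)
      + Z2 *\<^sub>v (input1 c *\<^sub>v v))"
    unfolding e_def g_def 
    by (simp add: d x mult_mat_vec_add del: assoc_add_vec) (intro eq_vecI; simp add: d x del: index_mult_mat_vec)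
  also have "\<dots> = (Z2 * cfB1 c + Z4 * cfC2 c') *\<^sub>v x1 + Z2 * cfC1 c *\<^sub>v x0 + Z2 * input1 c *\<^sub>v v"
    unfolding 0 by (simp add: d x add_mat_mult_vec mult_mat_vec_assoc del: assoc_add_vec)
  finally have Z: "(Z2 * cfB1 c + Z4 * cfC2 c') *\<^sub>v x1 + Z2 * cfC1 c *\<^sub>v x0 + Z2 * input1 c *\<^sub>v v
      = Z2 *\<^sub>v e + g" by simp
  have g: "Z2 *\<^sub>v cff1 c + Z4 *\<^sub>v cff2 c' + Z5 *\<^sub>v cff3 c'' = Z2 *\<^sub>v cff1 c + g"
    unfolding g_def by (intro eq_vecI; simp add: d x del: index_mult_mat_vec)
  have "Z2 *\<^sub>v e + g = Z2 *\<^sub>v cff1 c + g \<longleftrightarrow> Z2 *\<^sub>v e = Z2 *\<^sub>v cff1 c"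
    using dg by (intro vec_add_right_cancel) simp_all
  moreover have "S2 * cfA1 c *\<^sub>v x2 + S2 * cfB1 c *\<^sub>v x1 + S2 * cfC1 c *\<^sub>v x0 + S2 * input1 c *\<^sub>v v = S2 *\<^sub>v e"
    unfolding e_def by (simp add: d x mult_mat_vec_add mult_mat_vec_assoc)
  moreover have "S2 *\<^sub>v e = S2 *\<^sub>v cff1 c \<and> Z2 *\<^sub>v e = Z2 *\<^sub>v cff1 c \<longleftrightarrow> e = cff1 c"
    by (intro orthogonal_square_cancel[OF reduction_matrices_rels(2)[OF R]]) (simp_all add: e_def d x)
  ultimately show ?thesis unfolding Z g by (simp add: e_def)
qed

text \<open>Both systems contain the third block row at all times; it yields the second block row at all
  times, which in turn yields the first.\<close>

lemma solutions_index_reduction: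
  assumes c: "\<And>n. n \<ge> n0 \<Longrightarrow> condensed_blocks d p (c n)"
    and F: "index_reduction n0 d p c F" and u: "\<And>n. n \<ge> n0 \<Longrightarrow> dim_vec (u n) = p"
  shows "solutions n0 d F u = solutions n0 d (\<lambda>n. condensed_descr d p (c n)) u"
proof -
  have "x \<in> solutions n0 d F u \<longleftrightarrow> x \<in> solutions n0 d (\<lambda>n. condensed_descr d p (c n)) u" for x
  proof (cases "\<forall>n\<ge>n0. dim_vec (x n) = d")
    case False
    thus ?thesis by (auto simp: solutions_iff)
  next
    case True
    hence x: "dim_vec (x n) = d" "dim_vec (x (n + 1)) = d" "dim_vec (x (n + 2)) = d" if "n \<ge> n0" for n
      using that by simp_all
    define L3 where "L3 n \<longleftrightarrow> cfC3 (c n) *\<^sub>v x n = cff3 (c n)" for n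
    define L2 where "L2 n \<longleftrightarrow> cfB2 (c n) *\<^sub>v x (n + 1) + cfC2 (c n) *\<^sub>v x n = cff2 (c n)" for n
    define HF where "HF n \<longleftrightarrow> eq_holds (F n) (x (n + 2)) (x (n + 1)) (x n) (u n)" for n
    define HC where "HC n \<longleftrightarrow> eq_holds (condensed_descr d p (c n)) (x (n + 2)) (x (n + 1)) (x n) (u n)" for n
    have HC: "HC n \<Longrightarrow> L3 n \<and> L2 n" if "n \<ge> n0" for n
      using condensed_eq_holds_iff[OF c[OF that] x(3,2,1)[OF that] u[OF that]]
      by (simp add: HC_def L2_def L3_def)
    have red: "(HF n \<longrightarrow> L3 n) \<and> (L3 (n + 1) \<longrightarrow> HF n \<longrightarrow> L2 n) \<and>
        (L3 (n + 1) \<longrightarrow> L3 (n + 2) \<longrightarrow> L2 (n + 1) \<longrightarrow> (HF n \<longleftrightarrow> HC n))" if n: "n \<ge> n0" for n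
    proof -
      obtain S1 S2 Z1 Z2 Z3 Z4 Z5 where
        R: "reduction_matrices d (c n) (c (n + 1)) (c (n + 2)) S1 S2 Z1 Z2 Z3 Z4 Z5"
        and Fn: "F n = reduced_eq d p (c n) (c (n + 1)) (c (n + 2)) S1 S2 Z1 Z2 Z3 Z4 Z5"
        using F n unfolding index_reduction_def by blast
      have cn: "condensed_blocks d p (c (n + 1))" "condensed_blocks d p (c (n + 2))"
        using c n by simp_all
      note blocks = reduced_eq_blocks[OF c[OF n] cn R x(3,2,1)[OF n] u[OF n], folded Fn]
      note l1 = level1_reduction_iff[OF c[OF n] cn(1) R x(2,1)[OF n]]
      note l2 = level2_reduction_iff[OF c[OF n] cn R x(3,2,1)[OF n] u[OF n]]
      have n2: "n + 1 + 1 = n + 2" by simp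
      note cond = condensed_eq_holds_iff[OF c[OF n] x(3,2,1)[OF n] u[OF n]]
      show ?thesis unfolding HF_def HC_def L3_def L2_def n2 blocks cond using l1 l2 by blast
    qed
    \<comment> \<open>The times \<open>n + 1\<close> and \<open>n + 2\<close> are again at least
      \<open>n0\<close>, so the lower block rows are available there for whichever system is assumed
      to hold.\<close>
    have "(\<forall>n\<ge>n0. HF n) \<longleftrightarrow> (\<forall>n\<ge>n0. HC n)"
      using red HC by (meson le_add1 le_trans)
    thus ?thesis using True by (simp add: solutions_iff HF_def HC_def)
  qed
  thus ?thesis by blast
qed

section \<open>Existence of the reduction matrices\<close>

lemma mat_eq_via_unit_vec:
  fixes A B :: "real mat"
  assumes dims: "dim_row A = m" "dim_row B = m" "dim_col A = n" "dim_col B = n"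
    and eq: "\<And>j. j < n \<Longrightarrow> A *\<^sub>v unit_vec n j = B *\<^sub>v unit_vec n j"
  shows "A = B"
proof (rule mat_col_eqI)
  fix j assume j: "j < dim_col B"
  have "M *\<^sub>v unit_vec n j = col M j" if "dim_col M = n" for M :: "real mat"
    using that j dims by (intro eq_vecI) simp_all
  thus "col A j = col B j" using eq[of j] j dims by simp
qed (simp_all add: dims)

text \<open>\<open>W\<close> collects the coefficients of those combinations of rows of
  \<open>P\<close> that lie in the row space of \<open>Q\<close>, the hidden redundancies.
  \<open>Z\<close> is an orthonormal basis of it, \<open>X\<close> expresses the corresponding rows
  through \<open>Q\<close> up to sign, and \<open>S\<close> spans the complement, where no
  redundancy is left.\<close>

lemma orthogonal_reduction:
  fixes P Q :: "real mat"
  assumes P: "injective_mat P\<^sup>T" and dims: "dim_col Q = dim_col P"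
  obtains S Z X where "dim_col S = dim_row P" "dim_col Z = dim_row P"
    "orthogonal_square (dim_row P) (S @\<^sub>r Z)" "dim_row X = dim_row Z" "dim_col X = dim_row Q"
    "Z * P + X * Q = 0\<^sub>m (dim_row Z) (dim_col P)" "full_row_rank (S * P)"
    "no_hidden_redundancy (S * P) Q"
proof -
  define W where "W = {z. dim_vec z = dim_row P \<and>
    (\<exists>w. dim_vec w = dim_row Q \<and> P\<^sup>T *\<^sub>v z + Q\<^sup>T *\<^sub>v w = 0\<^sub>v (dim_col P))}"
  have WI: "z \<in> W" if "dim_vec z = dim_row P" "dim_vec w = dim_row Q"
    "P\<^sup>T *\<^sub>v z + Q\<^sup>T *\<^sub>v w = 0\<^sub>v (dim_col P)" for z w
    using that by (auto simp: W_def)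
  have W: "W \<subseteq> carrier_vec (dim_row P)" "0\<^sub>v (dim_row P) \<in> W"
    "\<And>v w. v \<in> W \<Longrightarrow> w \<in> W \<Longrightarrow> v + w \<in> W" "\<And>c v. v \<in> W \<Longrightarrow> c \<cdot>\<^sub>v v \<in> W"
  proof -
    show "W \<subseteq> carrier_vec (dim_row P)" by (auto simp: W_def)
    show "0\<^sub>v (dim_row P) \<in> W" by (rule WI[of _ "0\<^sub>v (dim_row Q)"]) (simp_all add: dims)
  next
    fix v v' assume "v \<in> W" "v' \<in> W"
    then obtain w w' where v: "dim_vec v = dim_row P" "dim_vec v' = dim_row P"
      and w: "dim_vec w = dim_row Q" "dim_vec w' = dim_row Q"
      and eq: "P\<^sup>T *\<^sub>v v + Q\<^sup>T *\<^sub>v w = 0\<^sub>v (dim_col P)" "P\<^sup>T *\<^sub>v v' + Q\<^sup>T *\<^sub>v w' = 0\<^sub>v (dim_col P)"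
      by (auto simp: W_def)
    have "P\<^sup>T *\<^sub>v (v + v') + Q\<^sup>T *\<^sub>v (w + w')
        = (P\<^sup>T *\<^sub>v v + Q\<^sup>T *\<^sub>v w) + (P\<^sup>T *\<^sub>v v' + Q\<^sup>T *\<^sub>v w')"
      by (simp add: v w mult_mat_vec_add) (intro eq_vecI; simp add: dims del: index_mult_mat_vec)
    also have "\<dots> = 0\<^sub>v (dim_col P)" by (simp add: eq)
    finally show "v + v' \<in> W" by (intro WI[of _ "w + w'"]) (simp_all add: v w)
  next
    fix k v assume "v \<in> W"
    then obtain w where v: "dim_vec v = dim_row P" and w: "dim_vec w = dim_row Q"
      and eq: "P\<^sup>T *\<^sub>v v + Q\<^sup>T *\<^sub>v w = 0\<^sub>v (dim_col P)"
      by (auto simp: W_def)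
    have "P\<^sup>T *\<^sub>v (k \<cdot>\<^sub>v v) + Q\<^sup>T *\<^sub>v (k \<cdot>\<^sub>v w) = k \<cdot>\<^sub>v (P\<^sup>T *\<^sub>v v + Q\<^sup>T *\<^sub>v w)"
      by (simp add: v w mult_mat_vec_smult)
        (intro eq_vecI; simp add: dims distrib_left del: index_mult_mat_vec)
    also have "\<dots> = 0\<^sub>v (dim_col P)" unfolding eq by (intro eq_vecI) simp_all
    finally show "k \<cdot>\<^sub>v v \<in> W" by (intro WI[of _ "k \<cdot>\<^sub>v w"]) (simp_all add: v w)
  qed
  obtain S Z where SZ: "dim_col S = dim_row P" "dim_col Z = dim_row P"
    "orthogonal_square (dim_row P) (S @\<^sub>r Z)"
    and ZW: "\<And>y. dim_vec y = dim_row Z \<Longrightarrow> Z\<^sup>T *\<^sub>v y \<in> W"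
    and SW: "\<And>v. v \<in> W \<Longrightarrow> S *\<^sub>v v = 0\<^sub>v (dim_row S)"
    using orthogonal_split[OF W] by blast
  note orth = orthogonal_square_append[OF SZ(3,1,2)]
  have SPT: "(S * P)\<^sup>T *\<^sub>v a = P\<^sup>T *\<^sub>v (S\<^sup>T *\<^sub>v a)" if "dim_vec a = dim_row S" for a
    using that SZ(1) by (simp add: transpose_mult_dim mult_mat_vec_assoc)
  have indep: "a = 0\<^sub>v (dim_row S)" if "dim_vec a = dim_row S" "dim_vec b = dim_row Q"
    "(S * P)\<^sup>T *\<^sub>v a + Q\<^sup>T *\<^sub>v b = 0\<^sub>v (dim_col P)" for a b
  proof -
    \<comment> \<open>A combination of the rows of \<open>S * P\<close> is one of the rows of
      \<open>P\<close> with coefficients \<open>S\<^sup>T *\<^sub>v a\<close>. If it is redundant,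
      these lie in \<open>W\<close>, on which \<open>S\<close> vanishes.\<close>
    have "S\<^sup>T *\<^sub>v a \<in> W" using that SZ(1) by (intro WI[of _ b]) (simp_all add: SPT)
    from SW[OF this] show ?thesis using orth(2)[OF that(1)] by simp
  qed
  have inj: "injective_mat (S * P)\<^sup>T" unfolding injective_mat_def
  proof (intro ballI impI)
    fix y assume y: "y \<in> carrier_vec (dim_col (S * P)\<^sup>T)" "(S * P)\<^sup>T *\<^sub>v y = 0\<^sub>v (dim_row (S * P)\<^sup>T)"
    have "(S * P)\<^sup>T *\<^sub>v y + Q\<^sup>T *\<^sub>v 0\<^sub>v (dim_row Q) = 0\<^sub>v (dim_col P)"
      using y dims by simp
    thus "y = 0\<^sub>v (dim_col (S * P)\<^sup>T)" using indep[of y "0\<^sub>v (dim_row Q)"] y(1) by simp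
  qed
  have "\<exists>w. dim_vec w = dim_row Q \<and> P\<^sup>T *\<^sub>v (Z\<^sup>T *\<^sub>v unit_vec (dim_row Z) i) + Q\<^sup>T *\<^sub>v w = 0\<^sub>v (dim_col P)" for i
    using ZW[of "unit_vec (dim_row Z) i"] by (simp add: W_def)
  then obtain w where w: "\<And>i. dim_vec (w i) = dim_row Q"
    "\<And>i. P\<^sup>T *\<^sub>v (Z\<^sup>T *\<^sub>v unit_vec (dim_row Z) i) + Q\<^sup>T *\<^sub>v w i = 0\<^sub>v (dim_col P)"
    by metis
  \<comment> \<open>Row \<open>i\<close> of \<open>X\<close> is the witness that row
    \<open>i\<close> of \<open>Z\<close> belongs to \<open>W\<close>.\<close>
  define X where "X = mat (dim_row Z) (dim_row Q) (\<lambda>(i,j). w i $ j)"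
  have X: "dim_row X = dim_row Z" "dim_col X = dim_row Q" by (simp_all add: X_def)
  have XT: "X\<^sup>T *\<^sub>v unit_vec (dim_row Z) i = w i" if "i < dim_row Z" for i
    using that w(1) by (intro eq_vecI) (simp_all add: X_def)
  have "(Z * P + X * Q)\<^sup>T = 0\<^sub>m (dim_col P) (dim_row Z)"
  proof (rule mat_eq_via_unit_vec[of _ "dim_col P" _ "dim_row Z"])
    fix i assume i: "i < dim_row Z"
    have "(Z * P + X * Q)\<^sup>T = P\<^sup>T * Z\<^sup>T + Q\<^sup>T * X\<^sup>T"
      using transpose_add[of "Z * P" "dim_row Z" "dim_col P" "X * Q"] SZ X dims
      by (simp add: transpose_mult_dim)
    thus "(Z * P + X * Q)\<^sup>T *\<^sub>v unit_vec (dim_row Z) i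
        = 0\<^sub>m (dim_col P) (dim_row Z) *\<^sub>v unit_vec (dim_row Z) i"
      using SZ X dims i w(2)[of i] by (simp add: add_mat_mult_vec mult_mat_vec_assoc XT)
  qed (simp_all add: X dims)
  hence "Z * P + X * Q = 0\<^sub>m (dim_row Z) (dim_col P)"
    by (metis transpose_transpose zero_transpose_mat)
  moreover have "full_row_rank (S * P)" using inj by (simp add: full_row_rank_iff_injective_transpose)
  moreover have "no_hidden_redundancy (S * P) Q"
    using indep by (intro no_hidden_redundancyI[OF inj]) (simp_all add: dims)
  ultimately show thesis using that SZ X by blast
qed

lemma condensed_blocks_ranks:
  assumes "condensed_blocks d p c"
  shows "full_row_rank (cfA1 c)" "full_row_rank (cfB2 c)" "full_row_rank (cfC3 c)"
    "invertible_mat (cfS1 c)" "invertible_mat (cfS0 c)"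
  using assms by (simp_all add: condensed_blocks_def)

lemma reduction_matrices_exist:
  assumes c: "condensed_blocks d p c" and c': "condensed_blocks d p c'" and c'': "condensed_blocks d p c''"
  shows "\<exists>S1 S2 Z1 Z2 Z3 Z4 Z5. reduction_matrices d c c' c'' S1 S2 Z1 Z2 Z3 Z4 Z5"
proof -
  note d = condensed_blocks_dims[OF c] condensed_blocks_dims[OF c'] condensed_blocks_dims[OF c'']
  note ranks = condensed_blocks_ranks[OF c, unfolded full_row_rank_iff_injective_transpose]
  obtain S1 Z1 Z3 where 1: "dim_col S1 = r1 c" "dim_col Z1 = r1 c"
    "orthogonal_square (r1 c) (S1 @\<^sub>r Z1)" "dim_row Z3 = dim_row Z1" "dim_col Z3 = r0 c'"
    "Z1 * cfB2 c + Z3 * cfC3 c' = 0\<^sub>m (dim_row Z1) d" "full_row_rank (S1 * cfB2 c)"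
    "no_hidden_redundancy (S1 * cfB2 c) (cfC3 c')"
    using orthogonal_reduction[OF ranks(2), of "cfC3 c'"] unfolding d by blast
  obtain S2 Z2 X where 2: "dim_col S2 = r2 c" "dim_col Z2 = r2 c"
    "orthogonal_square (r2 c) (S2 @\<^sub>r Z2)" "dim_row X = dim_row Z2" "dim_col X = r1 c' + r0 c''"
    "Z2 * cfA1 c + X * (cfB2 c' @\<^sub>r cfC3 c'') = 0\<^sub>m (dim_row Z2) d" "full_row_rank (S2 * cfA1 c)"
    "no_hidden_redundancy (S2 * cfA1 c) (cfB2 c' @\<^sub>r cfC3 c'')"
    using orthogonal_reduction[OF ranks(1), of "cfB2 c' @\<^sub>r cfC3 c''"] unfolding d dim_append_rows by blast
  \<comment> \<open>The columns of \<open>X\<close> are divided along the stack of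
    \<open>cfB2 c'\<close> and \<open>cfC3 c''\<close>, which gives \<open>Z4\<close> and
    \<open>Z5\<close>; the transpose reduces this to a division of rows.\<close>
  obtain Y4 Y5 where Y: "dim_row Y4 = r1 c'" "dim_row Y5 = r0 c''" "dim_col Y4 = dim_row Z2"
    "dim_col Y5 = dim_row Z2" "X\<^sup>T = Y4 @\<^sub>r Y5"
    using row_split[of "X\<^sup>T" "r1 c'" "r0 c''"] 2(4,5) by (metis index_transpose_mat(2,3))
  have X: "X = (Y4 @\<^sub>r Y5)\<^sup>T" using Y(5) by (metis transpose_transpose)
  have "X * (cfB2 c' @\<^sub>r cfC3 c'') = Y4\<^sup>T * cfB2 c' + Y5\<^sup>T * cfC3 c''"
    by (rule mat_eq_via_vec[of _ "dim_row Z2" d])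
      (simp_all add: X d Y mult_mat_vec_assoc append_rows_mult_vec append_rows_transpose_mult_vec add_mat_mult_vec)
  hence "Z2 * cfA1 c + Y4\<^sup>T * cfB2 c' + Y5\<^sup>T * cfC3 c'' = 0\<^sub>m (dim_row Z2) d"
    using 2(6) assoc_add_mat[of "Z2 * cfA1 c" "dim_row Z2" d "Y4\<^sup>T * cfB2 c'" "Y5\<^sup>T * cfC3 c''"]
    by (simp add: d Y)
  hence "reduction_matrices d c c' c'' S1 S2 Z1 Z2 Z3 Y4\<^sup>T Y5\<^sup>T"
    unfolding reduction_matrices_def using 1 2 Y by simp
  thus ?thesis by blast
qed

lemma index_reduction_exists:
  assumes c: "\<And>n. n \<ge> n0 \<Longrightarrow> condensed_blocks d p (c n)"
  shows "\<exists>F. index_reduction n0 d p c F"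
proof -
  define Q where "Q n G \<longleftrightarrow> (\<exists>S1 S2 Z1 Z2 Z3 Z4 Z5.
     reduction_matrices d (c n) (c (n + 1)) (c (n + 2)) S1 S2 Z1 Z2 Z3 Z4 Z5 \<and>
     G = reduced_eq d p (c n) (c (n + 1)) (c (n + 2)) S1 S2 Z1 Z2 Z3 Z4 Z5)" for n G
  have "\<exists>G. Q n G" if "n \<ge> n0" for n
    unfolding Q_def using reduction_matrices_exist[OF c c c, of n "n + 1" "n + 2"] that by simp
  hence "\<exists>F. \<forall>n\<ge>n0. Q n (F n)" by metis
  thus ?thesis by (simp only: index_reduction_def Q_def)
qed

section \<open>Decrease of the block sizes\<close>

lemma zero_append_rows: "0\<^sub>m a d @\<^sub>r 0\<^sub>m b d = (0\<^sub>m (a + b) d :: real mat)"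
  by (intro eq_matI) (auto simp: append_rows_def)

lemma injective_transpose_of_invertible:
  fixes M :: "real mat"
  assumes "dim_row M = n" "dim_col M = n" "invertible_mat M"
  shows "injective_mat M\<^sup>T"
proof -
  obtain N where "N \<in> carrier_mat n n" "M * N = 1\<^sub>m n"
    using invertible_mat_inverse[of M n] assms by auto
  thus ?thesis using assms by (intro injective_transposeI_right_inverse[of M N]) auto
qed

lemma hstack3_transpose_mult_vec:
  assumes "dim_row A = r" "dim_row B = r" "dim_row C = r" "dim_vec a = r"
  shows "(hstack r [A, B, C])\<^sup>T *\<^sub>v a = A\<^sup>T *\<^sub>v a @\<^sub>v B\<^sup>T *\<^sub>v a @\<^sub>v C\<^sup>T *\<^sub>v a"
  using assms by (simp add: hstack_def append_rows_mult_vec)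

lemma hstack3_mult_vec:
  assumes "dim_row A = r" "dim_row B = r" "dim_row C = r"
    "dim_vec a = dim_col A" "dim_vec b = dim_col B" "dim_vec c = dim_col C"
  shows "hstack r [A, B, C] *\<^sub>v (a @\<^sub>v b @\<^sub>v c) = A *\<^sub>v a + (B *\<^sub>v b + C *\<^sub>v c)"
  using assms by (simp add: hstack_def append_rows_transpose_mult_vec)

text \<open>\<open>cfS1\<close> and \<open>cfS0\<close> are nonsingular and occupy disjoint groups
  of columns, so a vanishing combination can be tested in each group separately.\<close>

lemma inputs_injective_transpose:
  assumes c: "condensed_blocks d p c"
  shows "injective_mat (input4 p c @\<^sub>r input5 p c)\<^sup>T"
proof (rule injective_append_transposeI)
  note d = condensed_blocks_dims[OF c] dim_inputs[OF c]
  let ?q = "p - phi1 c - phi0 c"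
  fix a b assume "a \<in> carrier_vec (dim_row (input4 p c))" "b \<in> carrier_vec (dim_row (input5 p c))"
    and eq: "(input4 p c)\<^sup>T *\<^sub>v a + (input5 p c)\<^sup>T *\<^sub>v b = 0\<^sub>v (dim_col (input4 p c))"
  hence ab: "dim_vec a = phi1 c" "dim_vec b = phi0 c" by (simp_all add: d)
  have "(input4 p c)\<^sup>T *\<^sub>v a + (input5 p c)\<^sup>T *\<^sub>v b
      = 0\<^sub>v ?q @\<^sub>v (cfS1 c)\<^sup>T *\<^sub>v a @\<^sub>v (cfS0 c)\<^sup>T *\<^sub>v b"
    unfolding input4_def input5_def using ab
    by (simp add: hstack3_transpose_mult_vec append_vec_plus d(1-25))
  moreover have "dim_col (input4 p c) = ?q + (phi1 c + phi0 c)"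
    using c by (simp add: d condensed_blocks_def)
  ultimately have "0\<^sub>v ?q @\<^sub>v (cfS1 c)\<^sup>T *\<^sub>v a @\<^sub>v (cfS0 c)\<^sup>T *\<^sub>v b = 0\<^sub>v ?q @\<^sub>v 0\<^sub>v (phi1 c) @\<^sub>v 0\<^sub>v (phi0 c)"
    using eq by simp
  hence "(cfS1 c)\<^sup>T *\<^sub>v a = 0\<^sub>v (phi1 c) \<and> (cfS0 c)\<^sup>T *\<^sub>v b = 0\<^sub>v (phi0 c)"
    by (simp only: append_vec_inject index_zero_vec(2) dim_mult_mat_vec index_transpose_mat d refl simp_thms)
  moreover have "injective_mat (cfS1 c)\<^sup>T" "injective_mat (cfS0 c)\<^sup>T"
    using condensed_blocks_ranks(4,5)[OF c] by (auto intro!: injective_transpose_of_invertible simp: d)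
  ultimately show "a = 0\<^sub>v (dim_row (input4 p c)) \<and> b = 0\<^sub>v (dim_row (input5 p c))"
    using injective_matD[of "(cfS1 c)\<^sup>T" a] injective_matD[of "(cfS0 c)\<^sup>T" b] ab by (simp add: d)
qed (simp add: dim_inputs[OF c])

text \<open>The transposed window has \<open>b\<close> rows and more than \<open>b\<close> columns,
  hence a nonzero kernel vector. With \<open>L\<close> a block row of the scaling matrix, this gives
  a combination that makes no use of the chosen rows of the system.\<close>

lemma row_combination_vanishing_on_window:
  fixes L :: "real mat"
  assumes "k + b \<le> dim_col L" "b < dim_row L"
  obtains y where "dim_vec y = dim_row L" "y \<noteq> 0\<^sub>v (dim_row L)"
    "\<And>i. i < b \<Longrightarrow> (L\<^sup>T *\<^sub>v y) $ (k + i) = 0"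
proof -
  define K where "K = mat b (dim_row L) (\<lambda>(i,j). L $$ (j, k + i))"
  have "\<not> injective_mat K" using assms by (intro wide_not_injective) (simp add: K_def)
  then obtain y where y: "dim_vec y = dim_row L" "y \<noteq> 0\<^sub>v (dim_row L)" "K *\<^sub>v y = 0\<^sub>v b"
    by (auto simp: injective_mat_def K_def)
  have "(L\<^sup>T *\<^sub>v y) $ (k + i) = 0" if "i < b" for i
    using arg_cong[OF y(3), of "\<lambda>v. v $ i"] that assms y(1)
    by (simp add: K_def scalar_prod_def)
  thus thesis using that y by blast
qed

text \<open>\<open>U1\<close> and \<open>U2\<close> are the first two block rows of the scaling
  matrix. Multiplying by the inverse of \<open>V\<close> turns the zero block of
  \<open>U * cD e * V\<close> into one of \<open>U * cD e\<close>.\<close>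

lemma condensed_at_rows:
  assumes e: "sized_eq m d p e" and b: "condensed_at m d p e b"
  obtains U1 U2 where "dim_row U1 = r2 b" "dim_col U1 = m" "dim_row U2 = r1 b" "dim_col U2 = m"
    "U1 * cA e = cfA1 b" "U2 * cA e = 0\<^sub>m (r1 b) d" "U2 * cB e = cfB2 b" "U2 * cD e = 0\<^sub>m (r1 b) p"
proof -
  have de: "dim_row (cA e) = m" "dim_row (cB e) = m" "dim_row (cD e) = m" "dim_col (cA e) = d"
      "dim_col (cB e) = d" "dim_col (cD e) = p"
    using e by (simp_all add: sized_eq_def)
  have blocks: "condensed_blocks d p b" using b by (simp add: condensed_at_iff)
  note db = condensed_blocks_dims[OF blocks] dim_inputs[OF blocks]
  obtain U V where U: "dim_row U = m" "dim_col U = m" "U * cA e = cA (condensed_descr d p b)"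
      "U * cB e = cB (condensed_descr d p b)" "U * cD e * V = cD (condensed_descr d p b)"
    and V: "V \<in> carrier_mat p p" "invertible_mat V"
    using b by (auto simp: condensed_at_iff)
  obtain U1 U' where U1: "dim_row U1 = r2 b" "dim_col U1 = m"
    and U': "dim_row U' = m - r2 b" "dim_col U' = m" "U = U1 @\<^sub>r U'"
    using row_split[of U "r2 b" "m - r2 b"] U(1,2) b
    by (metis add_diff_inverse_nat condensed_at_iff add.assoc not_add_less1)
  obtain U2 U'' where U2: "dim_row U2 = r1 b" "dim_col U2 = m"
    and U'': "dim_col U'' = m" "U' = U2 @\<^sub>r U''"
  proof (rule row_split[of U' "r1 b" "m - r2 b - r1 b"])
    show "dim_row U' = r1 b + (m - r2 b - r1 b)" using b U'(1) by (auto simp: condensed_at_iff)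
  qed (use U' in auto)
  obtain V' where V': "V' \<in> carrier_mat p p" "V * V' = 1\<^sub>m p"
    using invertible_mat_inverse[OF V] by blast
  have mult: "U * M = (U1 * M) @\<^sub>r ((U2 * M) @\<^sub>r (U'' * M))" if "dim_row M = m" for M
    using that by (simp add: U' U'' U1 U2 append_rows_mult)
  have A: "U1 * cA e = cfA1 b \<and> U2 * cA e = 0\<^sub>m (r1 b) d"
    using U(3) unfolding mult[OF de(1)] condensed_descr_def descr_eq.select_convs
    by (auto dest!: append_rows_inject simp: U1 U2 U'' de db)
  have B: "U2 * cB e = cfB2 b"
    using U(4) unfolding mult[OF de(2)] condensed_descr_def descr_eq.select_convs
    by (auto dest!: append_rows_inject simp: U1 U2 U'' de db)
  have "U * cD e * V = (U1 * cD e * V) @\<^sub>r ((U2 * cD e * V) @\<^sub>r (U'' * cD e * V))"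
    using V by (simp add: mult[OF de(3)] append_rows_mult U1 U2 U'' de)
  moreover have dV: "dim_row V = p" "dim_col V = p" using V(1) by simp_all
  ultimately have D: "U2 * cD e * V = 0\<^sub>m (r1 b) p"
    using U(5) unfolding condensed_descr_def descr_eq.select_convs
    by (auto dest!: append_rows_inject simp: U1 U2 U'' de db dV)
  have "U2 * cD e = U2 * cD e * (V * V')" using V' by (simp add: de right_mult_one_mat')
  also have "\<dots> = U2 * cD e * V * V'" using V V' by (simp add: mult_mat_assoc U2 de)
  also have "\<dots> = 0\<^sub>m (r1 b) p" using V' by (simp add: D)
  finally show thesis using that U1 U2 A B by blast
qed

section \<open>Bounds on the block sizes after a reduction step\<close>

lemma mult_transpose_mult_vec:
  fixes U M :: "real mat"
  assumes "dim_col U = dim_row M" "dim_vec y = dim_row U"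
  shows "(U * M)\<^sup>T *\<^sub>v y = M\<^sup>T *\<^sub>v (U\<^sup>T *\<^sub>v y)"
  using assms by (simp add: transpose_mult_dim mult_mat_vec_assoc)

context
  fixes d p m c c' c'' S1 S2 Z1 Z2 Z3 Z4 Z5 e b
  assumes c: "condensed_blocks d p c" and c': "condensed_blocks d p c'"
    and R: "reduction_matrices d c c' c'' S1 S2 Z1 Z2 Z3 Z4 Z5"
    and e: "e = reduced_eq d p c c' c'' S1 S2 Z1 Z2 Z3 Z4 Z5"
    and sized: "sized_eq m d p e"
    and b: "condensed_at m d p e b"
begin

lemma level2_kernel:
  assumes "dim_vec w1 = dim_row S2" "(S2 * cfA1 c)\<^sup>T *\<^sub>v w1 = 0\<^sub>v d"
  shows "w1 = 0\<^sub>v (dim_row S2)"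
proof -
  have "injective_mat (S2 * cfA1 c)\<^sup>T"
    using R by (simp add: reduction_matrices_def full_row_rank_iff_injective_transpose)
  from injective_matD[OF this _ assms(2)] assms(1) show ?thesis by simp
qed

text \<open>Only the leading \<open>dim_row S2\<close> rows of the reduced \<open>A\<close> can be
  nonzero. If \<open>r2 b\<close> were larger, a nontrivial combination of the rows of
  \<open>U1\<close> would avoid them, and with the same coefficients the independent rows of
  \<open>cfA1 b\<close> would sum to zero.\<close>

lemma r2_le: "r2 b \<le> dim_row S2"
proof (rule ccontr)
  assume less: "\<not> r2 b \<le> dim_row S2"
  note d = condensed_blocks_dims[OF c] reduction_matrices_dims[OF R]
  obtain U1 U2 where U: "dim_row U1 = r2 b" "dim_col U1 = m" "U1 * cA e = cfA1 b"
    using condensed_at_rows[OF sized b] by metis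
  have "cA e = (S2 * cfA1 c) @\<^sub>r 0\<^sub>m (dim_row (cA e) - dim_row S2) d"
    unfolding e reduced_eq_unfold[OF c R] by (simp add: zero_append_rows)
  moreover have "dim_row (cA e) = m" using sized by (simp add: sized_eq_def)
  moreover define t where "t = m - dim_row S2"
  ultimately have A: "cA e = (S2 * cfA1 c) @\<^sub>r 0\<^sub>m t d" by simp
  have m: "m = dim_row S2 + t"
    using \<open>dim_row (cA e) = m\<close> unfolding A by simp
  obtain y where y: "dim_vec y = r2 b" "y \<noteq> 0\<^sub>v (r2 b)"
    "\<And>i. i < dim_row S2 \<Longrightarrow> (U1\<^sup>T *\<^sub>v y) $ (0 + i) = 0"
    using row_combination_vanishing_on_window[of 0 "dim_row S2" U1] less U(1,2) m by auto
  obtain w1 w2 where w: "dim_vec w1 = dim_row S2" "dim_vec w2 = t" "U1\<^sup>T *\<^sub>v y = w1 @\<^sub>v w2"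
    by (rule vec_split[of "U1\<^sup>T *\<^sub>v y" "dim_row S2" t]) (use U m in simp_all)
  have "w1 = 0\<^sub>v (dim_row S2)"
    by (rule eq_vecI) (use y(3) w in \<open>auto simp del: index_mult_mat_vec\<close>)
  moreover have "(cfA1 b)\<^sup>T *\<^sub>v y = (cA e)\<^sup>T *\<^sub>v (w1 @\<^sub>v w2)"
    unfolding U(3)[symmetric] w(3)[symmetric]
    by (rule mult_transpose_mult_vec) (simp_all add: U y A m)
  ultimately have "(cfA1 b)\<^sup>T *\<^sub>v y = 0\<^sub>v d"
    using w by (simp add: A append_rows_transpose_mult_vec d)
  moreover have blocks: "condensed_blocks d p b" using b by (simp add: condensed_at_iff)
  ultimately show False
    using condensed_blocks_ranks(1)[OF blocks] y(1,2) injective_matD[of "(cfA1 b)\<^sup>T" y d]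
    by (simp add: full_row_rank_iff_injective_transpose condensed_blocks_dims[OF blocks])
qed

text \<open>The rows of the reduced \<open>B\<close> that may be nonzero come from
  \<open>S2\<close>, \<open>Z2\<close>, \<open>S1\<close> and \<open>cfB4\<close>. Too many rows of
  \<open>U2\<close> would admit a combination avoiding the \<open>Z2\<close> and \<open>S1\<close>
  rows; the vanishing of \<open>A\<close> and of the input part excludes the \<open>S2\<close> and
  \<open>cfB4\<close> rows as well, so independent rows of \<open>cfB2 b\<close> would sum to
  zero.\<close>

lemma r1_le: "r1 b \<le> dim_row Z2 + dim_row S1"
proof (rule ccontr)
  assume less: "\<not> r1 b \<le> dim_row Z2 + dim_row S1"
  note d = condensed_blocks_dims[OF c] condensed_blocks_dims[OF c'] reduction_matrices_dims[OF R]
    dim_inputs[OF c]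
  obtain U1 U2 where U: "dim_row U2 = r1 b" "dim_col U2 = m" "U2 * cA e = 0\<^sub>m (r1 b) d"
      "U2 * cB e = cfB2 b" "U2 * cD e = 0\<^sub>m (r1 b) p"
    using condensed_at_rows[OF sized b] by metis
  note e' = e[unfolded reduced_eq_unfold[OF c R]]
  have m: "m = dim_row S2 + (dim_row Z2 + (dim_row S1 + (dim_row Z1 + (r0 c + (phi1 c + (phi0 c + vnum c))))))"
    using sized unfolding e' sized_eq_def by simp
  \<comment> \<open>The window skips the \<open>S2\<close> rows and covers exactly the adjacent
    \<open>Z2\<close> and \<open>S1\<close> rows.\<close>
  obtain y where y: "dim_vec y = r1 b" "y \<noteq> 0\<^sub>v (r1 b)"
    "\<And>i. i < dim_row Z2 + dim_row S1 \<Longrightarrow> (U2\<^sup>T *\<^sub>v y) $ (dim_row S2 + i) = 0"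
    using row_combination_vanishing_on_window[of "dim_row S2" "dim_row Z2 + dim_row S1" U2] less U(1,2) m by auto
  obtain w1 w2 w3 w4 w5 w6 w7 w8 where dw: "dim_vec w1 = dim_row S2" "dim_vec w2 = dim_row Z2"
      "dim_vec w3 = dim_row S1" "dim_vec w4 = dim_row Z1" "dim_vec w5 = r0 c" "dim_vec w6 = phi1 c"
      "dim_vec w7 = phi0 c" "dim_vec w8 = vnum c"
    and w: "U2\<^sup>T *\<^sub>v y = w1 @\<^sub>v w2 @\<^sub>v w3 @\<^sub>v w4 @\<^sub>v w5 @\<^sub>v w6 @\<^sub>v w7 @\<^sub>v w8"
  proof -
    have "dim_vec (U2\<^sup>T *\<^sub>v y) = m" using U by simp
    thus thesis using that unfolding m by (elim vec_split) blast
  qed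
  have w2: "w2 = 0\<^sub>v (dim_row Z2)"
  proof (rule eq_vecI)
    fix i assume "i < dim_vec (0\<^sub>v (dim_row Z2) :: real vec)"
    thus "w2 $ i = 0\<^sub>v (dim_row Z2) $ i" using y(3)[of i] dw unfolding w by simp
  qed (simp add: dw)
  have w3: "w3 = 0\<^sub>v (dim_row S1)"
  proof (rule eq_vecI)
    fix i assume "i < dim_vec (0\<^sub>v (dim_row S1) :: real vec)"
    thus "w3 $ i = 0\<^sub>v (dim_row S1) $ i" using y(3)[of "dim_row Z2 + i"] dw unfolding w by simp
  qed (simp add: dw)
  have mult: "(U2 * M)\<^sup>T *\<^sub>v y = M\<^sup>T *\<^sub>v (w1 @\<^sub>v w2 @\<^sub>v w3 @\<^sub>v w4 @\<^sub>v w5 @\<^sub>v w6 @\<^sub>v w7 @\<^sub>v w8)"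
    if "dim_row M = m" for M
    unfolding w[symmetric] by (rule mult_transpose_mult_vec) (simp_all add: U y that)
  have dm: "dim_row (cA e) = m" "dim_row (cB e) = m" "dim_row (cD e) = m"
    using sized by (simp_all add: sized_eq_def)
  note stacks = append_rows_transpose_mult_vec d dw
  have "(S2 * cfA1 c)\<^sup>T *\<^sub>v w1 = 0\<^sub>v d"
    using mult[OF dm(1)] y(1) unfolding U(3) by (simp add: e' stacks)
  from level2_kernel[OF dw(1) this] have w1: "w1 = 0\<^sub>v (dim_row S2)" .
  \<comment> \<open>With \<open>w1\<close> and \<open>w2\<close> zero, only the rows with
    independent inputs remain in the input part; this removes the \<open>cfB4\<close> rows.\<close>
  have "(input4 p c)\<^sup>T *\<^sub>v w6 + (input5 p c)\<^sup>T *\<^sub>v w7 = 0\<^sub>v p"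
    using mult[OF dm(3)] y(1) unfolding U(5) by (simp add: e' stacks w1 w2)
  with injective_append_transposeD[OF inputs_injective_transpose[OF c], of w6 w7 p]
  have w6: "w6 = 0\<^sub>v (phi1 c)" by (simp add: d dw)
  have "(cfB2 b)\<^sup>T *\<^sub>v y = 0\<^sub>v d"
    using mult[OF dm(2)] unfolding U(4) by (simp add: e' stacks w1 w2 w3 w6)
  moreover have blocks: "condensed_blocks d p b" using b by (simp add: condensed_at_iff)
  ultimately show False
    using condensed_blocks_ranks(2)[OF blocks] y(1,2) injective_matD[of "(cfB2 b)\<^sup>T" y d]
    by (simp add: full_row_rank_iff_injective_transpose condensed_blocks_dims[OF blocks])
qed

end

lemma injective_of_orthogonal_square:
  assumes "orthogonal_square r (S @\<^sub>r Z)" "dim_col S = r" "dim_col Z = r" "dim_row Z = 0"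
  shows "injective_mat S"
  unfolding injective_mat_def
proof (intro ballI impI)
  fix v assume v: "v \<in> carrier_vec (dim_col S)" "S *\<^sub>v v = 0\<^sub>v (dim_row S)"
  have "Z\<^sup>T *\<^sub>v (Z *\<^sub>v v) = 0\<^sub>v r"
    using assms(3,4) by (intro eq_vecI) (simp_all add: scalar_prod_def)
  thus "v = 0\<^sub>v (dim_col S)"
    using orthogonal_square_append(6)[OF assms(1-3), of v] v assms by simp
qed

text \<open>Without \<open>Z\<close> rows the matrices \<open>S1\<close> and \<open>S2\<close> are
  themselves orthogonal, so conditions on the products with them pass to the blocks. Read
  contrapositively, a time with hidden redundancy has a \<open>Z\<close> row, which drives
  termination.\<close>

lemma procedure_stops_if_no_reduction:
  assumes c: "condensed_blocks d p c" and c': "condensed_blocks d p c'" and c'': "condensed_blocks d p c''"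
    and R: "reduction_matrices d c c' c'' S1 S2 Z1 Z2 Z3 Z4 Z5"
    and "dim_row Z1 = 0" "dim_row Z2 = 0"
  shows "no_hidden_redundancy (cfA1 c) (cfB2 c' @\<^sub>r cfC3 c'') \<and> no_hidden_redundancy (cfB2 c) (cfC3 c')"
proof
  note d = condensed_blocks_dims[OF c] condensed_blocks_dims[OF c'] condensed_blocks_dims[OF c'']
    reduction_matrices_dims[OF R]
  have "injective_mat S1" "injective_mat S2"
    using assms(5,6) injective_of_orthogonal_square reduction_matrices_rels(1,2)[OF R] d by blast+
  thus "no_hidden_redundancy (cfA1 c) (cfB2 c' @\<^sub>r cfC3 c'')" "no_hidden_redundancy (cfB2 c) (cfC3 c')"
    using R by (auto intro!: no_hidden_redundancy_mult_injective[of S2 "cfA1 c"]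
        no_hidden_redundancy_mult_injective[of S1 "cfB2 c"] simp: d reduction_matrices_def)
qed

section \<open>Existence of the condensed form\<close>

text \<open>The added rows form an orthonormal basis of the kernel of \<open>N\<close>. A common
  kernel vector lies in that space and is orthogonal to its basis; a vanishing combination of rows
  splits because the two row spaces are orthogonal.\<close>

lemma row_completion:
  fixes N :: "real mat"
  assumes N: "injective_mat N\<^sup>T"
  obtains X where "dim_col X = dim_col N" "dim_row X + dim_row N = dim_col N" "injective_mat (X @\<^sub>r N)"
proof -
  define W where "W = {v. dim_vec v = dim_col N \<and> N *\<^sub>v v = 0\<^sub>v (dim_row N)}"
  have W: "W \<subseteq> carrier_vec (dim_col N)" "0\<^sub>v (dim_col N) \<in> W"
    "\<And>v w. v \<in> W \<Longrightarrow> w \<in> W \<Longrightarrow> v + w \<in> W" "\<And>c v. v \<in> W \<Longrightarrow> c \<cdot>\<^sub>v v \<in> W"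
    by (auto simp: W_def mult_mat_vec_add mult_mat_vec_smult)
  obtain X where X: "dim_col X = dim_col N" "X * X\<^sup>T = 1\<^sub>m (dim_row X)"
    and XW: "\<And>y. dim_vec y = dim_row X \<Longrightarrow> X\<^sup>T *\<^sub>v y \<in> W" "\<And>v. v \<in> W \<Longrightarrow> X\<^sup>T *\<^sub>v (X *\<^sub>v v) = v"
    using orthonormal_basis[OF W] by blast
  have XX: "X *\<^sub>v (X\<^sup>T *\<^sub>v a) = a" if "dim_vec a = dim_row X" for a
    using mult_mat_vec_assoc[of X "X\<^sup>T" a] that X by simp
  have inj: "injective_mat (X @\<^sub>r N)" unfolding injective_mat_def
  proof (intro ballI impI)
    fix v assume v: "v \<in> carrier_vec (dim_col (X @\<^sub>r N))" "(X @\<^sub>r N) *\<^sub>v v = 0\<^sub>v (dim_row (X @\<^sub>r N))"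
    hence "(X *\<^sub>v v) @\<^sub>v (N *\<^sub>v v) = 0\<^sub>v (dim_row X) @\<^sub>v 0\<^sub>v (dim_row N)"
      using X by (simp add: append_rows_mult_vec)
    hence *: "X *\<^sub>v v = 0\<^sub>v (dim_row X) \<and> N *\<^sub>v v = 0\<^sub>v (dim_row N)"
      by (subst (asm) append_vec_inject) simp_all
    hence "v \<in> W" using v X by (simp add: W_def)
    from XW(2)[OF this] * show "v = 0\<^sub>v (dim_col (X @\<^sub>r N))" by simp
  qed
  have "injective_mat (X @\<^sub>r N)\<^sup>T"
  proof (rule injective_append_transposeI)
    fix a b assume "a \<in> carrier_vec (dim_row X)" "b \<in> carrier_vec (dim_row N)"
      and eq: "X\<^sup>T *\<^sub>v a + N\<^sup>T *\<^sub>v b = 0\<^sub>v (dim_col X)"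
    hence d: "dim_vec a = dim_row X" "dim_vec b = dim_row N" by simp_all
    define n where "n = N\<^sup>T *\<^sub>v b"
    have dn: "dim_vec n = dim_col N" by (simp add: n_def)
    \<comment> \<open>Multiplication by \<open>N\<close> removes the \<open>X\<close> part, whose
      rows lie in the kernel of \<open>N\<close>; what remains makes \<open>n\<close> orthogonal to
      itself.\<close>
    have "N *\<^sub>v (X\<^sup>T *\<^sub>v a + n) = N *\<^sub>v n"
      using XW(1)[OF d(1)] X by (simp add: mult_mat_vec_add dn W_def)
    hence "N *\<^sub>v n = 0\<^sub>v (dim_row N)" using eq X by (simp add: n_def)
    hence "n \<bullet> n = 0"
      using transpose_vec_mult_scalar[of N "dim_row N" "dim_col N" n b] d(2) by (simp add: n_def)
    hence n0: "n = 0\<^sub>v (dim_col N)" using scalar_prod_self_eq_0[of n "dim_col N"] dn by simp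
    hence "b = 0\<^sub>v (dim_row N)" using injective_matD[OF N, of b "dim_col N"] d by (simp add: n_def)
    moreover have "X\<^sup>T *\<^sub>v a = 0\<^sub>v (dim_col N)" using eq n0 X by (simp add: n_def)
    hence "a = 0\<^sub>v (dim_row X)" using XX[OF d(1)] X by simp
    ultimately show "a = 0\<^sub>v (dim_row X) \<and> b = 0\<^sub>v (dim_row N)" by simp
  qed (simp add: X)
  from injective_imp_inverse[OF inj this] have "dim_row X + dim_row N = dim_col N"
    using X by auto
  thus thesis using that X(1) inj by blast
qed

lemma orthogonal_square_kernel:
  assumes "orthogonal_square r (S @\<^sub>r Z)" "dim_col S = r" "dim_col Z = r" "dim_vec v = r"
    "S *\<^sub>v v = 0\<^sub>v (dim_row S)" "Z *\<^sub>v v = 0\<^sub>v (dim_row Z)"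
  shows "v = 0\<^sub>v r"
  using orthogonal_square_cancel[OF assms(1-4), of "0\<^sub>v r"] assms by simp

lemma hstack3_split:
  fixes M :: "real mat"
  assumes "dim_row M = r" "dim_col M = a + (b + c)"
  obtains M1 M2 M3 where "dim_row M1 = r" "dim_row M2 = r" "dim_row M3 = r"
    "dim_col M1 = a" "dim_col M2 = b" "dim_col M3 = c" "M = hstack r [M1, M2, M3]"
proof -
  obtain N1 N' where N1: "dim_row N1 = a" "dim_col N1 = r" "dim_row N' = b + c" "dim_col N' = r" "M\<^sup>T = N1 @\<^sub>r N'"
    using row_split[of "M\<^sup>T" a "b + c"] assms by (metis index_transpose_mat(2,3))
  obtain N2 N3 where N2: "dim_row N2 = b" "dim_col N2 = r" "dim_row N3 = c" "dim_col N3 = r" "N' = N2 @\<^sub>r N3"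
    using row_split[of N' b c] N1 by metis
  have "M = (N1 @\<^sub>r N2 @\<^sub>r N3)\<^sup>T" using N1(5) N2(5) by (metis transpose_transpose)
  hence "M = hstack r [N1\<^sup>T, N2\<^sup>T, N3\<^sup>T]" using N2 by (simp add: hstack_def)
  thus thesis using that[of "N1\<^sup>T" "N2\<^sup>T" "N3\<^sup>T"] N1 N2 by simp
qed

lemma minus_mat_mult_vec:
  fixes A B :: "real mat"
  assumes "dim_row B = dim_row A" "dim_col B = dim_col A" "dim_vec x = dim_col A"
  shows "(A - B) *\<^sub>v x = A *\<^sub>v x - B *\<^sub>v x"
  using assms by (intro minus_mult_distrib_mat_vec[of _ "dim_row A" "dim_col A"]) simp_all

lemma invertible_one_mat: "invertible_mat (1\<^sub>m n :: real mat)"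
  using invertible_mat_iff_injective[of "1\<^sub>m n" n] injective_one_mat by simp

text \<open>Compress the rows first by \<open>A\<close>, then the remaining rows by \<open>D\<close>, and finally those with
  vanishing \<open>D\<close> by \<open>B\<close> and \<open>C\<close>, and those with independent \<open>D\<close> by \<open>B\<close>. Completing the latter rows of
  \<open>D\<close> to an invertible matrix and taking its inverse as \<open>V\<close> turns both \<open>\<Sigma>\<close> blocks into identities;
  they serve to clear the input blocks of the first row.\<close>

lemma condensed_at_exists:
  assumes e: "sized_eq m d p e"
  shows "\<exists>c. condensed_at m d p e c"
proof -
  define A B C D f where "A = cA e" and "B = cB e" and "C = cC e" and "D = cD e" and "f = rhs e"
  have de: "dim_row A = m" "dim_col A = d" "dim_row B = m" "dim_col B = d" "dim_row C = m"
    "dim_col C = d" "dim_row D = m" "dim_col D = p" "dim_vec f = m"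
    using e by (simp_all add: A_def B_def C_def D_def f_def sized_eq_def)
  obtain SA ZA where A: "dim_col SA = m" "dim_col ZA = m" "orthogonal_square m (SA @\<^sub>r ZA)"
    "injective_mat (SA * A)\<^sup>T" "ZA * A = 0\<^sub>m (dim_row ZA) d"
    using row_compression[of A] unfolding de .
  define kA where "kA = dim_row ZA"
  obtain SD ZD where D: "dim_col SD = kA" "dim_col ZD = kA" "orthogonal_square kA (SD @\<^sub>r ZD)"
    "injective_mat (SD * (ZA * D))\<^sup>T" "ZD * (ZA * D) = 0\<^sub>m (dim_row ZD) p"
    using row_compression[of "ZA * D"] unfolding index_mult_mat de kA_def[symmetric] .
  \<comment> \<open>\<open>N\<close> and \<open>T\<close> select row combinations on which
    \<open>A\<close> vanishes: those of \<open>N\<close> also annihilate \<open>D\<close>, those of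
    \<open>T\<close> have independent rows in \<open>D\<close>.\<close>
  define N where "N = ZD * ZA"
  define T where "T = SD * ZA"
  define kN where "kN = dim_row ZD"
  define kT where "kT = dim_row SD"
  have dNT: "dim_row N = kN" "dim_col N = m" "dim_row T = kT" "dim_col T = m"
    by (simp_all add: N_def T_def kN_def kT_def A)
  obtain SB ZB where B: "dim_col SB = kN" "dim_col ZB = kN" "orthogonal_square kN (SB @\<^sub>r ZB)"
    "injective_mat (SB * (N * B))\<^sup>T" "ZB * (N * B) = 0\<^sub>m (dim_row ZB) d"
    using row_compression[of "N * B"] unfolding index_mult_mat de dNT .
  define kB where "kB = dim_row ZB"
  obtain SC ZC where C: "dim_col SC = kB" "dim_col ZC = kB" "orthogonal_square kB (SC @\<^sub>r ZC)"
    "injective_mat (SC * (ZB * N * C))\<^sup>T" "ZC * (ZB * N * C) = 0\<^sub>m (dim_row ZC) d"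
    using row_compression[of "ZB * N * C"] unfolding index_mult_mat de kB_def[symmetric] .
  obtain SE ZE where E: "dim_col SE = kT" "dim_col ZE = kT" "orthogonal_square kT (SE @\<^sub>r ZE)"
    "injective_mat (SE * (T * B))\<^sup>T" "ZE * (T * B) = 0\<^sub>m (dim_row ZE) d"
    using row_compression[of "T * B"] unfolding index_mult_mat de dNT .
  define U2 where "U2 = SB * N"
  define U3 where "U3 = SC * (ZB * N)"
  define U6 where "U6 = ZC * (ZB * N)"
  define U4 where "U4 = SE * T"
  define U5 where "U5 = ZE * T"
  define s2 s1 s0 f1 f0 vn where "s2 = dim_row SA" and "s1 = dim_row SB" and "s0 = dim_row SC"
    and "f1 = dim_row SE" and "f0 = dim_row ZE" and "vn = dim_row ZC"
  note s_defs = s2_def[symmetric] s1_def[symmetric] s0_def[symmetric] f1_def[symmetric]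
    f0_def[symmetric] vn_def[symmetric] kA_def[symmetric] kN_def[symmetric] kT_def[symmetric] kB_def[symmetric]
  have dU: "dim_row U2 = s1" "dim_col U2 = m" "dim_row U3 = s0" "dim_col U3 = m" "dim_row U4 = f1"
    "dim_col U4 = m" "dim_row U5 = f0" "dim_col U5 = m" "dim_row U6 = vn" "dim_col U6 = m"
    by (simp_all add: U2_def U3_def U4_def U5_def U6_def s_defs dNT)
  note U_defs = U2_def U3_def U4_def U5_def U6_def N_def T_def
  have ZA0: "N * A = 0\<^sub>m kN d" "T * A = 0\<^sub>m kT d"
    using A D by (simp_all add: N_def T_def mult_mat_assoc s_defs de)
  have ND: "N * D = 0\<^sub>m kN p" using A D by (simp add: N_def mult_mat_assoc s_defs de)
  have TD: "injective_mat (T * D)\<^sup>T" using A D by (simp add: T_def mult_mat_assoc s_defs de)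
  have sizes: "s2 + kA = m" "kT + kN = kA" "s1 + kB = kN" "s0 + vn = kB" "f1 + f0 = kT"
    using orthogonal_square_append(1)[OF A(3,1,2)] orthogonal_square_append(1)[OF D(3,1,2)]
      orthogonal_square_append(1)[OF B(3,1,2)] orthogonal_square_append(1)[OF C(3,1,2)]
      orthogonal_square_append(1)[OF E(3,1,2)] by (simp_all add: s_defs)
  have UA: "U2 * A = 0\<^sub>m s1 d" "U3 * A = 0\<^sub>m s0 d" "U4 * A = 0\<^sub>m f1 d" "U5 * A = 0\<^sub>m f0 d" "U6 * A = 0\<^sub>m vn d"
    by (simp_all add: U2_def U3_def U4_def U5_def U6_def mult_mat_assoc dNT de A B C D E ZA0 s_defs)
  have UD: "U2 * D = 0\<^sub>m s1 p" "U3 * D = 0\<^sub>m s0 p" "U6 * D = 0\<^sub>m vn p"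
    by (simp_all add: U2_def U3_def U6_def mult_mat_assoc dNT de A B C D E ND s_defs)
  have UB: "U3 * B = 0\<^sub>m s0 d" "U5 * B = 0\<^sub>m f0 d" "U6 * B = 0\<^sub>m vn d"
    "injective_mat (U2 * B)\<^sup>T" "injective_mat (U4 * B)\<^sup>T"
    using B(4) E(4) by (simp_all add: U2_def U3_def U4_def U5_def U6_def mult_mat_assoc dNT de B(1-3,5) C(1-3) E(1-3,5) s_defs)
  have UC: "U6 * C = 0\<^sub>m vn d" "injective_mat (U3 * C)\<^sup>T"
    using C(4,5) by (simp_all add: U3_def U6_def mult_mat_assoc dNT de B(1-3) C(1-3) s_defs)
  \<comment> \<open>The rows of \<open>T\<close> are only transformed orthogonally by
    \<open>SE\<close> and \<open>ZE\<close>, so their input parts stay independent after the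
    compression by \<open>B\<close>.\<close>
  have "U4 @\<^sub>r U5 = (SE @\<^sub>r ZE) * T"
    by (simp add: U4_def U5_def append_rows_mult E dNT)
  hence "(U4 * D) @\<^sub>r (U5 * D) = (SE @\<^sub>r ZE) * (T * D)"
    using append_rows_mult[of U4 D U5] by (simp add: dU de mult_mat_assoc E dNT)
  moreover have "injective_mat (SE @\<^sub>r ZE)\<^sup>T"
    using E(3) by (intro injective_matI_left_inverse[of "SE @\<^sub>r ZE"]) (auto simp: orthogonal_square_def)
  ultimately have injD: "injective_mat ((U4 * D) @\<^sub>r (U5 * D))\<^sup>T"
    using TD by (simp add: transpose_mult_dim E dNT injective_mat_mult)
  obtain X where X: "dim_col X = p" "dim_row X + (f1 + f0) = p"
    "injective_mat (X @\<^sub>r (U4 * D) @\<^sub>r (U5 * D))"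
    using row_completion[OF injD] by (auto simp: dU de)
  define q where "q = p - f1 - f0"
  have q: "dim_row X = q" "q + (f1 + f0) = p" using X by (simp_all add: q_def)
  define K where "K = X @\<^sub>r (U4 * D) @\<^sub>r (U5 * D)"
  have K: "dim_row K = p" "dim_col K = p" using X by (simp_all add: K_def dU)
  obtain V where V: "dim_row V = p" "dim_col V = p" "K * V = 1\<^sub>m p" "V * K = 1\<^sub>m p"
    using square_injective_inverse[of K p] X(3) K by (auto simp: K_def)
  have "injective_mat V" by (rule injective_matI_left_inverse[of K]) (simp_all add: V K)
  hence invV: "invertible_mat V" using invertible_mat_iff_injective[of V p] V by simp
  have split: "\<exists>a b c. x = a @\<^sub>v b @\<^sub>v c \<and> dim_vec a = q \<and> dim_vec b = f1 \<and> dim_vec c = f0"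
    if "dim_vec x = p" for x :: "real vec"
  proof -
    have "dim_vec x = q + (f1 + f0)" using that q by simp
    thus ?thesis by (elim vec_split) blast
  qed
  \<comment> \<open>The equation \<open>K * V = 1\<^sub>m p\<close> read block by block: after the
    substitution by \<open>V\<close>, the input parts of \<open>U4\<close> and \<open>U5\<close> are
    the last two groups of coordinates.\<close>
  have V45: "(U4 * D) *\<^sub>v (V *\<^sub>v (a @\<^sub>v b @\<^sub>v c)) = b \<and> (U5 * D) *\<^sub>v (V *\<^sub>v (a @\<^sub>v b @\<^sub>v c)) = c"
    if "dim_vec a = q" "dim_vec b = f1" "dim_vec c = f0" for a b c
  proof -
    let ?x = "a @\<^sub>v b @\<^sub>v c"
    have dx: "dim_vec ?x = p" using that q by simp
    have "K *\<^sub>v (V *\<^sub>v ?x) = ?x" using mult_mat_vec_assoc[of K V ?x] dx V K by simp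
    hence "X *\<^sub>v (V *\<^sub>v ?x) @\<^sub>v (U4 * D) *\<^sub>v (V *\<^sub>v ?x) @\<^sub>v (U5 * D) *\<^sub>v (V *\<^sub>v ?x) = ?x"
      by (simp add: K_def append_rows_mult_vec X V de)
    thus ?thesis
      by (subst (asm) append_vec_inject, simp add: q that)
        (subst (asm) append_vec_inject, simp add: dU that, simp)
  qed
  obtain M1 M2 M3 where M: "dim_row M1 = s2" "dim_row M2 = s2" "dim_row M3 = s2"
    "dim_col M1 = q" "dim_col M2 = f1" "dim_col M3 = f0" "SA * D * V = hstack s2 [M1, M2, M3]"
    using hstack3_split[of "SA * D * V" s2 q f1 f0] q by (auto simp: V s_defs)
  \<comment> \<open>As the \<open>U4\<close> and \<open>U5\<close> rows have identity input blocks,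
    subtracting these multiples cancels \<open>M2\<close> and \<open>M3\<close>; \<open>A\<close> is
    unaffected because it vanishes on those rows.\<close>
  define U1 where "U1 = SA - (M2 * U4 + M3 * U5)"
  have dU1: "dim_row U1 = s2" "dim_col U1 = m" by (simp_all add: U1_def M dU)
  have U1v: "U1 *\<^sub>v x = SA *\<^sub>v x - (M2 *\<^sub>v (U4 *\<^sub>v x) + M3 *\<^sub>v (U5 *\<^sub>v x))" if "dim_vec x = m" for x
    unfolding U1_def
    by (subst minus_mat_mult_vec) (simp_all add: M dU A that add_mat_mult_vec mult_mat_vec_assoc s_defs)
  have U1A: "U1 * A = SA * A"
  proof (rule mat_eq_via_vec)
    fix x :: "real vec" assume x: "x \<in> carrier_vec d"
    have "U4 *\<^sub>v (A *\<^sub>v x) = 0\<^sub>v f1" "U5 *\<^sub>v (A *\<^sub>v x) = 0\<^sub>v f0"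
      using mult_mat_vec_assoc[of U4 A x] mult_mat_vec_assoc[of U5 A x] x by (simp_all add: UA dU de)
    hence "U1 *\<^sub>v (A *\<^sub>v x) = SA *\<^sub>v (A *\<^sub>v x)"
      by (simp add: U1v de M) (intro eq_vecI; simp add: s_defs del: index_mult_mat_vec)
    thus "U1 * A *\<^sub>v x = SA * A *\<^sub>v x" using x by (simp add: mult_mat_vec_assoc dU1 de A)
  qed (simp_all add: dU1 de s_defs)
  have UDV1: "U1 * D * V = hstack s2 [M1, 0\<^sub>m s2 f1, 0\<^sub>m s2 f0]"
  proof (rule mat_eq_via_vec[of _ s2 p])
    fix x :: "real vec" assume "x \<in> carrier_vec p"
    hence dx: "dim_vec x = p" by simp
    then obtain a b c where x: "x = a @\<^sub>v b @\<^sub>v c" "dim_vec a = q" "dim_vec b = f1" "dim_vec c = f0"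
      using split by blast
    define w where "w = D *\<^sub>v (V *\<^sub>v x)"
    have dw: "dim_vec w = m" by (simp add: w_def de)
    have 45: "U4 *\<^sub>v w = b" "U5 *\<^sub>v w = c"
      using V45[OF x(2-4), folded x(1)] dx by (simp_all add: w_def mult_mat_vec_assoc dU de V)
    have "SA *\<^sub>v w = (SA * D * V) *\<^sub>v x" using dx by (simp add: w_def mult_mat_vec_assoc de V A)
    also have "\<dots> = M1 *\<^sub>v a + (M2 *\<^sub>v b + M3 *\<^sub>v c)"
      unfolding M(7) x(1) by (rule hstack3_mult_vec) (simp_all add: M x)
    finally have "U1 *\<^sub>v w = M1 *\<^sub>v a"
      by (simp add: U1v dw 45) (intro eq_vecI; simp add: M del: index_mult_mat_vec)
    moreover have "hstack s2 [M1, 0\<^sub>m s2 f1, 0\<^sub>m s2 f0] *\<^sub>v x = M1 *\<^sub>v a"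
      unfolding x(1) using x by (subst hstack3_mult_vec) (simp_all add: M)
    moreover have "U1 * D * V *\<^sub>v x = U1 *\<^sub>v w" using dx by (simp add: w_def mult_mat_vec_assoc de V dU1)
    ultimately show "U1 * D * V *\<^sub>v x = hstack s2 [M1, 0\<^sub>m s2 f1, 0\<^sub>m s2 f0] *\<^sub>v x" by simp
  qed (use q in \<open>simp_all add: dim_hstack dU1 V M\<close>)
  have UDV4: "U4 * D * V = hstack f1 [0\<^sub>m f1 q, 1\<^sub>m f1, 0\<^sub>m f1 f0]"
  proof (rule mat_eq_via_vec[of _ f1 p])
    fix x :: "real vec" assume "x \<in> carrier_vec p"
    hence dx: "dim_vec x = p" by simp
    then obtain a b c where x: "x = a @\<^sub>v b @\<^sub>v c" "dim_vec a = q" "dim_vec b = f1" "dim_vec c = f0"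
      using split by blast
    have "hstack f1 [0\<^sub>m f1 q, 1\<^sub>m f1, 0\<^sub>m f1 f0] *\<^sub>v x = b"
      unfolding x(1) using x by (subst hstack3_mult_vec) simp_all
    thus "U4 * D * V *\<^sub>v x = hstack f1 [0\<^sub>m f1 q, 1\<^sub>m f1, 0\<^sub>m f1 f0] *\<^sub>v x"
      using V45[OF x(2-4), folded x(1)] dx by (simp add: mult_mat_vec_assoc dU de V)
  qed (use q in \<open>simp_all add: dim_hstack dU V\<close>)
  have UDV5: "U5 * D * V = hstack f0 [0\<^sub>m f0 q, 0\<^sub>m f0 f1, 1\<^sub>m f0]"
  proof (rule mat_eq_via_vec[of _ f0 p])
    fix x :: "real vec" assume "x \<in> carrier_vec p"
    hence dx: "dim_vec x = p" by simp
    then obtain a b c where x: "x = a @\<^sub>v b @\<^sub>v c" "dim_vec a = q" "dim_vec b = f1" "dim_vec c = f0"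
      using split by blast
    have "hstack f0 [0\<^sub>m f0 q, 0\<^sub>m f0 f1, 1\<^sub>m f0] *\<^sub>v x = c"
      unfolding x(1) using x by (subst hstack3_mult_vec) simp_all
    thus "U5 * D * V *\<^sub>v x = hstack f0 [0\<^sub>m f0 q, 0\<^sub>m f0 f1, 1\<^sub>m f0] *\<^sub>v x"
      using V45[OF x(2-4), folded x(1)] dx by (simp add: mult_mat_vec_assoc dU de V)
  qed (use q in \<open>simp_all add: dim_hstack dU V\<close>)
  define U where "U = vstack m [U1, U2, U3, U4, U5, U6]"
  have total: "s2 + s1 + s0 + f1 + f0 + vn = m" using sizes by linarith
  have dUU: "dim_row U = m" "dim_col U = m" using total by (simp_all add: U_def dU dU1)
  \<comment> \<open>The compressions are undone from the innermost outwards: \<open>T\<close>,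
    \<open>N\<close>, \<open>ZA\<close> and \<open>SA\<close> in turn map \<open>x\<close> to zero,
    each pair of orthogonal blocks passing the conclusion on.\<close>
  have "injective_mat U" unfolding injective_mat_def
  proof (intro ballI impI)
    fix x assume "x \<in> carrier_vec (dim_col U)" "U *\<^sub>v x = 0\<^sub>v (dim_row U)"
    hence x: "dim_vec x = m" and "U *\<^sub>v x = 0\<^sub>v s2 @\<^sub>v 0\<^sub>v s1 @\<^sub>v 0\<^sub>v s0 @\<^sub>v 0\<^sub>v f1 @\<^sub>v 0\<^sub>v f0 @\<^sub>v 0\<^sub>v vn"
      using total by (simp_all add: dUU add.assoc)
    hence "U1 *\<^sub>v x @\<^sub>v U2 *\<^sub>v x @\<^sub>v U3 *\<^sub>v x @\<^sub>v U4 *\<^sub>v x @\<^sub>v U5 *\<^sub>v x @\<^sub>v U6 *\<^sub>v x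
        = 0\<^sub>v s2 @\<^sub>v 0\<^sub>v s1 @\<^sub>v 0\<^sub>v s0 @\<^sub>v 0\<^sub>v f1 @\<^sub>v 0\<^sub>v f0 @\<^sub>v 0\<^sub>v vn"
      by (simp add: U_def append_rows_mult_vec dU dU1 del: zero_append_zero)
    hence Ux: "U1 *\<^sub>v x = 0\<^sub>v s2" "U2 *\<^sub>v x = 0\<^sub>v s1" "U3 *\<^sub>v x = 0\<^sub>v s0" "U4 *\<^sub>v x = 0\<^sub>v f1"
        "U5 *\<^sub>v x = 0\<^sub>v f0" "U6 *\<^sub>v x = 0\<^sub>v vn"
      by (simp_all add: append_vec_inject dU dU1 del: zero_append_zero)
    have "SE *\<^sub>v (T *\<^sub>v x) = 0\<^sub>v f1" "ZE *\<^sub>v (T *\<^sub>v x) = 0\<^sub>v f0"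
      using Ux(4,5) x by (simp_all add: U4_def U5_def mult_mat_vec_assoc E dNT)
    hence Tx: "T *\<^sub>v x = 0\<^sub>v kT"
      by (intro orthogonal_square_kernel[OF E(3,1,2)]) (simp_all add: dNT s_defs)
    have "SC *\<^sub>v (ZB *\<^sub>v (N *\<^sub>v x)) = 0\<^sub>v s0" "ZC *\<^sub>v (ZB *\<^sub>v (N *\<^sub>v x)) = 0\<^sub>v vn"
      using Ux(3,6) x by (simp_all add: U3_def U6_def mult_mat_vec_assoc B C dNT s_defs)
    hence "ZB *\<^sub>v (N *\<^sub>v x) = 0\<^sub>v kB"
      by (intro orthogonal_square_kernel[OF C(3,1,2)]) (simp_all add: dNT s_defs)
    moreover have "SB *\<^sub>v (N *\<^sub>v x) = 0\<^sub>v s1"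
      using Ux(2) x by (simp add: U2_def mult_mat_vec_assoc B dNT)
    ultimately have Nx: "N *\<^sub>v x = 0\<^sub>v kN"
      by (intro orthogonal_square_kernel[OF B(3,1,2)]) (simp_all add: dNT s_defs)
    have "ZA *\<^sub>v x = 0\<^sub>v kA"
      using Tx Nx x by (intro orthogonal_square_kernel[OF D(3,1,2)])
        (simp_all add: T_def N_def mult_mat_vec_assoc A D s_defs)
    moreover have "SA *\<^sub>v x = 0\<^sub>v s2"
    proof -
      have "SA *\<^sub>v x - (0\<^sub>v s2 + 0\<^sub>v s2) = 0\<^sub>v s2"
        using Ux(1) x by (simp add: U1v Ux(4,5) M)
      from arg_cong[OF this, of "\<lambda>v. v + 0\<^sub>v s2"] show ?thesis
        by (intro eq_vecI) (auto simp: s_defs dest: arg_cong[of _ _ "\<lambda>v. v $ _"])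
    qed
    ultimately show "x = 0\<^sub>v (dim_col U)"
      using orthogonal_square_kernel[OF A(3,1,2), of x] x by (simp add: dUU s_defs)
  qed
  hence invU: "invertible_mat U" using invertible_mat_iff_injective[of U m] dUU by simp
  define c where "c = \<lparr> r2 = s2, r1 = s1, r0 = s0, phi1 = f1, phi0 = f0, vnum = vn,
    cfA1 = U1 * A, cfB1 = U1 * B, cfC1 = U1 * C, cfD1 = M1, cfB2 = U2 * B, cfC2 = U2 * C,
    cfC3 = U3 * C, cfB4 = U4 * B, cfC4 = U4 * C, cfC5 = U5 * C, cfS1 = 1\<^sub>m f1, cfS0 = 1\<^sub>m f0,
    cff1 = U1 *\<^sub>v f, cff2 = U2 *\<^sub>v f, cff3 = U3 *\<^sub>v f, cff4 = U4 *\<^sub>v f, cff5 = U5 *\<^sub>v f, cff6 = U6 *\<^sub>v f \<rparr>"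
  have q': "p - (f1 + f0) = q" "f1 + f0 \<le> p" using q by simp_all
  have blocks: "condensed_blocks d p c"
    using UB(4,5) UC(2) A(4)
    by (simp add: condensed_blocks_def c_def dU dU1 de M full_row_rank_iff_injective_transpose
        invertible_one_mat diagonal_mat_def U1A q' s_defs)
  have mult: "U * N = (U1 * N) @\<^sub>r (U2 * N) @\<^sub>r (U3 * N) @\<^sub>r (U4 * N) @\<^sub>r (U5 * N) @\<^sub>r (U6 * N)"
    if "dim_row N = m" for N
    using that by (simp add: U_def append_rows_mult dU dU1)
  have "U * A = cA (condensed_descr d p c)"
    by (simp add: mult de condensed_descr_def c_def UA U1A)
  moreover have "U * B = cB (condensed_descr d p c)"
    by (simp add: mult de condensed_descr_def c_def UB)
  moreover have "U * C = cC (condensed_descr d p c)"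
    by (simp add: mult de condensed_descr_def c_def UC)
  moreover have "U * D * V = cD (condensed_descr d p c)"
  proof -
    have "U * D * V = (U1 * D * V) @\<^sub>r (U2 * D * V) @\<^sub>r (U3 * D * V) @\<^sub>r (U4 * D * V)
        @\<^sub>r (U5 * D * V) @\<^sub>r (U6 * D * V)"
      unfolding mult[OF de(7)] by (simp add: append_rows_mult dU dU1 V de del: assoc_mult_mat)
    thus ?thesis
      by (simp add: UDV1 UDV4 UDV5 UD V condensed_descr_def c_def input1_def input4_def input5_def q'
          dim_hstack)
  qed
  moreover have "U *\<^sub>v f = rhs (condensed_descr d p c)"
    by (simp add: U_def append_rows_mult_vec dU dU1 de condensed_descr_def c_def)
  moreover have "r2 c + r1 c + r0 c + phi1 c + phi0 c + vnum c = m"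
    using total by (simp add: c_def)
  ultimately have "condensed_at m d p e c"
    unfolding condensed_at_iff using blocks invU invV dUU V(1,2)
    by (auto simp: A_def B_def C_def D_def f_def)
  thus ?thesis ..
qed

section \<open>Runs of the regularization procedure\<close>

text \<open>In each orthogonal pair the numbers of rows add up to the size of the block row, so
  \<open>m\<close> is preserved. The existence of the next condensed form depends on this.\<close>

lemma sized_reduced_eq:
  assumes c: "condensed_blocks d p c" and R: "reduction_matrices d c c' c'' S1 S2 Z1 Z2 Z3 Z4 Z5"
    and c': "condensed_blocks d p c'" and m: "r2 c + r1 c + r0 c + phi1 c + phi0 c + vnum c = m"
  shows "sized_eq m d p (reduced_eq d p c c' c'' S1 S2 Z1 Z2 Z3 Z4 Z5)"
proof -
  note d = condensed_blocks_dims[OF c] condensed_blocks_dims[OF c'] reduction_matrices_dims[OF R]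
    dim_inputs[OF c]
  have "dim_row S1 + dim_row Z1 = r1 c" "dim_row S2 + dim_row Z2 = r2 c"
    by (rule orthogonal_square_append(1)[OF reduction_matrices_rels(1)[OF R]
          reduction_matrices_dims(1,2)[OF R]],
        rule orthogonal_square_append(1)[OF reduction_matrices_rels(2)[OF R]
          reduction_matrices_dims(3,4)[OF R]])
  hence "dim_row S2 + (dim_row Z2 + (dim_row S1 + (dim_row Z1 +
      (r0 c + (phi1 c + (phi0 c + vnum c)))))) = m" using m by linarith
  thus ?thesis unfolding sized_eq_def reduced_eq_unfold[OF c R] by (simp add: d)
qed

lemma condensed_form_exists:
  assumes "\<And>n. n \<ge> n0 \<Longrightarrow> sized_eq m d p (E n)"
  shows "\<exists>c. condensed_form n0 m d p E c"
proof -
  have "\<exists>c. \<forall>n. n0 \<le> n \<longrightarrow> condensed_at m d p (E n) (c n)"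
    by (rule choice) (use condensed_at_exists assms in blast)
  thus ?thesis by (simp add: condensed_form_def)
qed

lemma index_reduction_measure:
  assumes sys: "\<And>n. n \<ge> n0 \<Longrightarrow> sized_eq m d p (F n)"
    and c: "\<And>n. n \<ge> n0 \<Longrightarrow> condensed_blocks d p (c n)"
    and F: "index_reduction n0 d p c F"
    and b: "condensed_form n0 m d p F b"
    and const: "constant_size n0 c" "constant_size n0 b"
    and run: "\<not> procedure_stops n0 c"
  shows "2 * r2 (b n0) + r1 (b n0) < 2 * r2 (c n0) + r1 (c n0)"
proof -
  obtain n where n: "n \<ge> n0" and redundant: "\<not> (no_hidden_redundancy (cfA1 (c n)) (cfB2 (c (n + 1)) @\<^sub>r cfC3 (c (n + 2)))
      \<and> no_hidden_redundancy (cfB2 (c n)) (cfC3 (c (n + 1))))"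
    using run unfolding procedure_stops_def by blast
  have cn: "condensed_blocks d p (c n)" "condensed_blocks d p (c (n + 1))" "condensed_blocks d p (c (n + 2))"
    using c n by simp_all
  obtain S1 S2 Z1 Z2 Z3 Z4 Z5 where
    R: "reduction_matrices d (c n) (c (n + 1)) (c (n + 2)) S1 S2 Z1 Z2 Z3 Z4 Z5"
    and Fn: "F n = reduced_eq d p (c n) (c (n + 1)) (c (n + 2)) S1 S2 Z1 Z2 Z3 Z4 Z5"
    using F n unfolding index_reduction_def by blast
  have bn: "condensed_at m d p (F n) (b n)" using b n by (simp add: condensed_form_def)
  note bounds = r2_le[OF cn(1,2) R Fn sys[OF n] bn] r1_le[OF cn(1,2) R Fn sys[OF n] bn]
  have "dim_row S1 + dim_row Z1 = r1 (c n)" "dim_row S2 + dim_row Z2 = r2 (c n)"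
    using reduction_matrices_rels(1,2)[OF R] orthogonal_square_append(1) reduction_matrices_dims[OF R] by blast+
  moreover have "dim_row Z1 > 0 \<or> dim_row Z2 > 0"
    using procedure_stops_if_no_reduction[OF cn R] redundant by auto
  ultimately have "2 * r2 (b n) + r1 (b n) < 2 * r2 (c n) + r1 (c n)" using bounds by linarith
  \<comment> \<open>The Constant Size Assumption is applied to the condensed forms before and after
    the step.\<close>
  moreover have "r2 (c n) = r2 (c n0)" "r1 (c n) = r1 (c n0)" "r2 (b n) = r2 (b n0)" "r1 (b n) = r1 (b n0)"
    using const n unfolding constant_size_def by blast+
  ultimately show ?thesis by simp
qed

text \<open>The substitution is \<open>u = V v\<close>, so the condensed form receives
  \<open>T *\<^sub>v u\<close> with \<open>T\<close> the inverse of \<open>V\<close>; the scaling is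
  injective and loses no information.\<close>

lemma condensed_at_input_transformation:
  assumes e: "sized_eq m d p e" and c: "condensed_at m d p e c"
  obtains T where "dim_row T = p" "dim_col T = p" "injective_mat T"
    "\<And>x2 x1 x0 u. \<lbrakk>dim_vec x2 = d; dim_vec x1 = d; dim_vec x0 = d; dim_vec u = p\<rbrakk> \<Longrightarrow>
      eq_holds (condensed_descr d p c) x2 x1 x0 (T *\<^sub>v u) \<longleftrightarrow> eq_holds e x2 x1 x0 u"
proof -
  obtain U V where U: "U \<in> carrier_mat m m" "invertible_mat U" and V: "V \<in> carrier_mat p p" "invertible_mat V"
    and eqs: "cA (condensed_descr d p c) = U * cA e" "cB (condensed_descr d p c) = U * cB e"
      "cC (condensed_descr d p c) = U * cC e" "cD (condensed_descr d p c) = U * cD e * V"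
      "rhs (condensed_descr d p c) = U *\<^sub>v rhs e"
    using c unfolding condensed_at_iff by metis
  have dU: "dim_row U = m" "dim_col U = m" "injective_mat U" and dV: "dim_row V = p" "dim_col V = p"
    using U V invertible_mat_iff_injective[OF U(1)] by simp_all
  obtain T where "T \<in> carrier_mat p p" and VT: "V * T = 1\<^sub>m p"
    using invertible_mat_inverse[OF V] by blast
  hence dT: "dim_row T = p" "dim_col T = p" by simp_all
  have "eq_holds (condensed_descr d p c) x2 x1 x0 (T *\<^sub>v u) \<longleftrightarrow> eq_holds e x2 x1 x0 u"
    if x: "dim_vec x2 = d" "dim_vec x1 = d" "dim_vec x0 = d" and u: "dim_vec u = p" for x2 x1 x0 u
  proof -
    have "V *\<^sub>v (T *\<^sub>v u) = u" using mult_mat_vec_assoc[of V T u] VT by (simp add: dV dT u)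
    moreover have "dim_vec (T *\<^sub>v u) = p" by (simp add: dT)
    ultimately show ?thesis using scaled_eq_holds_iff[OF e dU dV eqs x] by metis
  qed
  moreover have "injective_mat T" by (rule injective_matI_left_inverse[of V]) (simp_all add: VT dV dT)
  ultimately show thesis using that dT by blast
qed

section \<open>Input transformations accumulated along a run\<close>

lemma solutions_cong:
  assumes "\<And>n x2 x1 x0. \<lbrakk>n \<ge> n0; dim_vec x2 = d; dim_vec x1 = d; dim_vec x0 = d\<rbrakk> \<Longrightarrow>
      eq_holds (E n) x2 x1 x0 (u n) \<longleftrightarrow> eq_holds (E' n) x2 x1 x0 (u' n)"
  shows "solutions n0 d E u = solutions n0 d E' u'"
proof -
  have "x \<in> solutions n0 d E u \<longleftrightarrow> x \<in> solutions n0 d E' u'" for x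
  proof (cases "\<forall>n\<ge>n0. dim_vec (x n) = d")
    case True
    hence "dim_vec (x n) = d" "dim_vec (x (n + 1)) = d" "dim_vec (x (n + 2)) = d" if "n \<ge> n0" for n
      using that by simp_all
    hence "eq_holds (E n) (x (n + 2)) (x (n + 1)) (x n) (u n) \<longleftrightarrow>
        eq_holds (E' n) (x (n + 2)) (x (n + 1)) (x n) (u' n)" if "n \<ge> n0" for n
      using assms that by blast
    thus ?thesis unfolding solutions_iff by blast
  next
    case False
    thus ?thesis unfolding solutions_iff by blast
  qed
  thus ?thesis by blast
qed

text \<open>\<open>T\<close> is fixed before the input, so one family of matrices serves all input
  sequences and the final coefficients do not depend on the input. Injectivity is recorded because
  input rows must keep full row rank when multiplied by \<open>T\<close>.\<close>

definition input_equivalent ::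
  "nat \<Rightarrow> nat \<Rightarrow> nat \<Rightarrow> (nat \<Rightarrow> descr_eq) \<Rightarrow> (nat \<Rightarrow> descr_eq) \<Rightarrow> (nat \<Rightarrow> real mat) \<Rightarrow> bool" where
  "input_equivalent n0 d p E F T \<longleftrightarrow>
    (\<forall>n\<ge>n0. dim_row (T n) = p \<and> dim_col (T n) = p \<and> injective_mat (T n)) \<and>
    (\<forall>u. (\<forall>n\<ge>n0. dim_vec (u n) = p) \<longrightarrow>
      solutions n0 d E u = solutions n0 d F (\<lambda>n. T n *\<^sub>v u n))"

lemma input_equivalent_refl: "input_equivalent n0 d p E E (\<lambda>_. 1\<^sub>m p)"
  unfolding input_equivalent_def
proof (intro conjI allI impI)
  fix u :: "nat \<Rightarrow> real vec" assume u: "\<forall>n\<ge>n0. dim_vec (u n) = p"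
  show "solutions n0 d E u = solutions n0 d E (\<lambda>n. 1\<^sub>m p *\<^sub>v u n)"
    by (rule solutions_cong) (use u in simp)
qed (simp_all add: injective_one_mat)

lemma input_equivalent_trans:
  assumes T: "input_equivalent n0 d p E F T" and T': "input_equivalent n0 d p F G T'"
  shows "input_equivalent n0 d p E G (\<lambda>n. T' n * T n)"
proof -
  have dT: "dim_row (T n) = p" "dim_col (T n) = p" "injective_mat (T n)"
    "dim_row (T' n) = p" "dim_col (T' n) = p" "injective_mat (T' n)" if "n \<ge> n0" for n
    using T T' that by (simp_all add: input_equivalent_def)
  show ?thesis unfolding input_equivalent_def
  proof (intro conjI allI impI)
    fix u :: "nat \<Rightarrow> real vec" assume u: "\<forall>n\<ge>n0. dim_vec (u n) = p"
    hence "solutions n0 d E u = solutions n0 d F (\<lambda>n. T n *\<^sub>v u n)"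
      using T by (simp add: input_equivalent_def)
    also have "\<dots> = solutions n0 d G (\<lambda>n. T' n *\<^sub>v (T n *\<^sub>v u n))"
      using T' dT by (simp add: input_equivalent_def)
    also have "\<dots> = solutions n0 d G (\<lambda>n. T' n * T n *\<^sub>v u n)"
      by (rule solutions_cong) (use u dT in \<open>simp add: mult_mat_vec_assoc\<close>)
    finally show "solutions n0 d E u = solutions n0 d G (\<lambda>n. T' n * T n *\<^sub>v u n)" .
  qed (simp_all add: dT injective_mat_mult)
qed

lemma input_equivalent_condensed:
  assumes E: "\<And>n. n \<ge> n0 \<Longrightarrow> sized_eq m d p (E n)" and c: "condensed_form n0 m d p E c"
  shows "\<exists>T. input_equivalent n0 d p E (\<lambda>n. condensed_descr d p (c n)) T"
proof -
  define Q where "Q n T \<longleftrightarrow> dim_row T = p \<and> dim_col T = p \<and> injective_mat T \<and>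
    (\<forall>x2 x1 x0 u. dim_vec x2 = d \<longrightarrow> dim_vec x1 = d \<longrightarrow> dim_vec x0 = d \<longrightarrow> dim_vec u = p \<longrightarrow>
      (eq_holds (E n) x2 x1 x0 u \<longleftrightarrow> eq_holds (condensed_descr d p (c n)) x2 x1 x0 (T *\<^sub>v u)))" for n T
  have "\<exists>T. Q n T" if "n \<ge> n0" for n
  proof -
    have "condensed_at m d p (E n) (c n)" using c that by (simp add: condensed_form_def)
    from condensed_at_input_transformation[OF E[OF that] this] show ?thesis
      unfolding Q_def by metis
  qed
  hence "\<exists>T. \<forall>n\<ge>n0. Q n (T n)" by metis
  then obtain T where T: "Q n (T n)" if "n \<ge> n0" for n by blast
  have "input_equivalent n0 d p E (\<lambda>n. condensed_descr d p (c n)) T"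
    unfolding input_equivalent_def
  proof (intro conjI allI impI)
    fix u :: "nat \<Rightarrow> real vec" assume u: "\<forall>n\<ge>n0. dim_vec (u n) = p"
    show "solutions n0 d E u = solutions n0 d (\<lambda>n. condensed_descr d p (c n)) (\<lambda>n. T n *\<^sub>v u n)"
      by (rule solutions_cong) (use u T in \<open>simp add: Q_def\<close>)
  qed (use T in \<open>simp_all add: Q_def\<close>)
  thus ?thesis by blast
qed

lemma input_equivalent_index_reduction:
  assumes "\<And>n. n \<ge> n0 \<Longrightarrow> condensed_blocks d p (c n)" and "index_reduction n0 d p c F"
  shows "input_equivalent n0 d p (\<lambda>n. condensed_descr d p (c n)) F (\<lambda>_. 1\<^sub>m p)"
  unfolding input_equivalent_def
proof (intro conjI allI impI)
  fix u :: "nat \<Rightarrow> real vec" assume u: "\<forall>n\<ge>n0. dim_vec (u n) = p"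
  have "solutions n0 d F u = solutions n0 d (\<lambda>n. condensed_descr d p (c n)) u"
    by (rule solutions_index_reduction[OF assms]) (use u in blast)+
  moreover have "solutions n0 d F u = solutions n0 d F (\<lambda>n. 1\<^sub>m p *\<^sub>v u n)"
    by (rule solutions_cong) (use u in simp)
  ultimately show "solutions n0 d (\<lambda>n. condensed_descr d p (c n)) u
      = solutions n0 d F (\<lambda>n. 1\<^sub>m p *\<^sub>v u n)" by simp
qed (simp_all add: injective_one_mat)

text \<open>Multiplying the input matrix by \<open>T\<close> returns to the original input; it keeps
  zero block rows zero, so the stopped condensed form has the required shape.\<close>

lemma strangeness_free_condensed:
  assumes c: "\<And>n. n \<ge> n0 \<Longrightarrow> condensed_blocks d p (c n)"
    and const: "constant_size n0 c" and stops: "procedure_stops n0 c"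
    and T: "\<And>n. n \<ge> n0 \<Longrightarrow> dim_row (T n) = p \<and> dim_col (T n) = p \<and> injective_mat (T n)"
  shows "strangeness_free n0 d p
    (\<lambda>n. condensed_descr d p (c n)\<lparr>cD := cD (condensed_descr d p (c n)) * T n\<rparr>)"
  unfolding strangeness_free_def
proof (rule exI[of _ "r2 (c n0)"], rule exI[of _ "r1 (c n0)"], rule exI[of _ "r0 (c n0)"],
    rule exI[of _ "phi1 (c n0)"], rule exI[of _ "phi0 (c n0)"], rule exI[of _ "vnum (c n0)"],
    rule exI[of _ "\<lambda>n. cfA1 (c n)"], rule exI[of _ "\<lambda>n. cfB1 (c n)"], rule exI[of _ "\<lambda>n. cfC1 (c n)"],
    rule exI[of _ "\<lambda>n. cfB2 (c n)"], rule exI[of _ "\<lambda>n. cfC2 (c n)"], rule exI[of _ "\<lambda>n. cfC3 (c n)"],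
    rule exI[of _ "\<lambda>n. cfB4 (c n)"], rule exI[of _ "\<lambda>n. cfC4 (c n)"], rule exI[of _ "\<lambda>n. cfC5 (c n)"],
    rule exI[of _ "\<lambda>n. input1 (c n) * T n"], rule exI[of _ "\<lambda>n. input4 p (c n) * T n"],
    rule exI[of _ "\<lambda>n. input5 p (c n) * T n"], rule exI[of _ "\<lambda>n. cff1 (c n)"],
    rule exI[of _ "\<lambda>n. cff2 (c n)"], rule exI[of _ "\<lambda>n. cff3 (c n)"], rule exI[of _ "\<lambda>n. cff4 (c n)"],
    rule exI[of _ "\<lambda>n. cff5 (c n)"], rule exI[of _ "\<lambda>n. cff6 (c n)"], rule allI, rule impI)
  fix n assume n: "n0 \<le> n"
  have size: "r2 (c n0) = r2 (c n)" "r1 (c n0) = r1 (c n)" "r0 (c n0) = r0 (c n)"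
    "phi1 (c n0) = phi1 (c n)" "phi0 (c n0) = phi0 (c n)" "vnum (c n0) = vnum (c n)"
    using const n unfolding constant_size_def by metis+
  have cn: "condensed_blocks d p (c n)" "condensed_blocks d p (c (n + 1))" "condensed_blocks d p (c (n + 2))"
    using c n by simp_all
  note d = condensed_blocks_dims[OF cn(1)] dim_inputs[OF cn(1)]
  have dT: "dim_row (T n) = p" "dim_col (T n) = p" using T[OF n] by simp_all
  have D: "cD (condensed_descr d p (c n)) * T n = vstack p
      [input1 (c n) * T n, 0\<^sub>m (r1 (c n)) p, 0\<^sub>m (r0 (c n)) p, input4 p (c n) * T n,
       input5 p (c n) * T n, 0\<^sub>m (vnum (c n)) p]"
    by (simp add: condensed_descr_def append_rows_mult d dT)
  \<comment> \<open>The stopping condition at time \<open>n + 1\<close> handles the lower two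
    blocks; with the condition at time \<open>n\<close> for the first block, the ranks add up over
    the whole stack.\<close>
  have "no_hidden_redundancy (cfB2 (c (n + 1))) (cfC3 (c (n + 1 + 1)))"
    using stops n unfolding procedure_stops_def by (meson le_add1 le_trans)
  hence "full_row_rank (cfB2 (c (n + 1)) @\<^sub>r cfC3 (c (n + 2)))"
    using condensed_blocks_ranks(2)[OF cn(2)] condensed_blocks_ranks(3)[OF cn(3)]
    by (simp add: no_hidden_redundancy_full_row_rank)
  hence "full_row_rank (cfA1 (c n) @\<^sub>r cfB2 (c (n + 1)) @\<^sub>r cfC3 (c (n + 2)))"
    using stops n condensed_blocks_ranks(1)[OF cn(1)] unfolding procedure_stops_def
    by (blast intro: no_hidden_redundancy_full_row_rank)
  hence rank1: "full_row_rank (vstack d [cfA1 (c n), cfB2 (c (n + 1)), cfC3 (c (n + 2))])"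
    using condensed_blocks_dims[OF cn(3)] by simp
  have "injective_mat (T n)\<^sup>T" using T[OF n] invertible_mat_iff_injective[of "T n" p]
    by (intro injective_transpose_of_invertible[of _ p]) simp_all
  hence "injective_mat ((input4 p (c n) @\<^sub>r input5 p (c n)) * T n)\<^sup>T"
    using inputs_injective_transpose[OF cn(1)] by (simp add: transpose_mult_dim injective_mat_mult d dT)
  hence rank2: "full_row_rank (vstack p [input4 p (c n) * T n, input5 p (c n) * T n])"
    by (simp add: full_row_rank_iff_injective_transpose append_rows_mult d dT)
  show "cfA1 (c n) \<in> carrier_mat (r2 (c n0)) d \<and> cfB1 (c n) \<in> carrier_mat (r2 (c n0)) d \<and>
      cfC1 (c n) \<in> carrier_mat (r2 (c n0)) d \<and> cfB2 (c n) \<in> carrier_mat (r1 (c n0)) d \<and>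
      cfC2 (c n) \<in> carrier_mat (r1 (c n0)) d \<and> cfC3 (c n) \<in> carrier_mat (r0 (c n0)) d \<and>
      cfB4 (c n) \<in> carrier_mat (phi1 (c n0)) d \<and> cfC4 (c n) \<in> carrier_mat (phi1 (c n0)) d \<and>
      cfC5 (c n) \<in> carrier_mat (phi0 (c n0)) d \<and> input1 (c n) * T n \<in> carrier_mat (r2 (c n0)) p \<and>
      input4 p (c n) * T n \<in> carrier_mat (phi1 (c n0)) p \<and>
      input5 p (c n) * T n \<in> carrier_mat (phi0 (c n0)) p \<and> cff1 (c n) \<in> carrier_vec (r2 (c n0)) \<and>
      cff2 (c n) \<in> carrier_vec (r1 (c n0)) \<and> cff3 (c n) \<in> carrier_vec (r0 (c n0)) \<and>
      cff4 (c n) \<in> carrier_vec (phi1 (c n0)) \<and> cff5 (c n) \<in> carrier_vec (phi0 (c n0)) \<and>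
      cff6 (c n) \<in> carrier_vec (vnum (c n0)) \<and>
      cA (condensed_descr d p (c n)\<lparr>cD := cD (condensed_descr d p (c n)) * T n\<rparr>) = vstack d
        [cfA1 (c n), 0\<^sub>m (r1 (c n0)) d, 0\<^sub>m (r0 (c n0)) d, 0\<^sub>m (phi1 (c n0)) d, 0\<^sub>m (phi0 (c n0)) d, 0\<^sub>m (vnum (c n0)) d] \<and>
      cB (condensed_descr d p (c n)\<lparr>cD := cD (condensed_descr d p (c n)) * T n\<rparr>) = vstack d
        [cfB1 (c n), cfB2 (c n), 0\<^sub>m (r0 (c n0)) d, cfB4 (c n), 0\<^sub>m (phi0 (c n0)) d, 0\<^sub>m (vnum (c n0)) d] \<and>
      cC (condensed_descr d p (c n)\<lparr>cD := cD (condensed_descr d p (c n)) * T n\<rparr>) = vstack d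
        [cfC1 (c n), cfC2 (c n), cfC3 (c n), cfC4 (c n), cfC5 (c n), 0\<^sub>m (vnum (c n0)) d] \<and>
      cD (condensed_descr d p (c n)\<lparr>cD := cD (condensed_descr d p (c n)) * T n\<rparr>) = vstack p
        [input1 (c n) * T n, 0\<^sub>m (r1 (c n0)) p, 0\<^sub>m (r0 (c n0)) p, input4 p (c n) * T n,
         input5 p (c n) * T n, 0\<^sub>m (vnum (c n0)) p] \<and>
      rhs (condensed_descr d p (c n)\<lparr>cD := cD (condensed_descr d p (c n)) * T n\<rparr>)
        = cff1 (c n) @\<^sub>v cff2 (c n) @\<^sub>v cff3 (c n) @\<^sub>v cff4 (c n) @\<^sub>v cff5 (c n) @\<^sub>v cff6 (c n) \<and>
      full_row_rank (vstack d [cfA1 (c n), cfB2 (c (n + 1)), cfC3 (c (n + 2))]) \<and>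
      full_row_rank (vstack p [input4 p (c n) * T n, input5 p (c n) * T n])"
    unfolding size descr_eq.select_convs descr_eq.update_convs D
    using rank1 rank2 by (simp add: d dT condensed_descr_def D[unfolded condensed_descr_def descr_eq.select_convs] del: vstack_Cons)
qed

theorem theorem4p7:
  fixes n0 m d p :: nat
    and E :: "nat \<Rightarrow> descr_eq"
    and sys :: "nat \<Rightarrow> nat \<Rightarrow> descr_eq"
    and cf :: "nat \<Rightarrow> nat \<Rightarrow> condensed_eq"
  assumes "descriptor_system n0 m d p E"
    and "regularization_run n0 m d p E sys cf"
    and "\<forall>k. occurs n0 cf k \<longrightarrow> constant_size n0 (cf k)"
  shows "\<exists>F. strangeness_free n0 d p F \<and>
           (\<forall>u. (\<forall>n\<ge>n0. u n \<in> carrier_vec p) \<longrightarrow> solutions n0 d E u = solutions n0 d F u)"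
proof -
  have sys0: "sys 0 = E"
    and run_cf: "\<And>k. occurs n0 cf k \<Longrightarrow> \<exists>c. condensed_form n0 m d p (sys k) c \<Longrightarrow>
      condensed_form n0 m d p (sys k) (cf k)"
    and run_sys: "\<And>k. occurs n0 cf k \<Longrightarrow> \<not> procedure_stops n0 (cf k) \<Longrightarrow>
      \<exists>F. index_reduction n0 d p (cf k) F \<Longrightarrow> index_reduction n0 d p (cf k) (sys (Suc k))"
    using assms(2) unfolding regularization_run_def by blast+
  have occurs_Suc: "occurs n0 cf (Suc k) \<longleftrightarrow> occurs n0 cf k \<and> \<not> procedure_stops n0 (cf k)" for k
    by (auto simp: occurs_def less_Suc_eq)
  \<comment> \<open>The existence results need the sizes, and the choices of the run are correct
    only where these results apply. So \<open>good\<close> is a premise until the induction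
    establishes it for all occurring indices; later systems are arbitrary.\<close>
  define good where "good k \<longleftrightarrow> (\<forall>n\<ge>n0. sized_eq m d p (sys k n))" for k
  have form: "condensed_form n0 m d p (sys k) (cf k)" if "occurs n0 cf k" "good k" for k
    by (rule run_cf[OF that(1)], rule condensed_form_exists) (use that in \<open>simp add: good_def\<close>)
  have blocks: "condensed_blocks d p (cf k n)" if "occurs n0 cf k" "good k" "n \<ge> n0" for k n
    using form[OF that(1,2)] that(3) by (simp add: condensed_form_def condensed_at_iff)
  have reduction: "index_reduction n0 d p (cf k) (sys (Suc k))" if "occurs n0 cf (Suc k)" "good k" for k
    using that occurs_Suc run_sys index_reduction_exists[of n0 d p "cf k"] blocks by blast
  have good: "good k" if "occurs n0 cf k" for k
    using that
  proof (induction k)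
    case 0
    show ?case using assms(1) by (simp add: good_def sys0 descriptor_system_iff)
  next
    case (Suc k)
    hence k: "occurs n0 cf k" "good k" by (simp_all add: occurs_Suc)
    show ?case unfolding good_def
    proof (intro allI impI)
      fix n assume n: "n0 \<le> n"
      obtain S1 S2 Z1 Z2 Z3 Z4 Z5 where
        "reduction_matrices d (cf k n) (cf k (n + 1)) (cf k (n + 2)) S1 S2 Z1 Z2 Z3 Z4 Z5"
        "sys (Suc k) n = reduced_eq d p (cf k n) (cf k (n + 1)) (cf k (n + 2)) S1 S2 Z1 Z2 Z3 Z4 Z5"
        using reduction[OF Suc.prems k(2)] n unfolding index_reduction_def by blast
      moreover have "r2 (cf k n) + r1 (cf k n) + r0 (cf k n) + phi1 (cf k n) + phi0 (cf k n) + vnum (cf k n) = m"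
        using form[OF k] n by (simp add: condensed_form_def condensed_at_iff)
      ultimately show "sized_eq m d p (sys (Suc k) n)"
        using sized_reduced_eq[OF blocks[OF k n]] blocks[OF k, of "n + 1"] n by simp
    qed
  qed
  have "\<exists>K. occurs n0 cf K \<and> procedure_stops n0 (cf K)"
  proof (rule ccontr)
    assume endless: "\<not> ?thesis"
    have occ: "occurs n0 cf k" for k
    proof (induction k)
      case 0
      show ?case by (simp add: occurs_def)
    next
      case (Suc k)
      thus ?case using endless unfolding occurs_Suc by blast
    qed
    have going: "\<not> procedure_stops n0 (cf k)" for k using endless occ by blast
    define \<mu> where "\<mu> k = 2 * r2 (cf k n0) + r1 (cf k n0)" for k
    have "\<mu> (Suc k) < \<mu> k" for k
      unfolding \<mu>_def
    proof (rule index_reduction_measure)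
      show "sized_eq m d p (sys (Suc k) n)" if "n \<ge> n0" for n
        using good[OF occ[of "Suc k"]] that by (simp add: good_def)
      show "condensed_blocks d p (cf k n)" if "n \<ge> n0" for n
        by (rule blocks[OF occ good[OF occ] that])
      show "index_reduction n0 d p (cf k) (sys (Suc k))" by (rule reduction[OF occ good[OF occ]])
      show "condensed_form n0 m d p (sys (Suc k)) (cf (Suc k))" by (rule form[OF occ good[OF occ]])
      show "constant_size n0 (cf k)" "constant_size n0 (cf (Suc k))"
        by (rule assms(3)[rule_format, OF occ])+
      show "\<not> procedure_stops n0 (cf k)" by (rule going)
    qed
    note decrease = this
    \<comment> \<open>Each step costs at least one unit of the measure, so more than
      \<open>\<mu> 0\<close> steps are impossible.\<close>
    have "\<mu> k + k \<le> \<mu> 0" for k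
    proof (induction k)
      case (Suc k)
      show ?case using Suc decrease[of k] by linarith
    qed simp
    from this[of "Suc (\<mu> 0)"] show False by simp
  qed
  then obtain K where K: "occurs n0 cf K" "procedure_stops n0 (cf K)" by blast
  have condensed: "\<exists>T. input_equivalent n0 d p (sys k) (\<lambda>n. condensed_descr d p (cf k n)) T"
    if "occurs n0 cf k" for k
    using input_equivalent_condensed[of n0 m d p "sys k" "cf k"] good[OF that] form[OF that good[OF that]]
    by (simp add: good_def)
  have "\<exists>T. input_equivalent n0 d p E (sys k) T" if "occurs n0 cf k" for k
    using that
  proof (induction k)
    case 0
    show ?case unfolding sys0 using input_equivalent_refl by blast
  next
    case (Suc k)
    hence k: "occurs n0 cf k" by (simp add: occurs_Suc)
    from input_equivalent_index_reduction[OF blocks[OF k good[OF k]] reduction[OF Suc.prems good[OF k]]]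
    show ?case using Suc.IH[OF k] condensed[OF k] input_equivalent_trans by blast
  qed
  with condensed K(1) obtain T
    where T: "input_equivalent n0 d p E (\<lambda>n. condensed_descr d p (cf K n)) T"
    using input_equivalent_trans by blast
  have dT: "dim_row (T n) = p \<and> dim_col (T n) = p \<and> injective_mat (T n)" if "n \<ge> n0" for n
    using T that by (simp add: input_equivalent_def)
  \<comment> \<open>The last condensed form, with the accumulated input change multiplied into its
    input matrix.\<close>
  let ?F = "\<lambda>n. condensed_descr d p (cf K n)\<lparr>cD := cD (condensed_descr d p (cf K n)) * T n\<rparr>"
  note blocksK = blocks[OF K(1) good[OF K(1)]]
  have "strangeness_free n0 d p ?F"
  proof (rule strangeness_free_condensed)
    show "constant_size n0 (cf K)" using assms(3) K(1) by blast
  qed (use blocksK K(2) dT in blast)+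
  moreover have "solutions n0 d E u = solutions n0 d ?F u" if "\<forall>n\<ge>n0. u n \<in> carrier_vec p" for u
  proof -
    have u: "dim_vec (u n) = p" if "n \<ge> n0" for n using \<open>\<forall>n\<ge>n0. u n \<in> carrier_vec p\<close> that by simp
    have "solutions n0 d E u = solutions n0 d (\<lambda>n. condensed_descr d p (cf K n)) (\<lambda>n. T n *\<^sub>v u n)"
      using T u by (simp add: input_equivalent_def)
    also have "\<dots> = solutions n0 d ?F u"
    proof (rule solutions_cong)
      fix n and x2 x1 x0 :: "real vec" assume n: "n0 \<le> n"
      have "dim_col (cD (condensed_descr d p (cf K n))) = p"
        by (simp add: condensed_descr_def dim_inputs[OF blocksK[OF n]])
      thus "eq_holds (condensed_descr d p (cf K n)) x2 x1 x0 (T n *\<^sub>v u n) = eq_holds (?F n) x2 x1 x0 (u n)"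
        using dT[OF n] u[OF n] by (simp add: eq_holds_def mult_mat_vec_assoc)
    qed
    finally show ?thesis .
  qed
  ultimately show ?thesis by blast
qed

end
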